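(* For every crossed complex $\mathbf{C}$, the chain of fibrations $$\cdots \xrightarrow{\eta_{n+2}} P_{n+1}(\mathbf{C})\xrightarrow{\eta_{n+1}} P_n(\mathbf{C})\xrightarrow{\eta_n}\cdots\xrightarrow{\eta_1}P_0(\mathbf{C})$$ is a Postnikov tower for $\mathbf{C}$; that is, its inverse limit in the category of crossed complexes has the same homotopy type as $\mathbf{C}$, and for each $n\ge 1$ the map $\eta_n:P_n(\mathbf{C})\to P_{n-1}(\mathbf{C})$ is a fibration whose fibers are of the type of a $K(\Pi,n)$.
   Context: Groupoids are small. For a groupoid $G$, a $G$-group (resp. $G$-module) is a functor $G\to\mathbf{Gr}$ (resp. $G\to \mathbf{Ab}$); for $t:x\to y$ in $G$ and $u\in C(x)$ write ${}^tu=C(t)(u)$. $\mathrm{End}_G$ is the $G$-group $x\mapsto G(x,x)$ with conjugation action. A crossed module is a triple $(G,C,\delta)$ with $C$ a $G$-group and $\delta:C\to\mathrm{End}_G$ natural such that ${}^{\delta_x(u)}v=uvu^{-1}$ for $u,v\in C(x)$. A morphism $(f,\alpha):(G,C,\delta)\to(G',C',\delta')$ is a functor $f:G\to G'$ (change of base) with a natural $\alpha:C\to C'\circ f$ such that $f(\delta_x(u))=\delta'_{f(x)}(\alpha_x(u))$. $\mathbf{Xm}_G$ is the category of crossed modules over $G$ with morphisms having $f=1_G$. $\mathbf 0_G=(G,0,0)$, $\mathbf 1_G=(G,\mathrm{End}_G,1)$. A $G$-crossed complex $\mathbf{C}$ is a sequence $\cdots\to \mathcal C_{n+1}\xrightarrow{\partial_{n+1}}\mathcal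 C_n\to\cdots\to\mathcal C_2\xrightarrow{\partial_2}\mathbf 1_G$ in $\mathbf{Xm}_G$, $\mathcal C_n=(G,C_n,\delta_n)$, whose consecutive composites are trivial on underlying $G$-groups (so for $n\ge3$, $\delta_n=0$ and $C_n$ is a $G$-module), and such that for $n\ge 3$ the image of $\partial_2$ acts trivially on $C_n$. A morphism $\mathbf C\to\mathbf C'$ is a family of crossed module morphisms $f_n:\mathcal C_n\to\mathcal C_n'$, $n\ge1$ ($\mathcal C_1=\mathbf 1_G$), commuting with the $\partial$'s (all have the same change of base $f_1:G\to G'$). An $n$-crossed complex is one with $\mathcal C_m=\mathbf 0_G$ for $m>n$; $0$-crossed complexes are sets (discrete groupoids), $1$-crossed complexes are groupoids, $2$-crossed complexes are crossed modules. Homotopy groups: $\pi_0(\mathbf C)$ is the set of connected components of $G$; $\pi_1(\mathbf C)=G/\mathrm{Im}(\partial_2)$ is the fundamental groupoid (same objects as $G$); for $n\ge2$, $\pi_n(\mathbf C)$ is the $\pi_1(\mathbf C)$-module $x\mapsto\ker(\partial_n)_x/\mathrm{Im}(\partial_{n+1})_x$. A crossed complex is of the type of a $K(\Pi,m)$ if it is connected and its only nontrivial homotopy group is $\pi_m\cong\Pi$ (for $m=1$, a connected crossed complex with vertex group of $\pi_1$ isomorphic to $\Pi$ and $\pi_i=0$ for $i\geq 2$). Two crossed complexes have the same homotopy type if they are connected by morphisms inducing isomorphisms on $\pi_0$, equivalences on $\pi_1$ and isomorphisms on $\pi_n$, $n\ge2$. $P_n$ is the idempotent endofunctor of the category of crossed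 complexes obtained from the reflector onto $n$-crossed complexes: $P_0(\mathbf C)=\pi_0(\mathbf C)$, $P_1(\mathbf C)=\pi_1(\mathbf C)$, and for $n\ge2$, $P_n(\mathbf C)=(\cdots\to\mathbf 0_G\to\mathcal C_n/\mathrm{Im}\,\partial_{n+1}\xrightarrow{\bar\partial_n}\mathcal C_{n-1}\to\cdots\to\mathcal C_2\to\mathbf 1_G)$ with $\bar\partial_n$ induced by $\partial_n$. The map $\eta_{n+1}:P_{n+1}(\mathbf C)\to P_n(\mathbf C)$ is $P_{n+1}$ applied to the unit $\mathbf C\to P_n(\mathbf C)$: for $n\ge2$ it is trivial in dimension $n+1$, the quotient map $\mathcal C_n\to\mathcal C_n/\mathrm{Im}\,\partial_{n+1}$ in dimension $n$ and the identity in other dimensions; $\eta_1$ is the projection $\pi_1(\mathbf C)\to\pi_0(\mathbf C)$; $\eta_2$ has change of base the projection $G\to\pi_1(\mathbf C)$. A morphism of crossed complexes is a fibration if its change of base functor is a fibration of groupoids and for every $n\ge2$ the natural map of $G$-groups $C_n\to C_n'\circ f_1$ is surjective. The fiber over an object $x$ of the base groupoid of the codomain is the sub-crossed complex of the domain consisting of objects sent to $x$, arrows sent to $1_x$ and, in dimensions $\ge2$, elements sent to the neutral element. *)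

theory Defs
  imports "HOL-Algebra.Coset"
begin

section \<open>Groupoids\<close>

text \<open>The value \<open>gcomp G g f\<close> is the composite \<open>g \<circ> f\<close>; it is meaningful when
  \<open>gtgt G f = gsrc G g\<close>.\<close>

record ('o, 'm) gpd =
  gobj :: "'o set"
  garr :: "'m set"
  gsrc :: "'m \<Rightarrow> 'o"
  gtgt :: "'m \<Rightarrow> 'o"
  gid :: "'o \<Rightarrow> 'm"
  gcomp :: "'m \<Rightarrow> 'm \<Rightarrow> 'm"

definition ghom :: "('o, 'm) gpd \<Rightarrow> 'o \<Rightarrow> 'o \<Rightarrow> 'm set" where
  "ghom G x y = {g \<in> garr G. gsrc G g = x \<and> gtgt G g = y}"

definition groupoid :: "('o, 'm) gpd \<Rightarrow> bool" where
  "groupoid G \<longleftrightarrow>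
     (\<forall>g\<in>garr G. gsrc G g \<in> gobj G \<and> gtgt G g \<in> gobj G) \<and>
     (\<forall>x\<in>gobj G. gid G x \<in> ghom G x x) \<and>
     (\<forall>x\<in>gobj G. \<forall>y\<in>gobj G. \<forall>z\<in>gobj G. \<forall>f\<in>ghom G x y. \<forall>g\<in>ghom G y z.
        gcomp G g f \<in> ghom G x z) \<and>
     (\<forall>x\<in>gobj G. \<forall>y\<in>gobj G. \<forall>f\<in>ghom G x y.
        gcomp G f (gid G x) = f \<and> gcomp G (gid G y) f = f) \<and>
     (\<forall>w\<in>gobj G. \<forall>x\<in>gobj G. \<forall>y\<in>gobj G. \<forall>z\<in>gobj G.
        \<forall>f\<in>ghom G w x. \<forall>g\<in>ghom G x y. \<forall>h\<in>ghom G y z.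
          gcomp G h (gcomp G g f) = gcomp G (gcomp G h g) f) \<and>
     (\<forall>x\<in>gobj G. \<forall>y\<in>gobj G. \<forall>f\<in>ghom G x y. \<exists>g\<in>ghom G y x.
        gcomp G g f = gid G x \<and> gcomp G f g = gid G y)"

definition ginv :: "('o, 'm) gpd \<Rightarrow> 'm \<Rightarrow> 'm" where
  "ginv G f = (THE g. g \<in> ghom G (gtgt G f) (gsrc G f) \<and>
     gcomp G g f = gid G (gsrc G f) \<and> gcomp G f g = gid G (gtgt G f))"

record ('o, 'm, 'p, 'q) fctr =
  fo :: "'o \<Rightarrow> 'p"
  fa :: "'m \<Rightarrow> 'q"

definition is_functor ::
  "('o, 'm) gpd \<Rightarrow> ('p, 'q) gpd \<Rightarrow> ('o, 'm, 'p, 'q) fctr \<Rightarrow> bool" where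
  "is_functor G H F \<longleftrightarrow> groupoid G \<and> groupoid H \<and>
     (\<forall>x\<in>gobj G. fo F x \<in> gobj H) \<and>
     (\<forall>x\<in>gobj G. \<forall>y\<in>gobj G. \<forall>g\<in>ghom G x y. fa F g \<in> ghom H (fo F x) (fo F y)) \<and>
     (\<forall>x\<in>gobj G. fa F (gid G x) = gid H (fo F x)) \<and>
     (\<forall>x\<in>gobj G. \<forall>y\<in>gobj G. \<forall>z\<in>gobj G. \<forall>f\<in>ghom G x y. \<forall>g\<in>ghom G y z.
        fa F (gcomp G g f) = gcomp H (fa F g) (fa F f))"

definition fctr_id :: "('o, 'm, 'o, 'm) fctr" where
  "fctr_id = \<lparr>fo = (\<lambda>x. x), fa = (\<lambda>g. g)\<rparr>"

definition fctr_comp ::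
  "('p, 'q, 'r, 's) fctr \<Rightarrow> ('o, 'm, 'p, 'q) fctr \<Rightarrow> ('o, 'm, 'r, 's) fctr" where
  "fctr_comp K F = \<lparr>fo = (\<lambda>x. fo K (fo F x)), fa = (\<lambda>g. fa K (fa F g))\<rparr>"

text \<open>Between groupoids every natural transformation is invertible.\<close>

definition is_natural ::
  "('o, 'm) gpd \<Rightarrow> ('p, 'q) gpd \<Rightarrow> ('o, 'm, 'p, 'q) fctr \<Rightarrow> ('o, 'm, 'p, 'q) fctr
     \<Rightarrow> ('o \<Rightarrow> 'q) \<Rightarrow> bool" where
  "is_natural G H F K \<tau> \<longleftrightarrow>
     (\<forall>x\<in>gobj G. \<tau> x \<in> ghom H (fo F x) (fo K x)) \<and>
     (\<forall>x\<in>gobj G. \<forall>y\<in>gobj G. \<forall>g\<in>ghom G x y.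
        gcomp H (\<tau> y) (fa F g) = gcomp H (fa K g) (\<tau> x))"

definition is_equivalence ::
  "('o, 'm) gpd \<Rightarrow> ('p, 'q) gpd \<Rightarrow> ('o, 'm, 'p, 'q) fctr \<Rightarrow> bool" where
  "is_equivalence G H F \<longleftrightarrow> is_functor G H F \<and>
     (\<exists>K. is_functor H G K \<and>
        (\<exists>\<sigma>. is_natural G G (fctr_comp K F) fctr_id \<sigma>) \<and>
        (\<exists>\<tau>. is_natural H H (fctr_comp F K) fctr_id \<tau>))"

definition groupoid_fibration ::
  "('o, 'm) gpd \<Rightarrow> ('p, 'q) gpd \<Rightarrow> ('o, 'm, 'p, 'q) fctr \<Rightarrow> bool" where
  "groupoid_fibration G H F \<longleftrightarrow> is_functor G H F \<and>
     (\<forall>x\<in>gobj G. \<forall>h\<in>garr H. gsrc H h = fo F x \<longrightarrow>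
        (\<exists>g\<in>garr G. gsrc G g = x \<and> fa F g = h))"

definition component :: "('o, 'm) gpd \<Rightarrow> 'o \<Rightarrow> 'o set" where
  "component G x = {y \<in> gobj G. ghom G x y \<noteq> {}}"


section \<open>\<open>G\<close>-groups and crossed modules\<close>

text \<open>For \<open>t : x \<rightarrow> y\<close> and \<open>u \<in> C(x)\<close>, the element \<open>C(t)(u)\<close> is \<open>act A t u\<close>.\<close>

record ('o, 'm, 'a) ggrp =
  grp :: "'o \<Rightarrow> 'a monoid"
  act :: "'m \<Rightarrow> 'a \<Rightarrow> 'a"

record ('o, 'm, 'a) xmod = "('o, 'm, 'a) ggrp" +
  dlt :: "'o \<Rightarrow> 'a \<Rightarrow> 'm"

definition G_group :: "('o, 'm) gpd \<Rightarrow> ('o, 'm, 'a, 'z) ggrp_scheme \<Rightarrow> bool" where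
  "G_group G A \<longleftrightarrow> groupoid G \<and>
     (\<forall>x\<in>gobj G. group (grp A x)) \<and>
     (\<forall>x\<in>gobj G. \<forall>y\<in>gobj G. \<forall>t\<in>ghom G x y. act A t \<in> hom (grp A x) (grp A y)) \<and>
     (\<forall>x\<in>gobj G. \<forall>u\<in>carrier (grp A x). act A (gid G x) u = u) \<and>
     (\<forall>x\<in>gobj G. \<forall>y\<in>gobj G. \<forall>z\<in>gobj G. \<forall>s\<in>ghom G x y. \<forall>t\<in>ghom G y z.
        \<forall>u\<in>carrier (grp A x). act A (gcomp G t s) u = act A t (act A s u))"

definition G_group_map ::
  "('o, 'm) gpd \<Rightarrow> ('o, 'm, 'a, 'z) ggrp_scheme \<Rightarrow> ('o, 'm, 'b, 'w) ggrp_scheme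
     \<Rightarrow> ('o \<Rightarrow> 'a \<Rightarrow> 'b) \<Rightarrow> bool" where
  "G_group_map G A B \<alpha> \<longleftrightarrow>
     (\<forall>x\<in>gobj G. \<alpha> x \<in> hom (grp A x) (grp B x)) \<and>
     (\<forall>x\<in>gobj G. \<forall>y\<in>gobj G. \<forall>t\<in>ghom G x y. \<forall>u\<in>carrier (grp A x).
        \<alpha> y (act A t u) = act B t (\<alpha> x u))"

definition pullback ::
  "('o, 'm, 'p, 'q) fctr \<Rightarrow> ('p, 'q, 'b, 'w) ggrp_scheme \<Rightarrow> ('o, 'm, 'b) ggrp" where
  "pullback F B = \<lparr>grp = (\<lambda>x. grp B (fo F x)), act = (\<lambda>t. act B (fa F t))\<rparr>"

definition End_group :: "('o, 'm) gpd \<Rightarrow> 'o \<Rightarrow> 'm monoid" where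
  "End_group G x = \<lparr>carrier = ghom G x x, monoid.mult = gcomp G, one = gid G x\<rparr>"

definition End_G :: "('o, 'm) gpd \<Rightarrow> ('o, 'm, 'm) ggrp" where
  "End_G G = \<lparr>grp = End_group G, act = (\<lambda>t g. gcomp G (gcomp G t g) (ginv G t))\<rparr>"

definition crossed_module :: "('o, 'm) gpd \<Rightarrow> ('o, 'm, 'a) xmod \<Rightarrow> bool" where
  "crossed_module G M \<longleftrightarrow> G_group G M \<and> G_group_map G M (End_G G) (dlt M) \<and>
     (\<forall>x\<in>gobj G. \<forall>u\<in>carrier (grp M x). \<forall>v\<in>carrier (grp M x).
        act M (dlt M x u) v = u \<otimes>\<^bsub>grp M x\<^esub> v \<otimes>\<^bsub>grp M x\<^esub> inv\<^bsub>grp M x\<^esub> u)"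

definition xmod_morphism ::
  "('o, 'm) gpd \<Rightarrow> ('o, 'm, 'a) xmod \<Rightarrow> ('p, 'q) gpd \<Rightarrow> ('p, 'q, 'b) xmod
     \<Rightarrow> ('o, 'm, 'p, 'q) fctr \<Rightarrow> ('o \<Rightarrow> 'a \<Rightarrow> 'b) \<Rightarrow> bool" where
  "xmod_morphism G M H N F \<alpha> \<longleftrightarrow>
     crossed_module G M \<and> crossed_module H N \<and> is_functor G H F \<and>
     G_group_map G M (pullback F N) \<alpha> \<and>
     (\<forall>x\<in>gobj G. \<forall>u\<in>carrier (grp M x). fa F (dlt M x u) = dlt N (fo F x) (\<alpha> x u))"

text \<open>Morphisms of the category of crossed modules over a fixed groupoid.\<close>

abbreviation Xm_morphism ::
  "('o, 'm) gpd \<Rightarrow> ('o, 'm, 'a) xmod \<Rightarrow> ('o, 'm, 'b) xmod \<Rightarrow> ('o \<Rightarrow> 'a \<Rightarrow> 'b) \<Rightarrow> bool" where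
  "Xm_morphism G M N \<alpha> \<equiv> xmod_morphism G M G N fctr_id \<alpha>"

definition one_xmod :: "('o, 'm) gpd \<Rightarrow> ('o, 'm, 'm) xmod" where
  "one_xmod G = \<lparr>grp = grp (End_G G), act = act (End_G G), dlt = (\<lambda>x g. g)\<rparr>"

text \<open>The zero crossed module; \<open>e\<close> names the only element of each of its groups.\<close>

definition zero_xmod :: "('o, 'm) gpd \<Rightarrow> 'a \<Rightarrow> ('o, 'm, 'a) xmod" where
  "zero_xmod G e = \<lparr>grp = (\<lambda>x. \<lparr>carrier = {e}, monoid.mult = (\<lambda>u v. e), one = e\<rparr>),
     act = (\<lambda>t u. e), dlt = (\<lambda>x u. gid G x)\<rparr>"


section \<open>Crossed complexes\<close>

text \<open>
  The crossed modules \<open>xm C n\<close> matter for \<open>n \<ge> 2\<close> only, and the boundaries \<open>bd C n\<close> for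
  \<open>n \<ge> 3\<close> only.  The boundary from dimension 2 to dimension 1 is the separate field \<open>bd2\<close>,
  since its values are arrows of the base groupoid.  Using one element type for all
  dimensions and all objects is no restriction, as the groups are given by their carriers.
\<close>

record ('o, 'm, 'a) ccx =
  base :: "('o, 'm) gpd"
  xm :: "nat \<Rightarrow> ('o, 'm, 'a) xmod"
  bd2 :: "'o \<Rightarrow> 'a \<Rightarrow> 'm"
  bd :: "nat \<Rightarrow> 'o \<Rightarrow> 'a \<Rightarrow> 'a"

abbreviation cgrp :: "('o, 'm, 'a) ccx \<Rightarrow> nat \<Rightarrow> 'o \<Rightarrow> 'a monoid" where
  "cgrp C n x \<equiv> grp (xm C n) x"

definition crossed_complex :: "('o, 'm, 'a) ccx \<Rightarrow> bool" where
  "crossed_complex C \<longleftrightarrow> groupoid (base C) \<and>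
     (\<forall>n\<ge>2. crossed_module (base C) (xm C n)) \<and>
     Xm_morphism (base C) (xm C 2) (one_xmod (base C)) (bd2 C) \<and>
     (\<forall>n\<ge>3. Xm_morphism (base C) (xm C n) (xm C (n - 1)) (bd C n)) \<and>
     (\<forall>x\<in>gobj (base C). \<forall>u\<in>carrier (cgrp C 3 x). bd2 C x (bd C 3 x u) = gid (base C) x) \<and>
     (\<forall>n\<ge>4. \<forall>x\<in>gobj (base C). \<forall>u\<in>carrier (cgrp C n x).
        bd C (n - 1) x (bd C n x u) = \<one>\<^bsub>cgrp C (n - 2) x\<^esub>) \<and>
     (\<forall>n\<ge>3. \<forall>x\<in>gobj (base C). \<forall>v\<in>carrier (cgrp C 2 x). \<forall>u\<in>carrier (cgrp C n x).
        act (xm C n) (bd2 C x v) u = u)"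

record ('o, 'm, 'a, 'p, 'q, 'b) cmor =
  mbase :: "('o, 'm, 'p, 'q) fctr"
  mcmp :: "nat \<Rightarrow> 'o \<Rightarrow> 'a \<Rightarrow> 'b"

text \<open>The component in dimension 1 of a morphism is determined by its change of base, so only
  the components in dimensions \<open>n \<ge> 2\<close> are recorded.\<close>

definition cc_morphism ::
  "('o, 'm, 'a) ccx \<Rightarrow> ('p, 'q, 'b) ccx \<Rightarrow> ('o, 'm, 'a, 'p, 'q, 'b) cmor \<Rightarrow> bool" where
  "cc_morphism C D f \<longleftrightarrow> crossed_complex C \<and> crossed_complex D \<and>
     is_functor (base C) (base D) (mbase f) \<and>
     (\<forall>n\<ge>2. xmod_morphism (base C) (xm C n) (base D) (xm D n) (mbase f) (mcmp f n)) \<and>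
     (\<forall>x\<in>gobj (base C). \<forall>u\<in>carrier (cgrp C 2 x).
        fa (mbase f) (bd2 C x u) = bd2 D (fo (mbase f) x) (mcmp f 2 x u)) \<and>
     (\<forall>n\<ge>3. \<forall>x\<in>gobj (base C). \<forall>u\<in>carrier (cgrp C n x).
        mcmp f (n - 1) x (bd C n x u) = bd D n (fo (mbase f) x) (mcmp f n x u))"

definition cc_comp ::
  "('p, 'q, 'b, 'r, 's, 'c) cmor \<Rightarrow> ('o, 'm, 'a, 'p, 'q, 'b) cmor
     \<Rightarrow> ('o, 'm, 'a, 'r, 's, 'c) cmor" where
  "cc_comp g f = \<lparr>mbase = fctr_comp (mbase g) (mbase f),
     mcmp = (\<lambda>n x u. mcmp g n (fo (mbase f) x) (mcmp f n x u))\<rparr>"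

text \<open>Equality of morphisms with domain \<open>C\<close>: values outside the carriers are irrelevant.\<close>

definition cc_mor_eq ::
  "('o, 'm, 'a) ccx \<Rightarrow> ('o, 'm, 'a, 'p, 'q, 'b) cmor \<Rightarrow> ('o, 'm, 'a, 'p, 'q, 'b) cmor
     \<Rightarrow> bool" where
  "cc_mor_eq C f g \<longleftrightarrow>
     (\<forall>x\<in>gobj (base C). fo (mbase f) x = fo (mbase g) x) \<and>
     (\<forall>t\<in>garr (base C). fa (mbase f) t = fa (mbase g) t) \<and>
     (\<forall>n\<ge>2. \<forall>x\<in>gobj (base C). \<forall>u\<in>carrier (cgrp C n x). mcmp f n x u = mcmp g n x u)"


section \<open>Homotopy groups and homotopy types\<close>

definition bd2_im :: "('o, 'm, 'a) ccx \<Rightarrow> 'o \<Rightarrow> 'm set" where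
  "bd2_im C x = bd2 C x ` carrier (cgrp C 2 x)"

definition bd_im :: "('o, 'm, 'a) ccx \<Rightarrow> nat \<Rightarrow> 'o \<Rightarrow> 'a set" where
  "bd_im C n x = bd C n x ` carrier (cgrp C n x)"

definition bd_ker :: "('o, 'm, 'a) ccx \<Rightarrow> nat \<Rightarrow> 'o \<Rightarrow> 'a set" where
  "bd_ker C n x = (if n = 2 then {u \<in> carrier (cgrp C 2 x). bd2 C x u = gid (base C) x}
     else {u \<in> carrier (cgrp C n x). bd C n x u = \<one>\<^bsub>cgrp C (n - 1) x\<^esub>})"

definition pi0 :: "('o, 'm, 'a) ccx \<Rightarrow> 'o set set" where
  "pi0 C = component (base C) ` gobj (base C)"

definition pi1_class :: "('o, 'm, 'a) ccx \<Rightarrow> 'm \<Rightarrow> 'm set" where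
  "pi1_class C g = {gcomp (base C) d g | d. d \<in> bd2_im C (gtgt (base C) g)}"

text \<open>All arrows in a class have the same source and the same target.\<close>

definition pi1 :: "('o, 'm, 'a) ccx \<Rightarrow> ('o, 'm set) gpd" where
  "pi1 C = (let G = base C in
     \<lparr>gobj = gobj G, garr = pi1_class C ` garr G,
      gsrc = (\<lambda>A. the_elem (gsrc G ` A)), gtgt = (\<lambda>A. the_elem (gtgt G ` A)),
      gid = (\<lambda>x. pi1_class C (gid G x)),
      gcomp = (\<lambda>B A. {gcomp G b a | a b. a \<in> A \<and> b \<in> B})\<rparr>)"

text \<open>For \<open>n \<ge> 2\<close>.\<close>

definition pin :: "('o, 'm, 'a) ccx \<Rightarrow> nat \<Rightarrow> 'o \<Rightarrow> 'a set monoid" where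
  "pin C n x = ((cgrp C n x)\<lparr>carrier := bd_ker C n x\<rparr>) Mod (bd_im C (n + 1) x)"

text \<open>In the maps induced on quotients, the unions are unions of copies of a single class.\<close>

definition pi0_map ::
  "('p, 'q, 'b) ccx \<Rightarrow> ('o, 'm, 'a, 'p, 'q, 'b) cmor \<Rightarrow> 'o set \<Rightarrow> 'p set" where
  "pi0_map D f c = (\<Union>x\<in>c. component (base D) (fo (mbase f) x))"

definition pi1_map ::
  "('p, 'q, 'b) ccx \<Rightarrow> ('o, 'm, 'a, 'p, 'q, 'b) cmor \<Rightarrow> ('o, 'm set, 'p, 'q set) fctr" where
  "pi1_map D f = \<lparr>fo = fo (mbase f), fa = (\<lambda>A. \<Union>g\<in>A. pi1_class D (fa (mbase f) g))\<rparr>"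

definition pin_map ::
  "('p, 'q, 'b) ccx \<Rightarrow> ('o, 'm, 'a, 'p, 'q, 'b) cmor \<Rightarrow> nat \<Rightarrow> 'o \<Rightarrow> 'a set \<Rightarrow> 'b set" where
  "pin_map D f n x U = (let y = fo (mbase f) x in
     \<Union>u\<in>U. bd_im D (n + 1) y #>\<^bsub>cgrp D n y\<^esub> mcmp f n x u)"

text \<open>The maps induced on \<open>\<pi>\<^sub>n\<close> are always compatible with the actions of \<open>\<pi>\<^sub>1\<close>, so they are
  isomorphisms of modules as soon as they are isomorphisms of groups at each object.\<close>

definition weak_equivalence ::
  "('o, 'm, 'a) ccx \<Rightarrow> ('p, 'q, 'b) ccx \<Rightarrow> ('o, 'm, 'a, 'p, 'q, 'b) cmor \<Rightarrow> bool" where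
  "weak_equivalence C D f \<longleftrightarrow> cc_morphism C D f \<and>
     bij_betw (pi0_map D f) (pi0 C) (pi0 D) \<and>
     is_equivalence (pi1 C) (pi1 D) (pi1_map D f) \<and>
     (\<forall>n\<ge>2. \<forall>x\<in>gobj (base C). pin_map D f n x \<in> iso (pin C n x) (pin D n (fo (mbase f) x)))"

text \<open>
  Two crossed complexes have the same homotopy type if they are connected by a zigzag of weak
  equivalences.  The intermediate complexes live on the types of one of the two ends.
\<close>

definition weq_step :: "('o, 'm, 'a) ccx \<Rightarrow> ('p, 'q, 'b) ccx \<Rightarrow> bool" where
  "weq_step C D \<longleftrightarrow> (\<exists>f. weak_equivalence C D f) \<or> (\<exists>g. weak_equivalence D C g)"

definition same_homotopy_type :: "('o, 'm, 'a) ccx \<Rightarrow> ('p, 'q, 'b) ccx \<Rightarrow> bool" where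
  "same_homotopy_type C D \<longleftrightarrow>
     (\<exists>C' D'. weq_step\<^sup>*\<^sup>* C C' \<and> weq_step C' D' \<and> weq_step\<^sup>*\<^sup>* D' D)"

definition cc_connected :: "('o, 'm, 'a) ccx \<Rightarrow> bool" where
  "cc_connected C \<longleftrightarrow> (\<exists>c. pi0 C = {c})"

text \<open>The group \<open>K\<close> itself is allowed to be trivial.\<close>

definition of_type_K :: "('o, 'm, 'a) ccx \<Rightarrow> 'g monoid \<Rightarrow> nat \<Rightarrow> bool" where
  "of_type_K C K m \<longleftrightarrow> crossed_complex C \<and> cc_connected C \<and> m \<ge> 1 \<and>
     (if m = 1 then group K else comm_group K) \<and>
     (\<forall>x\<in>gobj (base C).
        (if m = 1 then End_group (pi1 C) x \<cong> K
         else carrier (End_group (pi1 C) x) = {gid (pi1 C) x}) \<and>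
        (\<forall>n\<ge>2. if n = m then pin C n x \<cong> K else carrier (pin C n x) = {\<one>\<^bsub>pin C n x\<^esub>}))"


section \<open>Fibrations and fibers\<close>

definition cc_fibration ::
  "('o, 'm, 'a) ccx \<Rightarrow> ('p, 'q, 'b) ccx \<Rightarrow> ('o, 'm, 'a, 'p, 'q, 'b) cmor \<Rightarrow> bool" where
  "cc_fibration C D f \<longleftrightarrow> cc_morphism C D f \<and>
     groupoid_fibration (base C) (base D) (mbase f) \<and>
     (\<forall>n\<ge>2. \<forall>x\<in>gobj (base C).
        mcmp f n x ` carrier (cgrp C n x) = carrier (cgrp D n (fo (mbase f) x)))"

definition cc_fiber ::
  "('o, 'm, 'a) ccx \<Rightarrow> ('p, 'q, 'b) ccx \<Rightarrow> ('o, 'm, 'a, 'p, 'q, 'b) cmor \<Rightarrow> 'p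
     \<Rightarrow> ('o, 'm, 'a) ccx" where
  "cc_fiber C D f x = C
     \<lparr>base := (base C)
        \<lparr>gobj := {y \<in> gobj (base C). fo (mbase f) y = x},
         garr := {g \<in> garr (base C). fa (mbase f) g = gid (base D) x}\<rparr>,
      xm := (\<lambda>n. (xm C n)\<lparr>grp := (\<lambda>y. (cgrp C n y)
        \<lparr>carrier := {u \<in> carrier (cgrp C n y). mcmp f n y u = \<one>\<^bsub>cgrp D n x\<^esub>}\<rparr>)\<rparr>)\<rparr>"


section \<open>Inverse limits of towers\<close>

text \<open>A tower consists of crossed complexes \<open>T n\<close> and morphisms \<open>e n : T n \<rightarrow> T (n - 1)\<close> for
  \<open>n \<ge> 1\<close>; the value \<open>e 0\<close> is irrelevant.\<close>

text \<open>
  The universal property.  HOL does not allow quantification over types within a formula, so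
  the types of the test complexes \<open>X\<close> are a parameter.
\<close>

definition is_inverse_limit ::
  "('x \<times> 'y \<times> 'z) itself \<Rightarrow> (nat \<Rightarrow> ('o, 'm, 'a) ccx)
     \<Rightarrow> (nat \<Rightarrow> ('o, 'm, 'a, 'o, 'm, 'a) cmor)
     \<Rightarrow> ('p, 'q, 'b) ccx \<Rightarrow> (nat \<Rightarrow> ('p, 'q, 'b, 'o, 'm, 'a) cmor) \<Rightarrow> bool" where
  "is_inverse_limit _ T e L p \<longleftrightarrow> crossed_complex L \<and>
     (\<forall>n. cc_morphism L (T n) (p n)) \<and>
     (\<forall>n. cc_mor_eq L (cc_comp (e (Suc n)) (p (Suc n))) (p n)) \<and>
     (\<forall>(X :: ('x, 'y, 'z) ccx) q.
        crossed_complex X \<and> (\<forall>n. cc_morphism X (T n) (q n)) \<and>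
        (\<forall>n. cc_mor_eq X (cc_comp (e (Suc n)) (q (Suc n))) (q n)) \<longrightarrow>
        (\<exists>u. cc_morphism X L u \<and> (\<forall>n. cc_mor_eq X (cc_comp (p n) u) (q n)) \<and>
           (\<forall>v. cc_morphism X L v \<and> (\<forall>n. cc_mor_eq X (cc_comp (p n) v) (q n)) \<longrightarrow>
              cc_mor_eq X v u)))"

text \<open>The standard model: compatible sequences, with pointwise operations.\<close>

definition lim_base ::
  "(nat \<Rightarrow> ('o, 'm, 'a) ccx) \<Rightarrow> (nat \<Rightarrow> ('o, 'm, 'a, 'o, 'm, 'a) cmor)
     \<Rightarrow> (nat \<Rightarrow> 'o, nat \<Rightarrow> 'm) gpd" where
  "lim_base T e =
     \<lparr>gobj = {X. \<forall>n. X n \<in> gobj (base (T n)) \<and> fo (mbase (e (Suc n))) (X (Suc n)) = X n},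
      garr = {A. \<forall>n. A n \<in> garr (base (T n)) \<and> fa (mbase (e (Suc n))) (A (Suc n)) = A n},
      gsrc = (\<lambda>A n. gsrc (base (T n)) (A n)), gtgt = (\<lambda>A n. gtgt (base (T n)) (A n)),
      gid = (\<lambda>X n. gid (base (T n)) (X n)),
      gcomp = (\<lambda>B A n. gcomp (base (T n)) (B n) (A n))\<rparr>"

definition lim_xm ::
  "(nat \<Rightarrow> ('o, 'm, 'a) ccx) \<Rightarrow> (nat \<Rightarrow> ('o, 'm, 'a, 'o, 'm, 'a) cmor)
     \<Rightarrow> nat \<Rightarrow> (nat \<Rightarrow> 'o, nat \<Rightarrow> 'm, nat \<Rightarrow> 'a) xmod" where
  "lim_xm T e m =
     \<lparr>grp = (\<lambda>X.
        \<lparr>carrier = {u. \<forall>n. u n \<in> carrier (cgrp (T n) m (X n)) \<and>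
                         mcmp (e (Suc n)) m (X (Suc n)) (u (Suc n)) = u n},
         monoid.mult = (\<lambda>u v n. u n \<otimes>\<^bsub>cgrp (T n) m (X n)\<^esub> v n),
         one = (\<lambda>n. \<one>\<^bsub>cgrp (T n) m (X n)\<^esub>)\<rparr>),
      act = (\<lambda>A u n. act (xm (T n) m) (A n) (u n)),
      dlt = (\<lambda>X u n. dlt (xm (T n) m) (X n) (u n))\<rparr>"

definition inverse_limit ::
  "(nat \<Rightarrow> ('o, 'm, 'a) ccx) \<Rightarrow> (nat \<Rightarrow> ('o, 'm, 'a, 'o, 'm, 'a) cmor)
     \<Rightarrow> (nat \<Rightarrow> 'o, nat \<Rightarrow> 'm, nat \<Rightarrow> 'a) ccx" where
  "inverse_limit T e =
     \<lparr>base = lim_base T e, xm = lim_xm T e,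
      bd2 = (\<lambda>X u n. bd2 (T n) (X n) (u n)),
      bd = (\<lambda>m X u n. bd (T n) m (X n) (u n))\<rparr>"

definition lim_proj ::
  "nat \<Rightarrow> (nat \<Rightarrow> 'o, nat \<Rightarrow> 'm, nat \<Rightarrow> 'a, 'o, 'm, 'a) cmor" where
  "lim_proj n = \<lparr>mbase = \<lparr>fo = (\<lambda>X. X n), fa = (\<lambda>A. A n)\<rparr>, mcmp = (\<lambda>m X u. u n)\<rparr>"


section \<open>The tower of the truncations \<open>P\<^sub>n\<close>\<close>

text \<open>
  All the complexes \<open>P C n\<close> must have the same type in order to form a tower.  Since connected
  components and cosets are sets, they are complexes on sets of objects, sets of arrows and
  sets of elements; whatever \<open>P\<^sub>n\<close> leaves unchanged occurs as singletons.  Thus an object \<open>x\<close>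
  is \<open>{x}\<close> for \<open>n \<ge> 1\<close>, an arrow \<open>g\<close> is \<open>{g}\<close> for \<open>n \<ge> 2\<close>, and the group in a dimension
  \<open>m < n\<close> is the quotient of the original one by the trivial subgroup.  In the discrete
  groupoid \<open>P\<^sub>0\<close>, the identity arrow of a component is the set of all arrows in it.
\<close>

definition component_arrows :: "('o, 'm, 'a) ccx \<Rightarrow> 'o set \<Rightarrow> 'm set" where
  "component_arrows C c = {g \<in> garr (base C). gsrc (base C) g \<in> c}"

definition P_base :: "('o, 'm, 'a) ccx \<Rightarrow> nat \<Rightarrow> ('o set, 'm set) gpd" where
  "P_base C n = (let G = base C in
     if n = 0 then
       \<lparr>gobj = pi0 C, garr = component_arrows C ` pi0 C,
        gsrc = (\<lambda>A. gsrc G ` A), gtgt = (\<lambda>A. gtgt G ` A),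
        gid = component_arrows C, gcomp = (\<lambda>B A. A)\<rparr>
     else if n = 1 then
       \<lparr>gobj = {{x} | x. x \<in> gobj (pi1 C)}, garr = garr (pi1 C),
        gsrc = (\<lambda>A. {gsrc (pi1 C) A}), gtgt = (\<lambda>A. {gtgt (pi1 C) A}),
        gid = (\<lambda>X. gid (pi1 C) (the_elem X)), gcomp = gcomp (pi1 C)\<rparr>
     else
       \<lparr>gobj = {{x} | x. x \<in> gobj G}, garr = {{g} | g. g \<in> garr G},
        gsrc = (\<lambda>A. {gsrc G (the_elem A)}), gtgt = (\<lambda>A. {gtgt G (the_elem A)}),
        gid = (\<lambda>X. {gid G (the_elem X)}),
        gcomp = (\<lambda>B A. {gcomp G (the_elem B) (the_elem A)})\<rparr>)"

text \<open>In the case \<open>2 \<le> m \<le> n\<close>, actions and boundaries of cosets are taken elementwise.\<close>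

definition P_xm :: "('o, 'm, 'a) ccx \<Rightarrow> nat \<Rightarrow> nat \<Rightarrow> ('o set, 'm set, 'a set) xmod" where
  "P_xm C n m =
     (if m \<le> n then
       \<lparr>grp = (\<lambda>X. let x = the_elem X in
          cgrp C m x Mod (if m < n then {\<one>\<^bsub>cgrp C m x\<^esub>} else bd_im C (n + 1) x)),
        act = (\<lambda>A U. act (xm C m) (the_elem A) ` U),
        dlt = (\<lambda>X U. dlt (xm C m) (the_elem X) ` U)\<rparr>
      else zero_xmod (P_base C n) {})"

definition P :: "('o, 'm, 'a) ccx \<Rightarrow> nat \<Rightarrow> ('o set, 'm set, 'a set) ccx" where
  "P C n =
     \<lparr>base = P_base C n, xm = P_xm C n,
      bd2 = (\<lambda>X U. if 2 \<le> n then bd2 C (the_elem X) ` U else gid (P_base C n) X),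
      bd = (\<lambda>m X U. if m \<le> n then bd C m (the_elem X) ` U
                     else \<one>\<^bsub>grp (P_xm C n (m - 1)) X\<^esub>)\<rparr>"

text \<open>The morphism \<open>eta C n : P C n \<rightarrow> P C (n - 1)\<close>, for \<open>n \<ge> 1\<close>.\<close>

definition eta_base :: "('o, 'm, 'a) ccx \<Rightarrow> nat \<Rightarrow> ('o set, 'm set, 'o set, 'm set) fctr" where
  "eta_base C n =
     (if n = 1 then
       \<lparr>fo = (\<lambda>X. component (base C) (the_elem X)),
        fa = (\<lambda>A. component_arrows C (component (base C) (gsrc (pi1 C) A)))\<rparr>
      else if n = 2 then
       \<lparr>fo = (\<lambda>X. X), fa = (\<lambda>A. pi1_class C (the_elem A))\<rparr>
      else fctr_id)"

definition eta ::
  "('o, 'm, 'a) ccx \<Rightarrow> nat \<Rightarrow> ('o set, 'm set, 'a set, 'o set, 'm set, 'a set) cmor" where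
  "eta C n =
     \<lparr>mbase = eta_base C n,
      mcmp = (\<lambda>m X U. if m \<ge> n then \<one>\<^bsub>grp (P_xm C (n - 1) m) (fo (eta_base C n) X)\<^esub>
                       else if m = n - 1 then
                         bd_im C n (the_elem X) #>\<^bsub>cgrp C m (the_elem X)\<^esub> the_elem U
                       else U)\<rparr>"

end

theory Submission
  imports Defs
begin

text \<open>
  The truncations are images of \<open>C\<close>. For \<open>n \<ge> 1\<close> the unit \<open>q\<^sub>n : C \<rightarrow> P\<^sub>n C\<close> is
  bijective on objects, surjective on arrows and on elements in each dimension, and carries the
  operations of \<open>C\<close> to those of \<open>P\<^sub>n C\<close>. Each axiom of crossed complexes is an identity
  between elements over one object or along composable arrows, so it passes to such images
  (\<open>cc_quotient_morphism\<close>, \<open>P_unit_quotient\<close>). Because \<open>\<eta>\<^sub>n q\<^sub>n = q\<^bsub>n - 1\<^esub>\<close>, the map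
  \<open>\<eta>\<^sub>n\<close> is the one that \<open>q\<^bsub>n - 1\<^esub>\<close> induces on the quotient \<open>P\<^sub>n C\<close>, and it inherits
  surjectivity from \<open>q\<^bsub>n - 1\<^esub>\<close>; hence it is a fibration (\<open>eta_fibration\<close>). Only \<open>P\<^sub>0 C\<close>, where
  objects are identified, has to be treated separately.

  The axioms hold in a tower of crossed complexes coordinate by coordinate, so the compatible
  sequences form its inverse limit (\<open>inverse_limit_is_inverse_limit\<close>). The units are a cone over
  the tower of truncations, and the induced map from \<open>C\<close> to the limit is bijective on objects, on
  arrows and in each dimension. Indeed, in a fixed dimension \<open>q\<^sub>n\<close> is injective for all large
  \<open>n\<close>, so the coordinates of a compatible sequence with large index all come from one and the
  same element of \<open>C\<close>, and this element then determines the other coordinates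
  (\<open>compatible_sequence_lift\<close>). A bijective morphism induces bijections on all homotopy groups
  (\<open>bijective_weak_equivalence\<close>).

  For \<open>n \<ge> 2\<close>, the fiber of \<open>\<eta>\<^sub>n\<close> over \<open>x\<close> has the single object \<open>x\<close>. It is
  \<open>C\<^sub>n / Im \<partial>\<^bsub>n + 1\<^esub>\<close> in dimension \<open>n\<close>, \<open>Im \<partial>\<^sub>n\<close> in dimension \<open>n - 1\<close> (for \<open>n = 2\<close>
  these are the arrows) and trivial elsewhere. Its boundary \<open>C\<^sub>n / Im \<partial>\<^bsub>n + 1\<^esub> \<rightarrow> Im \<partial>\<^sub>n\<close> is
  surjective, so only the kernel of this boundary survives in homotopy, and that kernel is abelian
  by the Peiffer rule (\<open>fiber_eta\<close>). The fiber of \<open>\<eta>\<^sub>1\<close> over a component of \<open>C\<close> is the full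
  subgroupoid of \<open>\<pi>\<^sub>1\<close> on that component, whose vertex groups are conjugate
  (\<open>fiber_eta_1\<close>).
\<close>

section \<open>Groupoids\<close>

lemma ghomI: "g \<in> garr G \<Longrightarrow> gsrc G g = x \<Longrightarrow> gtgt G g = y \<Longrightarrow> g \<in> ghom G x y"
  by (simp add: ghom_def)

lemma ghomD:
  assumes "g \<in> ghom G x y"
  shows "g \<in> garr G" "gsrc G g = x" "gtgt G g = y"
  using assms by (simp_all add: ghom_def)

lemma garr_in_ghom: "g \<in> garr G \<Longrightarrow> g \<in> ghom G (gsrc G g) (gtgt G g)"
  by (simp add: ghom_def)

lemma garr_obj:
  assumes "groupoid G" "g \<in> garr G"
  shows "gsrc G g \<in> gobj G" "gtgt G g \<in> gobj G"
  using assms by (simp_all add: groupoid_def)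

lemma ghom_obj:
  assumes "groupoid G" "g \<in> ghom G x y"
  shows "x \<in> gobj G" "y \<in> gobj G"
  using garr_obj[OF assms(1) ghomD(1)[OF assms(2)]] ghomD(2,3)[OF assms(2)] by simp_all

lemma gid_hom: "groupoid G \<Longrightarrow> x \<in> gobj G \<Longrightarrow> gid G x \<in> ghom G x x"
  by (simp add: groupoid_def)

lemma gcomp_hom:
  assumes "groupoid G" "f \<in> ghom G x y" "g \<in> ghom G y z"
  shows "gcomp G g f \<in> ghom G x z"
  using assms ghom_obj[OF assms(1,2)] ghom_obj[OF assms(1,3)] by (simp add: groupoid_def)

lemma gcomp_id:
  assumes "groupoid G" "f \<in> ghom G x y"
  shows "gcomp G f (gid G x) = f" "gcomp G (gid G y) f = f"
  using assms ghom_obj[OF assms] by (simp_all add: groupoid_def)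

lemma gcomp_assoc:
  assumes "groupoid G" "f \<in> ghom G w x" "g \<in> ghom G x y" "h \<in> ghom G y z"
  shows "gcomp G h (gcomp G g f) = gcomp G (gcomp G h g) f"
  using assms ghom_obj[OF assms(1,2)] ghom_obj[OF assms(1,4)] by (simp add: groupoid_def)

lemma groupoidI:
  assumes "\<And>g. g \<in> garr G \<Longrightarrow> gsrc G g \<in> gobj G \<and> gtgt G g \<in> gobj G"
    and "\<And>x. x \<in> gobj G \<Longrightarrow> gid G x \<in> ghom G x x"
    and "\<And>x y z f g. f \<in> ghom G x y \<Longrightarrow> g \<in> ghom G y z \<Longrightarrow> gcomp G g f \<in> ghom G x z"
    and "\<And>x y f. f \<in> ghom G x y \<Longrightarrow> gcomp G f (gid G x) = f \<and> gcomp G (gid G y) f = f"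
    and "\<And>w x y z f g h. f \<in> ghom G w x \<Longrightarrow> g \<in> ghom G x y \<Longrightarrow> h \<in> ghom G y z \<Longrightarrow>
           gcomp G h (gcomp G g f) = gcomp G (gcomp G h g) f"
    and "\<And>x y f. f \<in> ghom G x y \<Longrightarrow>
           \<exists>g\<in>ghom G y x. gcomp G g f = gid G x \<and> gcomp G f g = gid G y"
  shows "groupoid G"
  unfolding groupoid_def
proof (intro conjI)
  show "\<forall>g\<in>garr G. gsrc G g \<in> gobj G \<and> gtgt G g \<in> gobj G" by (intro ballI assms(1))
qed (intro ballI, rule assms, assumption+)+

lemma ginv_equality:
  assumes G: "groupoid G" and f: "f \<in> ghom G x y" and g: "g \<in> ghom G y x"
    and gf: "gcomp G g f = gid G x" and fg: "gcomp G f g = gid G y"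
  shows "ginv G f = g"
proof -
  have u: "h = g" if h: "h \<in> ghom G y x" "gcomp G h f = gid G x" for h
  proof -
    have "h = gcomp G h (gcomp G f g)" using fg gcomp_id(1)[OF G h(1)] by simp
    also have "\<dots> = gcomp G (gcomp G h f) g" by (rule gcomp_assoc[OF G g f h(1)])
    also have "\<dots> = g" using h(2) gcomp_id(2)[OF G g] by simp
    finally show ?thesis .
  qed
  show ?thesis unfolding ginv_def
    unfolding ghomD(2,3)[OF f]
  proof (rule the_equality)
    show "g \<in> ghom G y x \<and> gcomp G g f = gid G x \<and> gcomp G f g = gid G y"
      by (intro conjI g gf fg)
  qed (use u in blast)
qed

lemma ginv:
  assumes G: "groupoid G" and f: "f \<in> ghom G x y"
  shows "ginv G f \<in> ghom G y x" "gcomp G (ginv G f) f = gid G x" "gcomp G f (ginv G f) = gid G y"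
proof -
  obtain g where g: "g \<in> ghom G y x" "gcomp G g f = gid G x" "gcomp G f g = gid G y"
    using G ghom_obj[OF G f] f unfolding groupoid_def by metis
  have "ginv G f = g" by (rule ginv_equality[OF G f g])
  then show "ginv G f \<in> ghom G y x" "gcomp G (ginv G f) f = gid G x" "gcomp G f (ginv G f) = gid G y"
    using g by (simp_all only:)
qed

lemma ginv_gid:
  assumes G: "groupoid G" and x: "x \<in> gobj G"
  shows "ginv G (gid G x) = gid G x"
  by (rule ginv_equality[OF G gid_hom[OF G x] gid_hom[OF G x]]) (rule gcomp_id[OF G gid_hom[OF G x]])+

lemma is_functorI:
  assumes "groupoid G" "groupoid H" "\<And>x. x \<in> gobj G \<Longrightarrow> fo F x \<in> gobj H"
    and "\<And>x y g. g \<in> ghom G x y \<Longrightarrow> fa F g \<in> ghom H (fo F x) (fo F y)"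
    and "\<And>x. x \<in> gobj G \<Longrightarrow> fa F (gid G x) = gid H (fo F x)"
    and "\<And>x y z f g. f \<in> ghom G x y \<Longrightarrow> g \<in> ghom G y z \<Longrightarrow>
           fa F (gcomp G g f) = gcomp H (fa F g) (fa F f)"
  shows "is_functor G H F"
  unfolding is_functor_def using assms by blast

lemma is_functorD:
  assumes "is_functor G H F"
  shows "groupoid G" "groupoid H"
    and "x \<in> gobj G \<Longrightarrow> fo F x \<in> gobj H"
    and "g \<in> ghom G x y \<Longrightarrow> fa F g \<in> ghom H (fo F x) (fo F y)"
    and "x \<in> gobj G \<Longrightarrow> fa F (gid G x) = gid H (fo F x)"
    and "f \<in> ghom G x y \<Longrightarrow> g \<in> ghom G y z \<Longrightarrow> fa F (gcomp G g f) = gcomp H (fa F g) (fa F f)"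
  using assms ghom_obj[of G g x y] ghom_obj[of G f x y] ghom_obj[of G g y z]
  by (simp_all add: is_functor_def)

lemma is_functor_ginv:
  assumes F: "is_functor G H F" and f: "f \<in> ghom G x y"
  shows "fa F (ginv G f) = ginv H (fa F f)"
proof -
  note D = is_functorD[OF F]
  note i = ginv[OF D(1) f]
  have "x \<in> gobj G" "y \<in> gobj G" using ghom_obj[OF D(1) f] by auto
  then have "ginv H (fa F f) = fa F (ginv G f)"
    using ginv_equality[OF D(2) D(4)[OF f] D(4)[OF i(1)]] D(6)[OF f i(1)] D(6)[OF i(1) f] i(2,3) D(5)
    by simp
  then show ?thesis by simp
qed

lemma is_functor_id: "groupoid G \<Longrightarrow> is_functor G G fctr_id"
  by (rule is_functorI) (simp_all add: fctr_id_def)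

lemma fctr_id_simps [simp]: "fo fctr_id x = x" "fa fctr_id g = g"
  by (simp_all add: fctr_id_def)

lemma fctr_comp_simps [simp]:
  "fo (fctr_comp K F) x = fo K (fo F x)" "fa (fctr_comp K F) g = fa K (fa F g)"
  by (simp_all add: fctr_comp_def)

text \<open>
  Here \<open>H\<close> is a bare record, which these conditions turn into a groupoid. Bijectivity on objects
  makes composable arrows of \<open>H\<close> lift to composable arrows of \<open>G\<close>.
\<close>

definition gpd_quotient ::
  "('o, 'm) gpd \<Rightarrow> ('p, 'q) gpd \<Rightarrow> ('o, 'm, 'p, 'q) fctr \<Rightarrow> bool" where
  "gpd_quotient G H F \<longleftrightarrow> bij_betw (fo F) (gobj G) (gobj H) \<and> garr H = fa F ` garr G \<and>
     (\<forall>g\<in>garr G. gsrc H (fa F g) = fo F (gsrc G g) \<and> gtgt H (fa F g) = fo F (gtgt G g)) \<and>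
     (\<forall>x\<in>gobj G. gid H (fo F x) = fa F (gid G x)) \<and>
     (\<forall>f\<in>garr G. \<forall>g\<in>garr G. gtgt G f = gsrc G g \<longrightarrow>
        gcomp H (fa F g) (fa F f) = fa F (gcomp G g f))"

lemma gpd_quotient_lift_obj:
  assumes "gpd_quotient G H F" "y \<in> gobj H"
  obtains x where "x \<in> gobj G" "y = fo F x"
  using assms unfolding gpd_quotient_def bij_betw_def by blast

lemma gpd_quotient_lift_hom:
  assumes G: "groupoid G" and q: "gpd_quotient G H F" and x: "x \<in> gobj G" and y: "y \<in> gobj G"
    and h: "h \<in> ghom H (fo F x) (fo F y)"
  obtains g where "g \<in> ghom G x y" "h = fa F g"
proof -
  obtain g where g: "g \<in> garr G" "h = fa F g"
    using q ghomD(1)[OF h] unfolding gpd_quotient_def by auto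
  have "fo F (gsrc G g) = fo F x" "fo F (gtgt G g) = fo F y"
    using q g ghomD[OF h] unfolding gpd_quotient_def by auto
  moreover have "inj_on (fo F) (gobj G)" using q by (simp add: gpd_quotient_def bij_betw_def)
  ultimately have "gsrc G g = x" "gtgt G g = y"
    using garr_obj[OF G g(1)] x y by (auto dest: inj_onD)
  then show ?thesis using that g by (auto intro: ghomI)
qed

lemma gpd_quotient_functor:
  assumes G: "groupoid G" and q: "gpd_quotient G H F"
  shows "is_functor G H F"
proof -
  have hom: "fa F g \<in> ghom H (fo F x) (fo F y)" if "g \<in> ghom G x y" for g x y
    using q ghomD[OF that] by (auto simp: gpd_quotient_def intro!: ghomI)
  have comp: "gcomp H (fa F g) (fa F f) = fa F (gcomp G g f)"
    if "f \<in> ghom G x y" "g \<in> ghom G y z" for f g x y z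
    using q that by (simp add: gpd_quotient_def ghom_def)
  have gid: "gid H (fo F x) = fa F (gid G x)" if "x \<in> gobj G" for x
    using q that by (simp add: gpd_quotient_def)
  have obj: "fo F x \<in> gobj H" if "x \<in> gobj G" for x
    using q that by (auto simp: gpd_quotient_def bij_betw_def)
  have arr: "\<exists>g x y. g \<in> ghom G x y \<and> h = fa F g" if "h \<in> garr H" for h
    using q that by (auto simp: gpd_quotient_def intro: garr_in_ghom)
  have ends: "gsrc H h \<in> gobj H \<and> gtgt H h \<in> gobj H" if "h \<in> garr H" for h
    using arr[OF that] hom obj ghom_obj[OF G] ghomD(2,3) by metis
  have lo: "\<exists>x. x \<in> gobj G \<and> y = fo F x" if "y \<in> gobj H" for y
    using gpd_quotient_lift_obj[OF q that] by metis
  have src: "\<exists>x'. x' \<in> gobj G \<and> x = fo F x'" and tgt: "\<exists>y'. y' \<in> gobj G \<and> y = fo F y'"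
    if "h \<in> ghom H x y" for h x y
    using lo[of x] lo[of y] ends[of h] ghomD[OF that] by simp_all
  have "groupoid H"
  proof (rule groupoidI)
    fix x assume "x \<in> gobj H"
    then obtain x' where "x' \<in> gobj G" "x = fo F x'" using lo by blast
    then show "gid H x \<in> ghom H x x" using gid hom gid_hom[OF G] by simp
  next
    fix x y z f g assume f: "f \<in> ghom H x y" and g: "g \<in> ghom H y z"
    obtain x' where x': "x' \<in> gobj G" "x = fo F x'" using src[OF f] by blast
    obtain y' where y': "y' \<in> gobj G" "y = fo F y'" using src[OF g] by blast
    obtain z' where z': "z' \<in> gobj G" "z = fo F z'" using tgt[OF g] by blast
    note o = x' y' z'
    obtain f' where f': "f' \<in> ghom G x' y'" "f = fa F f'"
      using gpd_quotient_lift_hom[OF G q x'(1) y'(1)] f x'(2) y'(2) by blast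
    obtain g' where g': "g' \<in> ghom G y' z'" "g = fa F g'"
      using gpd_quotient_lift_hom[OF G q y'(1) z'(1)] g y'(2) z'(2) by blast
    show "gcomp H g f \<in> ghom H x z"
      using comp[OF f'(1) g'(1)] hom[OF gcomp_hom[OF G f'(1) g'(1)]] f'(2) g'(2) o by simp
  next
    fix x y f assume f: "f \<in> ghom H x y"
    obtain x' where x': "x' \<in> gobj G" "x = fo F x'" using src[OF f] by blast
    obtain y' where y': "y' \<in> gobj G" "y = fo F y'" using tgt[OF f] by blast
    note o = x' y'
    obtain f' where f': "f' \<in> ghom G x' y'" "f = fa F f'"
      using gpd_quotient_lift_hom[OF G q x'(1) y'(1)] f x'(2) y'(2) by blast
    show "gcomp H f (gid H x) = f \<and> gcomp H (gid H y) f = f"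
      unfolding o(2,4) gid[OF o(1)] gid[OF o(3)] f'(2) comp[OF gid_hom[OF G o(1)] f'(1)]
        comp[OF f'(1) gid_hom[OF G o(3)]] gcomp_id[OF G f'(1)] by (intro conjI refl)
    note i = ginv[OF G f'(1)]
    show "\<exists>g\<in>ghom H y x. gcomp H g f = gid H x \<and> gcomp H f g = gid H y"
      unfolding o(2,4) gid[OF o(1)] gid[OF o(3)] f'(2)
    proof (intro bexI conjI)
      show "gcomp H (fa F (ginv G f')) (fa F f') = fa F (gid G x')"
        using comp[OF f'(1) i(1)] i(2) by simp
      show "gcomp H (fa F f') (fa F (ginv G f')) = fa F (gid G y')"
        using comp[OF i(1) f'(1)] i(3) by simp
    qed (rule hom[OF i(1)])
  next
    fix w x y z f g h assume f: "f \<in> ghom H w x" and g: "g \<in> ghom H x y" and h: "h \<in> ghom H y z"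
    obtain w' where w': "w' \<in> gobj G" "w = fo F w'" using src[OF f] by blast
    obtain x' where x': "x' \<in> gobj G" "x = fo F x'" using src[OF g] by blast
    obtain y' where y': "y' \<in> gobj G" "y = fo F y'" using src[OF h] by blast
    obtain z' where z': "z' \<in> gobj G" "z = fo F z'" using tgt[OF h] by blast
    obtain f' where f': "f' \<in> ghom G w' x'" "f = fa F f'"
      using gpd_quotient_lift_hom[OF G q w'(1) x'(1)] f w'(2) x'(2) by blast
    obtain g' where g': "g' \<in> ghom G x' y'" "g = fa F g'"
      using gpd_quotient_lift_hom[OF G q x'(1) y'(1)] g x'(2) y'(2) by blast
    obtain h' where h': "h' \<in> ghom G y' z'" "h = fa F h'"
      using gpd_quotient_lift_hom[OF G q y'(1) z'(1)] h y'(2) z'(2) by blast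
    show "gcomp H h (gcomp H g f) = gcomp H (gcomp H h g) f"
      unfolding f'(2) g'(2) h'(2) comp[OF f'(1) g'(1)] comp[OF g'(1) h'(1)]
        comp[OF gcomp_hom[OF G f'(1) g'(1)] h'(1)] comp[OF f'(1) gcomp_hom[OF G g'(1) h'(1)]]
        gcomp_assoc[OF G f'(1) g'(1) h'(1)] ..
  qed (rule ends)
  then show ?thesis using G obj hom gid comp by (intro is_functorI) simp_all
qed

lemma End_group_group:
  assumes G: "groupoid G" and x: "x \<in> gobj G"
  shows "group (End_group G x)"
proof (rule groupI)
  fix g assume "g \<in> carrier (End_group G x)"
  then have g: "g \<in> ghom G x x" by (simp add: End_group_def)
  show "\<exists>h\<in>carrier (End_group G x). h \<otimes>\<^bsub>End_group G x\<^esub> g = \<one>\<^bsub>End_group G x\<^esub>"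
    using ginv(1,2)[OF G g] by (auto simp: End_group_def)
  show "\<one>\<^bsub>End_group G x\<^esub> \<otimes>\<^bsub>End_group G x\<^esub> g = g"
    using gcomp_id(2)[OF G g] by (simp add: End_group_def)
qed (simp_all add: End_group_def gid_hom[OF G x] gcomp_hom[OF G, of _ x x] gcomp_assoc[OF G, of _ x x _ x _ x])

lemma inv_End_group:
  assumes G: "groupoid G" and g: "g \<in> ghom G x x"
  shows "inv\<^bsub>End_group G x\<^esub> g = ginv G g"
  using group.inv_equality[OF End_group_group[OF G ghom_obj(1)[OF G g]], of "ginv G g" g] ginv[OF G g] g
  by (simp add: End_group_def)

lemma gcomp_cancel_inv:
  assumes G: "groupoid G" and t: "t \<in> ghom G x y" and f: "f \<in> ghom G w x" and h: "h \<in> ghom G w y"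
  shows "gcomp G (ginv G t) (gcomp G t f) = f" "gcomp G t (gcomp G (ginv G t) h) = h"
  using gcomp_assoc[OF G f t ginv(1)[OF G t]] gcomp_assoc[OF G h ginv(1)[OF G t] t]
    ginv[OF G t] gcomp_id[OF G f] gcomp_id[OF G h] by simp_all

lemma conj_hom:
  assumes G: "groupoid G" and t: "t \<in> ghom G x y"
  shows "(\<lambda>g. gcomp G (gcomp G t g) (ginv G t)) \<in> hom (End_group G x) (End_group G y)"
proof (rule homI)
  note i = ginv[OF G t]
  fix g assume g: "g \<in> carrier (End_group G x)"
  then show "gcomp G (gcomp G t g) (ginv G t) \<in> carrier (End_group G y)"
    using gcomp_hom[OF G i(1) gcomp_hom[OF G _ t]] by (simp add: End_group_def)
  fix h assume h: "h \<in> carrier (End_group G x)"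
  have g': "g \<in> ghom G x x" and h': "h \<in> ghom G x x" using g h by (simp_all add: End_group_def)
  have th: "gcomp G t h \<in> ghom G x y" and tg: "gcomp G t g \<in> ghom G x y"
    using gcomp_hom[OF G g' t] gcomp_hom[OF G h' t] by auto
  have thi: "gcomp G (gcomp G t h) (ginv G t) \<in> ghom G y y"
    by (rule gcomp_hom[OF G i(1) th])
  have "gcomp G (gcomp G (gcomp G t g) (ginv G t)) (gcomp G (gcomp G t h) (ginv G t))
      = gcomp G (gcomp G t g) (gcomp G (ginv G t) (gcomp G (gcomp G t h) (ginv G t)))"
    by (rule gcomp_assoc[OF G thi i(1) tg, symmetric])
  also have "\<dots> = gcomp G (gcomp G t g) (gcomp G h (ginv G t))"
    using gcomp_assoc[OF G i(1) th i(1)] gcomp_cancel_inv(1)[OF G t h' th] by simp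
  also have "\<dots> = gcomp G (gcomp G (gcomp G t g) h) (ginv G t)"
    by (rule gcomp_assoc[OF G i(1) h' tg])
  also have "gcomp G (gcomp G t g) h = gcomp G t (gcomp G g h)"
    by (rule gcomp_assoc[OF G h' g' t, symmetric])
  finally show "gcomp G (gcomp G t (g \<otimes>\<^bsub>End_group G x\<^esub> h)) (ginv G t) =
      gcomp G (gcomp G t g) (ginv G t) \<otimes>\<^bsub>End_group G y\<^esub> gcomp G (gcomp G t h) (ginv G t)"
    by (simp add: End_group_def)
qed

section \<open>Crossed modules and crossed complexes by their elements\<close>

abbreviation objs :: "('o, 'm, 'a) ccx \<Rightarrow> 'o set" where
  "objs C \<equiv> gobj (base C)"

abbreviation homs :: "('o, 'm, 'a) ccx \<Rightarrow> 'o \<Rightarrow> 'o \<Rightarrow> 'm set" where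
  "homs C \<equiv> ghom (base C)"

abbreviation elts :: "('o, 'm, 'a) ccx \<Rightarrow> nat \<Rightarrow> 'o \<Rightarrow> 'a set" where
  "elts C n x \<equiv> carrier (cgrp C n x)"

abbreviation neutral :: "('o, 'm, 'a) ccx \<Rightarrow> nat \<Rightarrow> 'o \<Rightarrow> 'a" where
  "neutral C n x \<equiv> \<one>\<^bsub>cgrp C n x\<^esub>"

abbreviation ob :: "('o, 'm, 'a, 'p, 'q, 'b) cmor \<Rightarrow> 'o \<Rightarrow> 'p" where
  "ob f \<equiv> fo (mbase f)"

abbreviation ar :: "('o, 'm, 'a, 'p, 'q, 'b) cmor \<Rightarrow> 'm \<Rightarrow> 'q" where
  "ar f \<equiv> fa (mbase f)"

text \<open>The three layers of the definition (\<open>G\<close>-group, map to \<open>End_G\<close>, Peiffer rule), flattened to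
  identities between elements. The constructions below are checked against this list.\<close>

lemma crossed_moduleI:
  assumes G: "groupoid G" and grp: "\<And>x. x \<in> gobj G \<Longrightarrow> group (grp M x)"
    and act_closed: "\<And>x y t u. t \<in> ghom G x y \<Longrightarrow> u \<in> carrier (grp M x) \<Longrightarrow>
      act M t u \<in> carrier (grp M y)"
    and act_mult: "\<And>x y t u v. t \<in> ghom G x y \<Longrightarrow> u \<in> carrier (grp M x) \<Longrightarrow> v \<in> carrier (grp M x) \<Longrightarrow>
      act M t (u \<otimes>\<^bsub>grp M x\<^esub> v) = act M t u \<otimes>\<^bsub>grp M y\<^esub> act M t v"
    and act_id: "\<And>x u. x \<in> gobj G \<Longrightarrow> u \<in> carrier (grp M x) \<Longrightarrow> act M (gid G x) u = u"
    and act_comp: "\<And>x y z s t u. s \<in> ghom G x y \<Longrightarrow> t \<in> ghom G y z \<Longrightarrow> u \<in> carrier (grp M x) \<Longrightarrow>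
      act M (gcomp G t s) u = act M t (act M s u)"
    and dlt_closed: "\<And>x u. x \<in> gobj G \<Longrightarrow> u \<in> carrier (grp M x) \<Longrightarrow> dlt M x u \<in> ghom G x x"
    and dlt_mult: "\<And>x u v. x \<in> gobj G \<Longrightarrow> u \<in> carrier (grp M x) \<Longrightarrow> v \<in> carrier (grp M x) \<Longrightarrow>
      dlt M x (u \<otimes>\<^bsub>grp M x\<^esub> v) = gcomp G (dlt M x u) (dlt M x v)"
    and dlt_act: "\<And>x y t u. t \<in> ghom G x y \<Longrightarrow> u \<in> carrier (grp M x) \<Longrightarrow>
      dlt M y (act M t u) = gcomp G (gcomp G t (dlt M x u)) (ginv G t)"
    and peiffer: "\<And>x u v. x \<in> gobj G \<Longrightarrow> u \<in> carrier (grp M x) \<Longrightarrow> v \<in> carrier (grp M x) \<Longrightarrow>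
      act M (dlt M x u) v = u \<otimes>\<^bsub>grp M x\<^esub> v \<otimes>\<^bsub>grp M x\<^esub> inv\<^bsub>grp M x\<^esub> u"
  shows "crossed_module G M"
  unfolding crossed_module_def
proof (intro conjI)
  show "G_group G M" unfolding G_group_def
    by (intro conjI ballI G grp homI) (use act_closed act_mult act_id act_comp in auto)
  show "G_group_map G M (End_G G) (dlt M)" unfolding G_group_map_def
    by (intro conjI ballI homI) (use dlt_closed dlt_mult dlt_act in \<open>auto simp: End_G_def End_group_def\<close>)
  show "\<forall>x\<in>gobj G. \<forall>u\<in>carrier (grp M x). \<forall>v\<in>carrier (grp M x).
        act M (dlt M x u) v = u \<otimes>\<^bsub>grp M x\<^esub> v \<otimes>\<^bsub>grp M x\<^esub> inv\<^bsub>grp M x\<^esub> u"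
    using peiffer by blast
qed

context
  fixes G :: "('o, 'm) gpd" and M :: "('o, 'm, 'a) xmod"
  assumes M: "crossed_module G M"
begin

lemma xmod_groupoid: "groupoid G"
  using M by (simp add: crossed_module_def G_group_def)

lemma xmod_group: "x \<in> gobj G \<Longrightarrow> group (grp M x)"
  using M by (simp add: crossed_module_def G_group_def)

lemma xmod_act_hom: "t \<in> ghom G x y \<Longrightarrow> act M t \<in> hom (grp M x) (grp M y)"
  using M ghom_obj[OF xmod_groupoid, of t x y] by (simp add: crossed_module_def G_group_def)

lemmas xmod_act_closed = hom_in_carrier[OF xmod_act_hom]
lemmas xmod_act_mult = hom_mult[OF xmod_act_hom]

lemma xmod_act_id: "x \<in> gobj G \<Longrightarrow> u \<in> carrier (grp M x) \<Longrightarrow> act M (gid G x) u = u"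
  using M by (simp add: crossed_module_def G_group_def)

lemma xmod_act_comp:
  assumes "s \<in> ghom G x y" "t \<in> ghom G y z" "u \<in> carrier (grp M x)"
  shows "act M (gcomp G t s) u = act M t (act M s u)"
  using M assms ghom_obj[OF xmod_groupoid assms(1)] ghom_obj[OF xmod_groupoid assms(2)]
  unfolding crossed_module_def G_group_def by blast

lemma xmod_dlt_hom: "x \<in> gobj G \<Longrightarrow> dlt M x \<in> hom (grp M x) (End_group G x)"
  using M by (simp add: crossed_module_def G_group_map_def End_G_def)

lemmas xmod_dlt_closed = hom_in_carrier[OF xmod_dlt_hom, unfolded End_group_def monoid.simps partial_object.simps]
lemmas xmod_dlt_mult = hom_mult[OF xmod_dlt_hom, unfolded End_group_def monoid.simps]

lemma xmod_dlt_act: "t \<in> ghom G x y \<Longrightarrow> u \<in> carrier (grp M x) \<Longrightarrow>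
    dlt M y (act M t u) = gcomp G (gcomp G t (dlt M x u)) (ginv G t)"
  using M ghom_obj[OF xmod_groupoid, of t x y] by (simp add: crossed_module_def G_group_map_def End_G_def)

lemma xmod_peiffer: "x \<in> gobj G \<Longrightarrow> u \<in> carrier (grp M x) \<Longrightarrow> v \<in> carrier (grp M x) \<Longrightarrow>
    act M (dlt M x u) v = u \<otimes>\<^bsub>grp M x\<^esub> v \<otimes>\<^bsub>grp M x\<^esub> inv\<^bsub>grp M x\<^esub> u"
  using M by (simp add: crossed_module_def)

lemma xmod_act_one: "t \<in> ghom G x y \<Longrightarrow> act M t \<one>\<^bsub>grp M x\<^esub> = \<one>\<^bsub>grp M y\<^esub>"
  using hom_one[OF xmod_act_hom] xmod_group ghom_obj[OF xmod_groupoid] by blast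

lemma xmod_dlt_one: "x \<in> gobj G \<Longrightarrow> dlt M x \<one>\<^bsub>grp M x\<^esub> = gid G x"
  using hom_one[OF xmod_dlt_hom xmod_group End_group_group[OF xmod_groupoid], of x]
  by (simp add: End_group_def)

end

lemmas crossed_moduleD = xmod_groupoid xmod_group xmod_act_closed xmod_act_mult xmod_act_id
  xmod_act_comp xmod_dlt_closed xmod_dlt_mult xmod_dlt_act xmod_peiffer xmod_act_one xmod_dlt_one

text \<open>Conjugation is an action, and the Peiffer rule for it is the definition of the action.\<close>

lemma one_xmod_crossed_module:
  assumes G: "groupoid G"
  shows "crossed_module G (one_xmod G)"
proof (rule crossed_moduleI[OF G])
  fix x y t u v
  show "group (grp (one_xmod G) x)" if "x \<in> gobj G" for x
    using End_group_group[OF G that] by (simp add: one_xmod_def End_G_def)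
  { assume t: "t \<in> ghom G x y" and u: "u \<in> carrier (grp (one_xmod G) x)"
    show "act (one_xmod G) t u \<in> carrier (grp (one_xmod G) y)"
      using hom_in_carrier[OF conj_hom[OF G t]] u by (simp add: one_xmod_def End_G_def)
    show "dlt (one_xmod G) y (act (one_xmod G) t u) =
        gcomp G (gcomp G t (dlt (one_xmod G) x u)) (ginv G t)"
      by (simp add: one_xmod_def End_G_def)
    assume v: "v \<in> carrier (grp (one_xmod G) x)"
    show "act (one_xmod G) t (u \<otimes>\<^bsub>grp (one_xmod G) x\<^esub> v) =
        act (one_xmod G) t u \<otimes>\<^bsub>grp (one_xmod G) y\<^esub> act (one_xmod G) t v"
      using hom_mult[OF conj_hom[OF G t]] u v by (simp add: one_xmod_def End_G_def) }
  { assume x: "x \<in> gobj G" and "u \<in> carrier (grp (one_xmod G) x)"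
    then have u: "u \<in> ghom G x x" by (simp add: one_xmod_def End_G_def End_group_def)
    then show "dlt (one_xmod G) x u \<in> ghom G x x" by (simp add: one_xmod_def)
    show "act (one_xmod G) (gid G x) u = u"
      using gcomp_id[OF G u] by (simp add: one_xmod_def End_G_def ginv_gid[OF G x])
    assume v: "v \<in> carrier (grp (one_xmod G) x)"
    show "dlt (one_xmod G) x (u \<otimes>\<^bsub>grp (one_xmod G) x\<^esub> v) =
        gcomp G (dlt (one_xmod G) x u) (dlt (one_xmod G) x v)"
      by (simp add: one_xmod_def End_G_def End_group_def)
    show "act (one_xmod G) (dlt (one_xmod G) x u) v =
       u \<otimes>\<^bsub>grp (one_xmod G) x\<^esub> v \<otimes>\<^bsub>grp (one_xmod G) x\<^esub> inv\<^bsub>grp (one_xmod G) x\<^esub> u"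
      using inv_End_group[OF G u] by (simp add: one_xmod_def End_G_def) (simp add: End_group_def) }
next
  fix x y z s t u
  assume s: "s \<in> ghom G x y" and t: "t \<in> ghom G y z" and "u \<in> carrier (grp (one_xmod G) x)"
  then have u: "u \<in> ghom G x x" by (simp add: one_xmod_def End_G_def End_group_def)
  note si = ginv[OF G s] and ti = ginv[OF G t]
  have ts: "gcomp G t s \<in> ghom G x z" and su: "gcomp G s u \<in> ghom G x y"
    and sti: "gcomp G (ginv G s) (ginv G t) \<in> ghom G z x"
    using gcomp_hom[OF G s t] gcomp_hom[OF G u s] gcomp_hom[OF G ti(1) si(1)] by simp_all
  have inv: "ginv G (gcomp G t s) = gcomp G (ginv G s) (ginv G t)"
  proof (rule ginv_equality[OF G ts sti])
    have "gcomp G (gcomp G (ginv G s) (ginv G t)) (gcomp G t s)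
        = gcomp G (ginv G s) (gcomp G (ginv G t) (gcomp G t s))"
      by (rule gcomp_assoc[OF G ts ti(1) si(1), symmetric])
    then show "gcomp G (gcomp G (ginv G s) (ginv G t)) (gcomp G t s) = gid G x"
      using gcomp_cancel_inv(1)[OF G t s ts] si by simp
    have "gcomp G (gcomp G t s) (gcomp G (ginv G s) (ginv G t))
        = gcomp G t (gcomp G s (gcomp G (ginv G s) (ginv G t)))"
      by (rule gcomp_assoc[OF G sti s t, symmetric])
    then show "gcomp G (gcomp G t s) (gcomp G (ginv G s) (ginv G t)) = gid G z"
      using gcomp_cancel_inv(2)[OF G s sti ti(1)] ti by simp
  qed
  have "gcomp G (gcomp G (gcomp G t s) u) (gcomp G (ginv G s) (ginv G t))
      = gcomp G (gcomp G t (gcomp G s u)) (gcomp G (ginv G s) (ginv G t))"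
    using gcomp_assoc[OF G u s t] by simp
  also have "\<dots> = gcomp G (gcomp G (gcomp G t (gcomp G s u)) (ginv G s)) (ginv G t)"
    by (rule gcomp_assoc[OF G ti(1) si(1) gcomp_hom[OF G su t]])
  also have "gcomp G (gcomp G t (gcomp G s u)) (ginv G s) = gcomp G t (gcomp G (gcomp G s u) (ginv G s))"
    by (rule gcomp_assoc[OF G si(1) su t, symmetric])
  finally show "act (one_xmod G) (gcomp G t s) u = act (one_xmod G) t (act (one_xmod G) s u)"
    by (simp add: one_xmod_def End_G_def inv)
qed

lemma End_group_iso:
  assumes G: "groupoid G" and t: "t \<in> ghom G x y"
  shows "End_group G x \<cong> End_group G y"
proof -
  let ?c = "act (one_xmod G)"
  note M = crossed_moduleD[OF one_xmod_crossed_module[OF G]]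
  note i = ginv[OF G t] and o = ghom_obj[OF G t]
  have grp: "grp (one_xmod G) = End_group G" by (simp add: one_xmod_def End_G_def)
  have "bij_betw (?c t) (carrier (End_group G x)) (carrier (End_group G y))"
    by (rule bij_betw_byWitness[where f' = "?c (ginv G t)"])
      (use M(3)[OF t] M(3)[OF i(1)] M(5)[OF o(1)] M(5)[OF o(2)] M(6)[OF t i(1)] M(6)[OF i(1) t] i
        in \<open>auto simp: grp\<close>)
  moreover have "?c t \<in> hom (End_group G x) (End_group G y)"
    using conj_hom[OF G t] by (simp add: one_xmod_def End_G_def)
  ultimately show ?thesis by (auto simp: is_iso_def iso_def)
qed

context
  fixes C :: "('o, 'm, 'a) ccx"
  assumes C: "crossed_complex C"
begin

lemma base_groupoid: "groupoid (base C)"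
  and cc_xmod: "n \<ge> 2 \<Longrightarrow> crossed_module (base C) (xm C n)"
  and bd2_bd3: "x \<in> objs C \<Longrightarrow> u \<in> elts C 3 x \<Longrightarrow> bd2 C x (bd C 3 x u) = gid (base C) x"
  and bd_bd: "n \<ge> 4 \<Longrightarrow> x \<in> objs C \<Longrightarrow> u \<in> elts C n x \<Longrightarrow>
    bd C (n - 1) x (bd C n x u) = neutral C (n - 2) x"
  and bd2_acts_trivially: "n \<ge> 3 \<Longrightarrow> x \<in> objs C \<Longrightarrow> v \<in> elts C 2 x \<Longrightarrow> u \<in> elts C n x \<Longrightarrow>
    act (xm C n) (bd2 C x v) u = u"
  and Xm_bd2: "Xm_morphism (base C) (xm C 2) (one_xmod (base C)) (bd2 C)"
  and Xm_bd: "n \<ge> 3 \<Longrightarrow> Xm_morphism (base C) (xm C n) (xm C (n - 1)) (bd C n)"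
  using C by (simp_all add: crossed_complex_def)

lemma dlt_2: "x \<in> objs C \<Longrightarrow> u \<in> elts C 2 x \<Longrightarrow> dlt (xm C 2) x u = bd2 C x u"
  using Xm_bd2 by (simp add: xmod_morphism_def one_xmod_def)

lemma bd_hom: "n \<ge> 3 \<Longrightarrow> x \<in> objs C \<Longrightarrow> bd C n x \<in> hom (cgrp C n x) (cgrp C (n - 1) x)"
  using Xm_bd by (simp add: xmod_morphism_def G_group_map_def pullback_def)

lemma bd_act: "n \<ge> 3 \<Longrightarrow> t \<in> homs C x y \<Longrightarrow> u \<in> elts C n x \<Longrightarrow>
    bd C n y (act (xm C n) t u) = act (xm C (n - 1)) t (bd C n x u)"
  using Xm_bd[of n] ghom_obj[OF base_groupoid, of t x y]
  by (simp add: xmod_morphism_def G_group_map_def pullback_def)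

text \<open>For \<open>n \<ge> 3\<close> the morphisms \<open>\<partial>\<^sub>n\<close> commute with the maps \<open>\<delta>\<close>, so that
  \<open>\<delta>\<^sub>n = \<delta>\<^sub>2 \<partial>\<^sub>3 \<dots> \<partial>\<^sub>n\<close>; this vanishes because \<open>\<delta>\<^sub>2 = \<partial>\<^sub>2\<close> and \<open>\<partial>\<^sub>2 \<partial>\<^sub>3\<close> is trivial.\<close>

lemma dlt_trivial:
  assumes "n \<ge> 3" and x: "x \<in> objs C" and "u \<in> elts C n x"
  shows "dlt (xm C n) x u = gid (base C) x"
  using assms(1,3)
proof (induction n arbitrary: u rule: dec_induct)
  case base
  then show ?case
    using Xm_bd[of 3] dlt_2[OF x] bd2_bd3[OF x] hom_in_carrier[OF bd_hom[of 3 x]] x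
    by (simp add: xmod_morphism_def)
next
  case (step n)
  then show ?case
    using Xm_bd[of "Suc n"] hom_in_carrier[OF bd_hom[of "Suc n" x]] x by (simp add: xmod_morphism_def)
qed

end

lemmas crossed_complexD = base_groupoid cc_xmod dlt_2 dlt_trivial bd_hom bd_act bd2_bd3 bd_bd
  bd2_acts_trivially

text \<open>
  Most of the axioms for \<open>\<partial>\<^sub>2\<close> are those for \<open>\<delta>\<^sub>2\<close>, since the two maps agree; and the
  compatibility of \<open>\<partial>\<^sub>n\<close> with \<open>\<delta>\<^sub>n\<close> for \<open>n \<ge> 3\<close> amounts to \<open>\<delta>\<^sub>n = 0\<close>.
\<close>

lemma crossed_complexI:
  assumes G: "groupoid (base C)" and xmod: "\<And>n. n \<ge> 2 \<Longrightarrow> crossed_module (base C) (xm C n)"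
    and d2: "\<And>x u. x \<in> objs C \<Longrightarrow> u \<in> elts C 2 x \<Longrightarrow> dlt (xm C 2) x u = bd2 C x u"
    and dn: "\<And>n x u. n \<ge> 3 \<Longrightarrow> x \<in> objs C \<Longrightarrow> u \<in> elts C n x \<Longrightarrow>
      dlt (xm C n) x u = gid (base C) x"
    and bd_closed: "\<And>n x u. n \<ge> 3 \<Longrightarrow> x \<in> objs C \<Longrightarrow> u \<in> elts C n x \<Longrightarrow>
      bd C n x u \<in> elts C (n - 1) x"
    and bd_mult: "\<And>n x u v. n \<ge> 3 \<Longrightarrow> x \<in> objs C \<Longrightarrow> u \<in> elts C n x \<Longrightarrow>
      v \<in> elts C n x \<Longrightarrow>
      bd C n x (u \<otimes>\<^bsub>cgrp C n x\<^esub> v) = bd C n x u \<otimes>\<^bsub>cgrp C (n - 1) x\<^esub> bd C n x v"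
    and bd_act: "\<And>n x y t u. n \<ge> 3 \<Longrightarrow> t \<in> homs C x y \<Longrightarrow> u \<in> elts C n x \<Longrightarrow>
      bd C n y (act (xm C n) t u) = act (xm C (n - 1)) t (bd C n x u)"
    and b23: "\<And>x u. x \<in> objs C \<Longrightarrow> u \<in> elts C 3 x \<Longrightarrow> bd2 C x (bd C 3 x u) = gid (base C) x"
    and bb: "\<And>n x u. n \<ge> 4 \<Longrightarrow> x \<in> objs C \<Longrightarrow> u \<in> elts C n x \<Longrightarrow>
      bd C (n - 1) x (bd C n x u) = neutral C (n - 2) x"
    and triv: "\<And>n x u v. n \<ge> 3 \<Longrightarrow> x \<in> objs C \<Longrightarrow> v \<in> elts C 2 x \<Longrightarrow>
      u \<in> elts C n x \<Longrightarrow> act (xm C n) (bd2 C x v) u = u"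
  shows "crossed_complex C"
proof -
  let ?G = "base C"
  have "Xm_morphism ?G (xm C 2) (one_xmod ?G) (bd2 C)"
  proof -
    note M = crossed_moduleD[OF xmod[of 2]]
    have "bd2 C x \<in> hom (cgrp C 2 x) (End_group ?G x)" if "x \<in> gobj ?G" for x
      using M(7,8)[of x] group.subgroup_self[OF M(2)[of x]] that
      by (intro homI) (auto simp: End_group_def d2[symmetric] subgroup_def)
    moreover have "bd2 C y (act (xm C 2) t u) = gcomp ?G (gcomp ?G t (bd2 C x u)) (ginv ?G t)"
      if "t \<in> ghom ?G x y" "u \<in> elts C 2 x" for x y t u
      using M(3,9)[of t x y u] ghom_obj[OF G that(1)] that by (simp add: d2[symmetric])
    ultimately show ?thesis
      using xmod[of 2] one_xmod_crossed_module[OF G] is_functor_id[OF G] d2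
      by (simp add: xmod_morphism_def G_group_map_def pullback_def one_xmod_def End_G_def)
  qed
  moreover have "Xm_morphism ?G (xm C n) (xm C (n - 1)) (bd C n)" if n: "n \<ge> 3" for n
  proof -
    have "dlt (xm C n) x u = dlt (xm C (n - 1)) x (bd C n x u)"
      if x: "x \<in> gobj ?G" and u: "u \<in> elts C n x" for x u
    proof (cases "n = 3")
      case True
      then show ?thesis using dn[OF n x u] bd_closed[OF n x u] d2[OF x] b23[OF x] u by simp
    next
      case False
      then show ?thesis using n dn[OF n x u] bd_closed[OF n x u] dn[of "n - 1" x] x by simp
    qed
    then show ?thesis
      using xmod[of n] xmod[of "n - 1"] n is_functor_id[OF G] bd_closed[OF n] bd_mult[OF n] bd_act[OF n]
      by (simp add: xmod_morphism_def G_group_map_def pullback_def hom_def Pi_def)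
  qed
  ultimately show ?thesis
    unfolding crossed_complex_def using G xmod b23 bb triv by blast
qed

context
  fixes C :: "('o, 'm, 'a) ccx" and D :: "('p, 'q, 'b) ccx" and f :: "('o, 'm, 'a, 'p, 'q, 'b) cmor"
  assumes f: "cc_morphism C D f"
begin

lemma mor_dom: "crossed_complex C"
  and mor_cod: "crossed_complex D"
  and mor_functor: "is_functor (base C) (base D) (mbase f)"
  and mor_bd2: "x \<in> objs C \<Longrightarrow> u \<in> elts C 2 x \<Longrightarrow> ar f (bd2 C x u) = bd2 D (ob f x) (mcmp f 2 x u)"
  and mor_bd: "n \<ge> 3 \<Longrightarrow> x \<in> objs C \<Longrightarrow> u \<in> elts C n x \<Longrightarrow>
    mcmp f (n - 1) x (bd C n x u) = bd D n (ob f x) (mcmp f n x u)"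
  and mor_xmod: "n \<ge> 2 \<Longrightarrow> xmod_morphism (base C) (xm C n) (base D) (xm D n) (mbase f) (mcmp f n)"
  using f by (simp_all add: cc_morphism_def)

lemma mor_hom: "n \<ge> 2 \<Longrightarrow> x \<in> objs C \<Longrightarrow> mcmp f n x \<in> hom (cgrp C n x) (cgrp D n (ob f x))"
  using mor_xmod by (simp add: xmod_morphism_def G_group_map_def pullback_def)

lemma mor_act: "n \<ge> 2 \<Longrightarrow> t \<in> homs C x y \<Longrightarrow> u \<in> elts C n x \<Longrightarrow>
    mcmp f n y (act (xm C n) t u) = act (xm D n) (ar f t) (mcmp f n x u)"
  using mor_xmod[of n] ghom_obj[OF base_groupoid[OF mor_dom], of t x y]
  by (simp add: xmod_morphism_def G_group_map_def pullback_def)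

lemma mor_dlt: "n \<ge> 2 \<Longrightarrow> x \<in> objs C \<Longrightarrow> u \<in> elts C n x \<Longrightarrow>
    ar f (dlt (xm C n) x u) = dlt (xm D n) (ob f x) (mcmp f n x u)"
  using mor_xmod by (simp add: xmod_morphism_def)

end

lemmas cc_morphismD = mor_dom mor_cod mor_functor mor_hom mor_act mor_dlt mor_bd2 mor_bd

text \<open>Compatibility with the maps \<open>\<delta>\<close> is a consequence: in dimension 2 it is compatibility with
  \<open>\<partial>\<^sub>2\<close>, and in higher dimensions \<open>\<delta>\<close> is trivial.\<close>

lemma cc_morphismI:
  assumes C: "crossed_complex C" and D: "crossed_complex D"
    and F: "is_functor (base C) (base D) (mbase f)"
    and closed: "\<And>n x u. n \<ge> 2 \<Longrightarrow> x \<in> objs C \<Longrightarrow> u \<in> elts C n x \<Longrightarrow>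
      mcmp f n x u \<in> elts D n (ob f x)"
    and mult: "\<And>n x u v. n \<ge> 2 \<Longrightarrow> x \<in> objs C \<Longrightarrow> u \<in> elts C n x \<Longrightarrow>
      v \<in> elts C n x \<Longrightarrow>
      mcmp f n x (u \<otimes>\<^bsub>cgrp C n x\<^esub> v) = mcmp f n x u \<otimes>\<^bsub>cgrp D n (ob f x)\<^esub> mcmp f n x v"
    and act: "\<And>n x y t u. n \<ge> 2 \<Longrightarrow> t \<in> homs C x y \<Longrightarrow> u \<in> elts C n x \<Longrightarrow>
      mcmp f n y (act (xm C n) t u) = act (xm D n) (ar f t) (mcmp f n x u)"
    and b2: "\<And>x u. x \<in> objs C \<Longrightarrow> u \<in> elts C 2 x \<Longrightarrow>
      ar f (bd2 C x u) = bd2 D (ob f x) (mcmp f 2 x u)"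
    and b: "\<And>n x u. n \<ge> 3 \<Longrightarrow> x \<in> objs C \<Longrightarrow> u \<in> elts C n x \<Longrightarrow>
      mcmp f (n - 1) x (bd C n x u) = bd D n (ob f x) (mcmp f n x u)"
  shows "cc_morphism C D f"
proof -
  note CC = crossed_complexD[OF C] and DD = crossed_complexD[OF D] and FF = is_functorD[OF F]
  have "xmod_morphism (base C) (xm C n) (base D) (xm D n) (mbase f) (mcmp f n)" if n: "n \<ge> 2" for n
  proof -
    have "ar f (dlt (xm C n) x u) = dlt (xm D n) (ob f x) (mcmp f n x u)"
      if x: "x \<in> objs C" and u: "u \<in> elts C n x" for x u
    proof (cases "n = 2")
      case True
      then show ?thesis
        using CC(3)[OF x] DD(3)[OF FF(3)[OF x] closed[of 2, OF _ x]] b2[OF x] u by simp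
    next
      case False
      then have "n \<ge> 3" using n by simp
      then show ?thesis
        using CC(4)[OF _ x u] DD(4)[OF _ FF(3)[OF x] closed[OF n x u]] FF(5)[OF x] by simp
    qed
    then show ?thesis
      using CC(2)[OF n] DD(2)[OF n] F closed[OF n] mult[OF n] act[OF n]
      by (simp add: xmod_morphism_def G_group_map_def pullback_def hom_def Pi_def)
  qed
  then show ?thesis using C D F b2 b by (simp add: cc_morphism_def)
qed

section \<open>Quotients of crossed complexes\<close>

lemma group_image:
  assumes G: "group G" and car: "carrier H = h ` carrier G" and one: "\<one>\<^bsub>H\<^esub> = h \<one>\<^bsub>G\<^esub>"
    and mult: "\<And>u v. u \<in> carrier G \<Longrightarrow> v \<in> carrier G \<Longrightarrow> h (u \<otimes>\<^bsub>G\<^esub> v) = h u \<otimes>\<^bsub>H\<^esub> h v"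
  shows "group H" and "u \<in> carrier G \<Longrightarrow> h (inv\<^bsub>G\<^esub> u) = inv\<^bsub>H\<^esub> h u"
proof -
  have h: "h \<in> hom G H" using car mult by (intro homI) auto
  have "H = H\<lparr>carrier := h ` carrier G, one := h \<one>\<^bsub>G\<^esub>\<rparr>"
    by (simp add: car[symmetric] one[symmetric])
  then show H: "group H" using group.hom_imp_img_group[OF G h] by simp
  show "u \<in> carrier G \<Longrightarrow> h (inv\<^bsub>G\<^esub> u) = inv\<^bsub>H\<^esub> h u"
    using group_hom.hom_inv[of G H h u] G H h by (simp add: group_hom_def group_hom_axioms_def)
qed

text \<open>Here \<open>D\<close> is a bare record, of which \<open>q\<close> carries each operation of \<open>C\<close> to the
  corresponding one; these conditions turn it into a crossed complex.\<close>

locale cc_quotient =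
  fixes C :: "('o, 'm, 'a) ccx" and D :: "('p, 'q, 'b) ccx" and q :: "('o, 'm, 'a, 'p, 'q, 'b) cmor"
  assumes C: "crossed_complex C" and gq: "gpd_quotient (base C) (base D) (mbase q)"
    and car: "n \<ge> 2 \<Longrightarrow> x \<in> objs C \<Longrightarrow> elts D n (ob q x) = mcmp q n x ` elts C n x"
    and one: "n \<ge> 2 \<Longrightarrow> x \<in> objs C \<Longrightarrow> neutral D n (ob q x) = mcmp q n x (neutral C n x)"
    and mult: "n \<ge> 2 \<Longrightarrow> x \<in> objs C \<Longrightarrow> u \<in> elts C n x \<Longrightarrow> v \<in> elts C n x \<Longrightarrow>
      mcmp q n x (u \<otimes>\<^bsub>cgrp C n x\<^esub> v) = mcmp q n x u \<otimes>\<^bsub>cgrp D n (ob q x)\<^esub> mcmp q n x v"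
    and act: "n \<ge> 2 \<Longrightarrow> t \<in> homs C x y \<Longrightarrow> u \<in> elts C n x \<Longrightarrow>
      mcmp q n y (act (xm C n) t u) = act (xm D n) (ar q t) (mcmp q n x u)"
    and dlt: "n \<ge> 2 \<Longrightarrow> x \<in> objs C \<Longrightarrow> u \<in> elts C n x \<Longrightarrow>
      ar q (dlt (xm C n) x u) = dlt (xm D n) (ob q x) (mcmp q n x u)"
    and b2: "x \<in> objs C \<Longrightarrow> u \<in> elts C 2 x \<Longrightarrow> ar q (bd2 C x u) = bd2 D (ob q x) (mcmp q 2 x u)"
    and b: "n \<ge> 3 \<Longrightarrow> x \<in> objs C \<Longrightarrow> u \<in> elts C n x \<Longrightarrow>
      mcmp q (n - 1) x (bd C n x u) = bd D n (ob q x) (mcmp q n x u)"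
begin

lemmas CD = crossed_complexD[OF C]
lemmas G = CD(1)
lemmas F = gpd_quotient_functor[OF G gq]
lemmas FD = is_functorD[OF F]

lemma obj: "y \<in> objs D \<Longrightarrow> \<exists>x. x \<in> objs C \<and> y = ob q x"
  using gpd_quotient_lift_obj[OF gq] by blast

lemma el: "n \<ge> 2 \<Longrightarrow> x \<in> objs C \<Longrightarrow> u \<in> elts D n (ob q x) \<Longrightarrow>
    \<exists>u'. u' \<in> elts C n x \<and> u = mcmp q n x u'"
  using car by auto

lemma lift_t:
  assumes t: "t \<in> homs D x y"
  shows "\<exists>x' y' t'. x' \<in> objs C \<and> x = ob q x' \<and> y' \<in> objs C \<and> y = ob q y' \<and>
      t' \<in> homs C x' y' \<and> t = ar q t'"
proof -
  obtain x' where x': "x' \<in> objs C" "x = ob q x'" using obj ghom_obj[OF FD(2) t] by blast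
  obtain y' where y': "y' \<in> objs C" "y = ob q y'" using obj ghom_obj[OF FD(2) t] by blast
  show ?thesis using gpd_quotient_lift_hom[OF G gq x'(1) y'(1)] t x' y' by metis
qed

text \<open>Every axiom of crossed complexes concerns elements over one object or along composable
  arrows, and these can be lifted to \<open>C\<close>.\<close>

theorem cc_quotient_morphism: "cc_morphism C D q"
proof -
  let ?G = "base C" and ?H = "base D"
  have closed: "mcmp q n x u \<in> elts D n (ob q x)"
    if "n \<ge> 2" "x \<in> objs C" "u \<in> elts C n x" for n x u
    using car[OF that(1,2)] that(3) by simp
  have grp: "group (cgrp D n (ob q x))"
    and inv: "u \<in> elts C n x \<Longrightarrow> mcmp q n x (inv\<^bsub>cgrp C n x\<^esub> u) = inv\<^bsub>cgrp D n (ob q x)\<^esub> mcmp q n x u"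
    if "n \<ge> 2" "x \<in> objs C" for n x u
    by (rule group_image[OF crossed_moduleD(2)[OF CD(2)[OF that(1)] that(2)] car[OF that] one[OF that]
        mult[OF that]]; assumption)+
  have xmod: "crossed_module ?H (xm D n)" if n: "n \<ge> 2" for n
  proof (rule crossed_moduleI[OF FD(2)])
    note M = crossed_moduleD[OF CD(2)[OF n]]
    fix x assume "x \<in> objs D"
    then obtain x' where x': "x' \<in> objs C" "x = ob q x'" using obj by blast
    show "group (cgrp D n x)" using grp[OF n] x' by simp
    fix u assume "u \<in> elts D n x"
    then obtain u' where u': "u' \<in> elts C n x'" "u = mcmp q n x' u'"
      using el[OF n x'(1)] x'(2) by blast
    show "act (xm D n) (gid ?H x) u = u"
      using act[OF n gid_hom[OF G x'(1)] u'(1)] FD(5)[OF x'(1)] M(5)[OF x'(1) u'(1)] x'(2) u'(2) by simp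
    show "dlt (xm D n) x u \<in> homs D x x"
      using FD(4)[OF M(7)[OF x'(1) u'(1)]] dlt[OF n x'(1) u'(1)] x'(2) u'(2) by simp
    fix v assume "v \<in> elts D n x"
    then obtain v' where v': "v' \<in> elts C n x'" "v = mcmp q n x' v'"
      using el[OF n x'(1)] x'(2) by blast
    interpret g: group "cgrp C n x'" by (rule M(2)[OF x'(1)])
    have "dlt (xm D n) x (u \<otimes>\<^bsub>cgrp D n x\<^esub> v) = ar q (dlt (xm C n) x' (u' \<otimes>\<^bsub>cgrp C n x'\<^esub> v'))"
      using dlt[OF n x'(1) g.m_closed[OF u'(1) v'(1)]] mult[OF n x'(1) u'(1) v'(1)] x'(2) u'(2) v'(2) by simp
    then show "dlt (xm D n) x (u \<otimes>\<^bsub>cgrp D n x\<^esub> v) = gcomp ?H (dlt (xm D n) x u) (dlt (xm D n) x v)"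
      using M(8)[OF x'(1) u'(1) v'(1)] FD(6)[OF M(7)[OF x'(1) v'(1)] M(7)[OF x'(1) u'(1)]]
        dlt[OF n x'(1) u'(1)] dlt[OF n x'(1) v'(1)] x'(2) u'(2) v'(2) by simp
    have "act (xm D n) (dlt (xm D n) x u) v = mcmp q n x' (act (xm C n) (dlt (xm C n) x' u') v')"
      using act[OF n M(7)[OF x'(1) u'(1)] v'(1)] dlt[OF n x'(1) u'(1)] x'(2) u'(2) v'(2) by simp
    then show "act (xm D n) (dlt (xm D n) x u) v = u \<otimes>\<^bsub>cgrp D n x\<^esub> v \<otimes>\<^bsub>cgrp D n x\<^esub> inv\<^bsub>cgrp D n x\<^esub> u"
      using M(10)[OF x'(1) u'(1) v'(1)] mult[OF n x'(1)] inv[OF n x'(1) u'(1)] x'(2) u' v' by simp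
  next
    note M = crossed_moduleD[OF CD(2)[OF n]]
    fix x y t u assume "t \<in> homs D x y" and "u \<in> elts D n x"
    then obtain x' y' t' u' where x': "x' \<in> objs C" "x = ob q x'" and y': "y' \<in> objs C" "y = ob q y'"
      and t': "t' \<in> homs C x' y'" "t = ar q t'"
      and u': "u' \<in> elts C n x'" "u = mcmp q n x' u'"
      using lift_t el[OF n] by metis
    note a = act[OF n t'(1) u'(1)]
    show "act (xm D n) t u \<in> elts D n y"
      using closed[OF n y'(1) M(3)[OF t'(1) u'(1)]] a t'(2) u'(2) y'(2) by simp
    have "dlt (xm D n) y (act (xm D n) t u) = ar q (dlt (xm C n) y' (act (xm C n) t' u'))"
      using a dlt[OF n y'(1) M(3)[OF t'(1) u'(1)]] t'(2) u'(2) y'(2) by simp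
    also have "\<dots> = ar q (gcomp ?G (gcomp ?G t' (dlt (xm C n) x' u')) (ginv ?G t'))"
      by (simp only: M(9)[OF t'(1) u'(1)])
    also have "\<dots> = gcomp ?H (gcomp ?H (ar q t') (ar q (dlt (xm C n) x' u'))) (ar q (ginv ?G t'))"
      using FD(6)[OF ginv(1)[OF G t'(1)] gcomp_hom[OF G M(7)[OF x'(1) u'(1)] t'(1)]]
        FD(6)[OF M(7)[OF x'(1) u'(1)] t'(1)] by simp
    finally show "dlt (xm D n) y (act (xm D n) t u) = gcomp ?H (gcomp ?H t (dlt (xm D n) x u)) (ginv ?H t)"
      using is_functor_ginv[OF F t'(1)] dlt[OF n x'(1) u'(1)] t'(2) u'(2) x'(2) by simp
    fix v assume "v \<in> elts D n x"
    then obtain v' where v': "v' \<in> elts C n x'" "v = mcmp q n x' v'"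
      using el[OF n x'(1)] x'(2) by blast
    interpret g: group "cgrp C n x'" by (rule M(2)[OF x'(1)])
    have "act (xm D n) t (u \<otimes>\<^bsub>cgrp D n x\<^esub> v) = mcmp q n y' (act (xm C n) t' (u' \<otimes>\<^bsub>cgrp C n x'\<^esub> v'))"
      using act[OF n t'(1) g.m_closed[OF u'(1) v'(1)]] mult[OF n x'(1) u'(1) v'(1)] x'(2) t'(2) u'(2) v'(2)
      by simp
    then show "act (xm D n) t (u \<otimes>\<^bsub>cgrp D n x\<^esub> v) = act (xm D n) t u \<otimes>\<^bsub>cgrp D n y\<^esub> act (xm D n) t v"
      using M(4)[OF t'(1) u'(1) v'(1)] mult[OF n y'(1) M(3)[OF t'(1) u'(1)] M(3)[OF t'(1) v'(1)]] a
        act[OF n t'(1) v'(1)] y'(2) t'(2) u'(2) v'(2) by simp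
  next
    note M = crossed_moduleD[OF CD(2)[OF n]]
    fix x y z s t u assume s: "s \<in> homs D x y" and t: "t \<in> homs D y z" and "u \<in> elts D n x"
    then obtain x' y' s' u' where x': "x' \<in> objs C" "x = ob q x'" and y': "y' \<in> objs C" "y = ob q y'"
      and s': "s' \<in> homs C x' y'" "s = ar q s'"
      and u': "u' \<in> elts C n x'" "u = mcmp q n x' u'"
      using lift_t el[OF n] by metis
    obtain z' where z': "z' \<in> objs C" "z = ob q z'" using obj ghom_obj[OF FD(2) t] by blast
    obtain t' where t': "t' \<in> homs C y' z'" "t = ar q t'"
      using gpd_quotient_lift_hom[OF G gq y'(1) z'(1)] t y'(2) z'(2) by metis
    show "act (xm D n) (gcomp ?H t s) u = act (xm D n) t (act (xm D n) s u)"
      using act[OF n gcomp_hom[OF G s'(1) t'(1)] u'(1)] FD(6)[OF s'(1) t'(1)] M(6)[OF s'(1) t'(1) u'(1)]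
        act[OF n t'(1) M(3)[OF s'(1) u'(1)]] act[OF n s'(1) u'(1)] s'(2) t'(2) u'(2) by simp
  qed
  have D: "crossed_complex D"
  proof (rule crossed_complexI[OF FD(2) xmod])
    fix n x u v assume x: "x \<in> objs D" and n: "n \<ge> 3" and u: "u \<in> elts D n x"
    obtain x' where x': "x' \<in> objs C" "x = ob q x'" using obj[OF x] by blast
    have n2: "n \<ge> 2" "n - 1 \<ge> 2" using n by simp_all
    obtain u' where u': "u' \<in> elts C n x'" "u = mcmp q n x' u'"
      using el[OF n2(1) x'(1)] u x'(2) by blast
    note bdc = hom_in_carrier[OF CD(5)[OF n x'(1)]]
    show "dlt (xm D n) x u = gid ?H x"
      using dlt[OF n2(1) x'(1) u'(1)] CD(4)[OF n x'(1) u'(1)] FD(5)[OF x'(1)] x' u' by simp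
    show "bd D n x u \<in> elts D (n - 1) x"
      using b[OF n x'(1) u'(1)] closed[OF n2(2) x'(1) bdc[OF u'(1)]] x' u' by simp
    { assume "v \<in> elts D n x"
      then obtain v' where v': "v' \<in> elts C n x'" "v = mcmp q n x' v'"
        using el[OF n2(1) x'(1)] x'(2) by blast
      interpret g: group "cgrp C n x'" by (rule crossed_moduleD(2)[OF CD(2)[OF n2(1)] x'(1)])
      have "bd D n x (u \<otimes>\<^bsub>cgrp D n x\<^esub> v) = mcmp q (n - 1) x' (bd C n x' (u' \<otimes>\<^bsub>cgrp C n x'\<^esub> v'))"
        using b[OF n x'(1) g.m_closed[OF u'(1) v'(1)]] mult[OF n2(1) x'(1) u'(1) v'(1)] x'(2) u'(2) v'(2)
        by simp
      then show "bd D n x (u \<otimes>\<^bsub>cgrp D n x\<^esub> v) = bd D n x u \<otimes>\<^bsub>cgrp D (n - 1) x\<^esub> bd D n x v"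
        using hom_mult[OF CD(5)[OF n x'(1)] u'(1) v'(1)] mult[OF n2(2) x'(1) bdc[OF u'(1)] bdc[OF v'(1)]]
          b[OF n x'(1) u'(1)] b[OF n x'(1) v'(1)] x'(2) u'(2) v'(2) by simp }
    { assume "v \<in> elts D 2 x"
      then obtain v' where v': "v' \<in> elts C 2 x'" "v = mcmp q 2 x' v'"
        using el[OF _ x'(1), of 2] x'(2) by auto
      have d: "bd2 C x' v' \<in> homs C x' x'"
        using crossed_moduleD(7)[OF CD(2), of 2 x' v'] x' v' CD(3)[OF x'(1) v'(1)] by simp
      show "act (xm D n) (bd2 D x v) u = u"
        using act[OF n2(1) d u'(1)] b2[OF x'(1) v'(1)] CD(9)[OF n x'(1) v'(1) u'(1)] x'(2) u'(2) v'(2) by simp }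
  next
    fix n x u assume x: "x \<in> objs D" and n: "n \<ge> 4" and u: "u \<in> elts D n x"
    obtain x' where x': "x' \<in> objs C" "x = ob q x'" using obj[OF x] by blast
    have n2: "n \<ge> 2" "n \<ge> 3" "n - 1 \<ge> 3" "n - 2 \<ge> 2" "n - 1 - 1 = n - 2" using n by simp_all
    obtain u' where u': "u' \<in> elts C n x'" "u = mcmp q n x' u'"
      using el[OF n2(1) x'(1)] u x'(2) by blast
    show "bd D (n - 1) x (bd D n x u) = neutral D (n - 2) x"
      using b[OF n2(2) x'(1) u'(1)] b[OF n2(3) x'(1) hom_in_carrier[OF CD(5)[OF n2(2) x'(1)] u'(1)]]
        CD(8)[OF n x'(1) u'(1)] one[OF n2(4) x'(1)] n2(5) x'(2) u'(2) by simp
  next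
    fix x u assume x: "x \<in> objs D" and u: "u \<in> elts D 2 x"
    obtain x' where x': "x' \<in> objs C" "x = ob q x'" using obj[OF x] by blast
    obtain u' where u': "u' \<in> elts C 2 x'" "u = mcmp q 2 x' u'"
      using el[OF _ x'(1), of 2] u x'(2) by auto
    show "dlt (xm D 2) x u = bd2 D x u"
      using dlt[OF _ x'(1) u'(1)] b2[OF x'(1) u'(1)] CD(3)[OF x'(1) u'(1)] x' u' by simp
  next
    fix x u assume x: "x \<in> objs D" and u: "u \<in> elts D 3 x"
    obtain x' where x': "x' \<in> objs C" "x = ob q x'" using obj[OF x] by blast
    obtain u' where u': "u' \<in> elts C 3 x'" "u = mcmp q 3 x' u'"
      using el[OF _ x'(1), of 3] u x'(2) by auto
    show "bd2 D x (bd D 3 x u) = gid ?H x"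
      using b[OF _ x'(1) u'(1)] b2[OF x'(1), of "bd C 3 x' u'"] hom_in_carrier[OF CD(5)[OF _ x'(1)] u'(1)]
        CD(7)[OF x'(1) u'(1)] FD(5)[OF x'(1)] x' u' by simp
  next
    fix n x y t u assume n: "n \<ge> 3" and "t \<in> homs D x y" and "u \<in> elts D n x"
    moreover have n2: "n \<ge> 2" "n - 1 \<ge> 2" using n by simp_all
    ultimately obtain x' y' t' u' where x': "x' \<in> objs C" "x = ob q x'" and y': "y' \<in> objs C" "y = ob q y'"
      and t': "t' \<in> homs C x' y'" "t = ar q t'"
      and u': "u' \<in> elts C n x'" "u = mcmp q n x' u'"
      using lift_t el[OF n2(1)] by metis
    show "bd D n y (act (xm D n) t u) = act (xm D (n - 1)) t (bd D n x u)"
      using act[OF n2(1) t'(1) u'(1)] b[OF n x'(1) u'(1)] CD(6)[OF n t'(1) u'(1)]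
        b[OF n y'(1) crossed_moduleD(3)[OF CD(2)[OF n2(1)] t'(1) u'(1)]]
        act[OF n2(2) t'(1) hom_in_carrier[OF CD(5)[OF n x'(1)] u'(1)]] x'(2) y'(2) t'(2) u'(2) by simp
  qed
  show ?thesis
    by (rule cc_morphismI[OF C D F]) (use closed mult act b2 b in auto)
qed

text \<open>Elements and composable arrows of \<open>D\<close> lift to \<open>C\<close>, so the identities for \<open>e\<close> follow from
  those for \<open>r\<close>.\<close>

lemma cc_morphism_descends:
  assumes r: "cc_morphism C E r"
    and fo: "\<And>x. x \<in> objs C \<Longrightarrow> ob e (ob q x) = ob r x"
    and fa: "\<And>t. t \<in> garr (base C) \<Longrightarrow> ar e (ar q t) = ar r t"
    and mc: "\<And>n x u. n \<ge> 2 \<Longrightarrow> x \<in> objs C \<Longrightarrow> u \<in> elts C n x \<Longrightarrow>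
      mcmp e n (ob q x) (mcmp q n x u) = mcmp r n x u"
  shows "cc_morphism D E e"
proof -
  let ?H = "base D"
  note R = cc_morphismD[OF r] and QD = cc_morphismD[OF cc_quotient_morphism]
  note RF = is_functorD[OF R(3)] and QF = FD
  have E: "is_functor ?H (base E) (mbase e)"
  proof (rule is_functorI[OF QF(2) RF(2)])
    fix x assume "x \<in> objs D"
    then obtain x' where x': "x' \<in> objs C" "x = ob q x'" using obj by blast
    show "ob e x \<in> objs E" using fo[OF x'(1)] RF(3)[OF x'(1)] x'(2) by simp
    show "ar e (gid ?H x) = gid (base E) (ob e x)"
      using fa[OF ghomD(1)[OF gid_hom[OF G x'(1)]]] QF(5)[OF x'(1)] RF(5)[OF x'(1)] fo[OF x'(1)] x'(2)
      by simp
  next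
    fix x y s assume "s \<in> homs D x y"
    then obtain x' y' s' where x': "x' \<in> objs C" "x = ob q x'" and y': "y' \<in> objs C" "y = ob q y'"
      and s': "s' \<in> homs C x' y'" "s = ar q s'" using lift_t by metis
    show "ar e s \<in> homs E (ob e x) (ob e y)"
      using RF(4)[OF s'(1)] fa[OF ghomD(1)[OF s'(1)]] fo[OF x'(1)] fo[OF y'(1)] x'(2) y'(2) s'(2) by simp
    fix z t assume t: "t \<in> homs D y z"
    obtain z' where z': "z' \<in> objs C" "z = ob q z'" using obj ghom_obj[OF QF(2) t] by blast
    obtain t' where t': "t' \<in> homs C y' z'" "t = ar q t'"
      using gpd_quotient_lift_hom[OF G gq y'(1) z'(1)] t y'(2) z'(2) by metis
    show "ar e (gcomp ?H t s) = gcomp (base E) (ar e t) (ar e s)"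
      using QF(6)[OF s'(1) t'(1)] RF(6)[OF s'(1) t'(1)] fa[OF ghomD(1)[OF gcomp_hom[OF G s'(1) t'(1)]]]
        fa[OF ghomD(1)[OF s'(1)]] fa[OF ghomD(1)[OF t'(1)]] s'(2) t'(2) by simp
  qed
  show ?thesis
  proof (rule cc_morphismI[OF QD(2) R(2) E])
    fix n x u assume n: "n \<ge> 2" and "x \<in> objs D" and u: "u \<in> elts D n x"
    then obtain x' where x': "x' \<in> objs C" "x = ob q x'" using obj by blast
    obtain u' where u': "u' \<in> elts C n x'" "u = mcmp q n x' u'"
      using el[OF n x'(1)] u x'(2) by blast
    show "mcmp e n x u \<in> elts E n (ob e x)"
      using hom_in_carrier[OF R(4)[OF n x'(1)] u'(1)] mc[OF n x'(1) u'(1)] fo[OF x'(1)] x'(2) u'(2) by simp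
    fix v assume "v \<in> elts D n x"
    then obtain v' where v': "v' \<in> elts C n x'" "v = mcmp q n x' v'"
      using el[OF n x'(1)] x'(2) by blast
    interpret g: group "cgrp C n x'" by (rule crossed_moduleD(2)[OF CD(2)[OF n] x'(1)])
    show "mcmp e n x (u \<otimes>\<^bsub>cgrp D n x\<^esub> v) = mcmp e n x u \<otimes>\<^bsub>cgrp E n (ob e x)\<^esub> mcmp e n x v"
      using hom_mult[OF R(4)[OF n x'(1)] u'(1) v'(1)] hom_mult[OF QD(4)[OF n x'(1)] u'(1) v'(1)]
        mc[OF n x'(1) u'(1)] mc[OF n x'(1) v'(1)] mc[OF n x'(1) g.m_closed[OF u'(1) v'(1)]]
        fo[OF x'(1)] x'(2) u'(2) v'(2) by simp
  next
    fix n x y t u assume n: "n \<ge> 2" and "t \<in> homs D x y" and "u \<in> elts D n x"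
    then obtain x' y' t' u' where x': "x' \<in> objs C" "x = ob q x'" and y': "y' \<in> objs C" "y = ob q y'"
      and t': "t' \<in> homs C x' y'" "t = ar q t'"
      and u': "u' \<in> elts C n x'" "u = mcmp q n x' u'"
      using lift_t el[OF n] by metis
    show "mcmp e n y (act (xm D n) t u) = act (xm E n) (ar e t) (mcmp e n x u)"
      using R(5)[OF n t'(1) u'(1)] QD(5)[OF n t'(1) u'(1)] mc[OF n x'(1) u'(1)]
        mc[OF n y'(1) crossed_moduleD(3)[OF CD(2)[OF n] t'(1) u'(1)]] fa[OF ghomD(1)[OF t'(1)]]
        x'(2) y'(2) t'(2) u'(2) by simp
  next
    fix x u assume "x \<in> objs D" and u: "u \<in> elts D 2 x"
    then obtain x' where x': "x' \<in> objs C" "x = ob q x'" using obj by blast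
    obtain u' where u': "u' \<in> elts C 2 x'" "u = mcmp q 2 x' u'"
      using el[OF _ x'(1), of 2] u x'(2) by auto
    have d: "bd2 C x' u' \<in> homs C x' x'"
      using crossed_moduleD(7)[OF CD(2), of 2 x' u'] x' u' CD(3)[OF x'(1) u'(1)] by simp
    show "ar e (bd2 D x u) = bd2 E (ob e x) (mcmp e 2 x u)"
      using R(7)[OF x'(1) u'(1)] QD(7)[OF x'(1) u'(1)] fa[OF ghomD(1)[OF d]] fo[OF x'(1)]
        mc[OF _ x'(1) u'(1)] x'(2) u'(2) by simp
  next
    fix n x u assume n: "n \<ge> 3" and "x \<in> objs D" and u: "u \<in> elts D n x"
    then obtain x' where x': "x' \<in> objs C" "x = ob q x'" using obj by blast
    have n2: "n \<ge> 2" "n - 1 \<ge> 2" using n by simp_all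
    obtain u' where u': "u' \<in> elts C n x'" "u = mcmp q n x' u'"
      using el[OF n2(1) x'(1)] u x'(2) by blast
    show "mcmp e (n - 1) x (bd D n x u) = bd E n (ob e x) (mcmp e n x u)"
      using R(8)[OF n x'(1) u'(1)] QD(8)[OF n x'(1) u'(1)] mc[OF n2(1) x'(1) u'(1)] fo[OF x'(1)]
        mc[OF n2(2) x'(1) hom_in_carrier[OF CD(5)[OF n x'(1)] u'(1)]] x'(2) u'(2) by simp
  qed
qed

end

section \<open>The fundamental groupoid\<close>

context
  fixes C :: "('o, 'm, 'a) ccx"
  assumes C: "crossed_complex C"
begin

lemma
  assumes x: "x \<in> objs C" and u: "u \<in> elts C 2 x"
  shows bd2_ghom: "bd2 C x u \<in> homs C x x"
    and bd2_mult: "v \<in> elts C 2 x \<Longrightarrow>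
      bd2 C x (u \<otimes>\<^bsub>cgrp C 2 x\<^esub> v) = gcomp (base C) (bd2 C x u) (bd2 C x v)"
    and bd2_act: "t \<in> homs C x y \<Longrightarrow>
      bd2 C y (act (xm C 2) t u) = gcomp (base C) (gcomp (base C) t (bd2 C x u)) (ginv (base C) t)"
proof -
  note CD = crossed_complexD[OF C]
  have xm2: "crossed_module (base C) (xm C 2)" by (rule CD(2)) simp
  note M = crossed_moduleD[OF xm2]
  interpret g: group "cgrp C 2 x" by (rule M(2)[OF x])
  show "bd2 C x u \<in> homs C x x" using M(7)[OF x u] CD(3)[OF x u] by simp
  show "bd2 C x (u \<otimes>\<^bsub>cgrp C 2 x\<^esub> v) = gcomp (base C) (bd2 C x u) (bd2 C x v)"
    if v: "v \<in> elts C 2 x"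
    using M(8)[OF x u v] CD(3)[OF x] u v by simp
  show "bd2 C y (act (xm C 2) t u) = gcomp (base C) (gcomp (base C) t (bd2 C x u)) (ginv (base C) t)"
    if t: "t \<in> homs C x y"
    using M(9)[OF t u] CD(3)[OF x u] CD(3)[OF ghom_obj(2)[OF CD(1) t] M(3)[OF t u]] by simp
qed

lemma bd2_one:
  assumes x: "x \<in> objs C"
  shows "bd2 C x (neutral C 2 x) = gid (base C) x"
proof -
  have xm2: "crossed_module (base C) (xm C 2)" by (rule crossed_complexD(2)[OF C]) simp
  interpret group "cgrp C 2 x" by (rule crossed_moduleD(2)[OF xm2 x])
  show ?thesis
    using crossed_moduleD(12)[OF xm2 x] crossed_complexD(3)[OF C x one_closed] by simp
qed

lemma bd2_im_ghom: "x \<in> objs C \<Longrightarrow> d \<in> bd2_im C x \<Longrightarrow> d \<in> homs C x x"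
  using bd2_ghom by (auto simp: bd2_im_def)

lemma gid_in_bd2_im:
  assumes x: "x \<in> objs C"
  shows "gid (base C) x \<in> bd2_im C x"
proof -
  interpret group "cgrp C 2 x"
    using crossed_moduleD(2)[OF crossed_complexD(2)[OF C, of 2] x] by simp
  show ?thesis using bd2_one[OF x] unfolding bd2_im_def by force
qed

lemma bd2_im_gcomp:
  assumes x: "x \<in> objs C" and d: "d \<in> bd2_im C x" "d' \<in> bd2_im C x"
  shows "gcomp (base C) d d' \<in> bd2_im C x"
proof -
  interpret group "cgrp C 2 x"
    using crossed_moduleD(2)[OF crossed_complexD(2)[OF C, of 2] x] by simp
  obtain u v where "u \<in> elts C 2 x" "v \<in> elts C 2 x" "d = bd2 C x u" "d' = bd2 C x v"
    using d by (auto simp: bd2_im_def)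
  then show ?thesis unfolding bd2_im_def by (intro image_eqI[of _ _ "u \<otimes>\<^bsub>cgrp C 2 x\<^esub> v"]) (auto simp: bd2_mult[OF x])
qed

lemma bd2_im_ginv:
  assumes x: "x \<in> objs C" and d: "d \<in> bd2_im C x"
  shows "ginv (base C) d \<in> bd2_im C x"
proof -
  interpret group "cgrp C 2 x"
    using crossed_moduleD(2)[OF crossed_complexD(2)[OF C, of 2] x] by simp
  obtain u where u: "u \<in> elts C 2 x" "d = bd2 C x u"
    using d by (auto simp: bd2_im_def)
  have "ginv (base C) d = bd2 C x (inv\<^bsub>cgrp C 2 x\<^esub> u)"
    using ginv_equality[OF crossed_complexD(1)[OF C] bd2_ghom[OF x u(1)] bd2_ghom[OF x inv_closed[OF u(1)]]]
      bd2_mult[OF x u(1) inv_closed[OF u(1)]] bd2_mult[OF x inv_closed[OF u(1)] u(1)] u bd2_one[OF x]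
    by simp
  then show ?thesis using u(1) unfolding bd2_im_def by simp
qed

lemma bd2_im_conj:
  assumes t: "t \<in> homs C x y" and d: "d \<in> bd2_im C x"
  shows "gcomp (base C) (gcomp (base C) t d) (ginv (base C) t) \<in> bd2_im C y"
proof -
  note G = crossed_complexD(1)[OF C]
  obtain u where u: "u \<in> elts C 2 x" "d = bd2 C x u"
    using d by (auto simp: bd2_im_def)
  have "act (xm C 2) t u \<in> elts C 2 y"
    using crossed_moduleD(3)[OF crossed_complexD(2)[OF C, of 2] t] u by simp
  then show ?thesis
    using bd2_act[OF ghom_obj(1)[OF G t] u(1) t] u(2) unfolding bd2_im_def by (metis image_eqI)
qed

lemma pi1_class_ghom:
  assumes g: "g \<in> homs C x y"
  shows "pi1_class C g = (\<lambda>d. gcomp (base C) d g) ` bd2_im C y"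
    and "h \<in> pi1_class C g \<Longrightarrow> h \<in> homs C x y"
    and "g \<in> pi1_class C g"
proof -
  note G = crossed_complexD(1)[OF C]
  have y: "y \<in> objs C" using ghom_obj[OF G g] by simp
  show e: "pi1_class C g = (\<lambda>d. gcomp (base C) d g) ` bd2_im C y"
    using ghomD[OF g] by (auto simp: pi1_class_def)
  show "h \<in> pi1_class C g \<Longrightarrow> h \<in> homs C x y"
    using gcomp_hom[OF G g bd2_im_ghom[OF y]] e by auto
  show "g \<in> pi1_class C g"
    using gcomp_id(2)[OF G g] gid_in_bd2_im[OF y] e by force
qed

lemma pi1_class_eqI:
  assumes g: "g \<in> homs C x y" and h: "h \<in> pi1_class C g"
  shows "pi1_class C h = pi1_class C g"
proof -
  note G = crossed_complexD(1)[OF C]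
  note e = pi1_class_ghom[OF g]
  have y: "y \<in> objs C" using ghom_obj[OF G g] by simp
  note e' = pi1_class_ghom[OF e(2)[OF h]]
  have sub: "pi1_class C h \<subseteq> pi1_class C g"
    if g: "g \<in> homs C x y" and h: "h \<in> pi1_class C g" for g h
  proof
    fix k assume k: "k \<in> pi1_class C h"
    note e = pi1_class_ghom[OF g]
    obtain d where d: "d \<in> bd2_im C y" "h = gcomp (base C) d g" using h e by auto
    obtain d' where d': "d' \<in> bd2_im C y" "k = gcomp (base C) d' h"
      using k pi1_class_ghom(1)[OF e(2)[OF h]] by auto
    have "k = gcomp (base C) (gcomp (base C) d' d) g"
      using d d' gcomp_assoc[OF G g bd2_im_ghom[OF y d(1)] bd2_im_ghom[OF y d'(1)]] by simp
    then show "k \<in> pi1_class C g" using e(1) bd2_im_gcomp[OF y d'(1) d(1)] by auto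
  qed
  obtain d where d: "d \<in> bd2_im C y" "h = gcomp (base C) d g" using h e by auto
  have dh: "d \<in> homs C y y" by (rule bd2_im_ghom[OF y d(1)])
  have "gcomp (base C) (ginv (base C) d) h = g"
    using gcomp_cancel_inv(1)[OF G dh g g] d(2) by simp
  then have "g \<in> pi1_class C h" using e'(1) bd2_im_ginv[OF y d(1)] by auto
  then show ?thesis using sub[OF g h] sub[OF e(2)[OF h]] by blast
qed

text \<open>The image of \<open>\<partial>\<^sub>2\<close> is stable under conjugation, so a factor from it can be moved across
  \<open>g\<close> in a product \<open>g f\<close>.\<close>

lemma pi1_class_gcomp:
  assumes f: "f \<in> homs C x y" and g: "g \<in> homs C y z"
  shows "{gcomp (base C) b a | a b. a \<in> pi1_class C f \<and> b \<in> pi1_class C g} = pi1_class C (gcomp (base C) g f)"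
proof -
  let ?G = "base C"
  note G = crossed_complexD(1)[OF C]
  have y: "y \<in> gobj ?G" and z: "z \<in> gobj ?G" using ghom_obj[OF G g] by simp_all
  note ef = pi1_class_ghom[OF f] and eg = pi1_class_ghom[OF g]
  have gf: "gcomp ?G g f \<in> ghom ?G x z" by (rule gcomp_hom[OF G f g])
  note egf = pi1_class_ghom[OF gf]
  have "gcomp ?G b a \<in> pi1_class C (gcomp ?G g f)" if a: "a \<in> pi1_class C f" and b: "b \<in> pi1_class C g" for a b
  proof -
    obtain d where d: "d \<in> bd2_im C y" "a = gcomp ?G d f" using a ef by auto
    obtain d' where d': "d' \<in> bd2_im C z" "b = gcomp ?G d' g" using b eg by auto
    have dh: "d \<in> ghom ?G y y" and dh': "d' \<in> ghom ?G z z"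
      using bd2_im_ghom y z d(1) d'(1) by blast+
    note gi = ginv[OF G g]
    have gd: "gcomp ?G g d \<in> ghom ?G y z" by (rule gcomp_hom[OF G dh g])
    \<comment> \<open>\<open>c\<close> is the factor \<open>d\<close> after it has moved to the left of \<open>g\<close>.\<close>
    define c where "c = gcomp ?G (gcomp ?G g d) (ginv ?G g)"
    have c: "c \<in> bd2_im C z" "c \<in> ghom ?G z z"
      using bd2_im_conj[OF g d(1)] bd2_im_ghom[OF z] c_def by auto
    have cg: "gcomp ?G c g = gcomp ?G g d"
      using gcomp_assoc[OF G g gi(1) gd] gi(2) gcomp_id(1)[OF G gd] c_def by simp
    have "gcomp ?G b a = gcomp ?G d' (gcomp ?G g (gcomp ?G d f))"
      using gcomp_assoc[OF G gcomp_hom[OF G f dh] g dh'] d(2) d'(2) by simp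
    also have "gcomp ?G g (gcomp ?G d f) = gcomp ?G c (gcomp ?G g f)"
      using gcomp_assoc[OF G f dh g] gcomp_assoc[OF G f g c(2)] cg by simp
    also have "gcomp ?G d' (gcomp ?G c (gcomp ?G g f)) = gcomp ?G (gcomp ?G d' c) (gcomp ?G g f)"
      by (rule gcomp_assoc[OF G gf c(2) dh'])
    finally show ?thesis using egf(1) bd2_im_gcomp[OF z d'(1) c(1)] by simp
  qed
  moreover have "\<exists>a\<in>pi1_class C f. \<exists>b\<in>pi1_class C g. k = gcomp ?G b a"
    if k: "k \<in> pi1_class C (gcomp ?G g f)" for k
  proof -
    obtain d where d: "d \<in> bd2_im C z" "k = gcomp ?G d (gcomp ?G g f)" using k egf by auto
    have "k = gcomp ?G (gcomp ?G d g) f"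
      using d gcomp_assoc[OF G f g bd2_im_ghom[OF z d(1)]] by simp
    then show ?thesis using ef(3) eg(1) d(1) by blast
  qed
  ultimately show ?thesis by blast
qed

lemma pi1_quotient:
  "gpd_quotient (base C) (pi1 C) \<lparr>fo = (\<lambda>x. x), fa = pi1_class C\<rparr>"
proof -
  let ?G = "base C"
  note G = crossed_complexD(1)[OF C]
  have ends: "gsrc ?G ` pi1_class C g = {gsrc ?G g}" "gtgt ?G ` pi1_class C g = {gtgt ?G g}"
    if g: "g \<in> garr ?G" for g
  proof -
    note e = pi1_class_ghom(2,3)[OF garr_in_ghom[OF g]]
    note h = ghomD(2)[OF e(1)] ghomD(3)[OF e(1)]
    show "gsrc ?G ` pi1_class C g = {gsrc ?G g}"
      by (simp add: h image_constant[OF e(2)] cong: image_cong)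
    show "gtgt ?G ` pi1_class C g = {gtgt ?G g}"
      by (simp add: h image_constant[OF e(2)] cong: image_cong)
  qed
  have comp: "{gcomp ?G b a | a b. a \<in> pi1_class C f \<and> b \<in> pi1_class C g} = pi1_class C (gcomp ?G g f)"
    if "f \<in> garr ?G" "g \<in> garr ?G" "gtgt ?G f = gsrc ?G g" for f g
  proof -
    have f: "f \<in> ghom ?G (gsrc ?G f) (gsrc ?G g)" using garr_in_ghom[OF that(1)] that(3) by simp
    show ?thesis by (rule pi1_class_gcomp[OF f garr_in_ghom[OF that(2)]])
  qed
  show ?thesis
    unfolding gpd_quotient_def
  proof (intro conjI ballI impI)
    show "bij_betw (fo \<lparr>fo = \<lambda>x. x, fa = pi1_class C\<rparr>) (gobj ?G) (gobj (pi1 C))"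
      by (simp add: pi1_def Let_def bij_betw_def)
    show "gcomp (pi1 C) (fa \<lparr>fo = \<lambda>x. x, fa = pi1_class C\<rparr> g) (fa \<lparr>fo = \<lambda>x. x, fa = pi1_class C\<rparr> f)
        = fa \<lparr>fo = \<lambda>x. x, fa = pi1_class C\<rparr> (gcomp ?G g f)"
      if "f \<in> garr ?G" "g \<in> garr ?G" "gtgt ?G f = gsrc ?G g" for f g
      unfolding pi1_def Let_def gpd.simps fctr.simps by (rule comp[OF that])
  qed (simp_all add: pi1_def Let_def ends)
qed

lemma pi1_functor: "is_functor (base C) (pi1 C) \<lparr>fo = (\<lambda>x. x), fa = pi1_class C\<rparr>"
  by (rule gpd_quotient_functor[OF crossed_complexD(1)[OF C] pi1_quotient])

lemma pi1_groupoid: "groupoid (pi1 C)"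
  by (rule is_functorD(2)[OF pi1_functor])

lemma pi1_gobj: "gobj (pi1 C) = objs C"
  and pi1_gid: "gid (pi1 C) x = pi1_class C (gid (base C) x)"
  and pi1_garr: "garr (pi1 C) = pi1_class C ` garr (base C)"
  by (simp_all add: pi1_def Let_def)

lemma pi1_gsrc: "g \<in> garr (base C) \<Longrightarrow> gsrc (pi1 C) (pi1_class C g) = gsrc (base C) g"
  and pi1_gtgt: "g \<in> garr (base C) \<Longrightarrow> gtgt (pi1 C) (pi1_class C g) = gtgt (base C) g"
  using pi1_quotient by (simp_all add: gpd_quotient_def)

lemma pi1_gcomp:
  assumes "f \<in> homs C x y" "g \<in> homs C y z"
  shows "gcomp (pi1 C) (pi1_class C g) (pi1_class C f) = pi1_class C (gcomp (base C) g f)"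
  using is_functorD(6)[OF pi1_functor assms] by simp

lemma pi1_ghom: "ghom (pi1 C) x y = pi1_class C ` homs C x y"
  by (auto simp: ghom_def pi1_garr pi1_gsrc pi1_gtgt)

end

section \<open>The truncations\<close>

lemma zero_xmod_simps [simp]:
  "carrier (grp (zero_xmod G e) x) = {e}" "\<one>\<^bsub>grp (zero_xmod G e) x\<^esub> = e"
  "u \<otimes>\<^bsub>grp (zero_xmod G e) x\<^esub> v = e" "act (zero_xmod G e) t u = e" "dlt (zero_xmod G e) x u = gid G x"
  by (simp_all add: zero_xmod_def)

lemma zero_xmod_crossed_module:
  assumes G: "groupoid G"
  shows "crossed_module G (zero_xmod G e)"
proof (rule crossed_moduleI[OF G])
  show grp: "group (grp (zero_xmod G e) x)" for x by (rule groupI) auto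
  show "dlt (zero_xmod G e) y (act (zero_xmod G e) t u) = gcomp G (gcomp G t (dlt (zero_xmod G e) x u)) (ginv G t)"
    if t: "t \<in> ghom G x y" for x y t u
    using gcomp_id(1)[OF G t] ginv(3)[OF G t] by simp
  show "dlt (zero_xmod G e) x (u \<otimes>\<^bsub>grp (zero_xmod G e) x\<^esub> v) =
      gcomp G (dlt (zero_xmod G e) x u) (dlt (zero_xmod G e) x v)" if "x \<in> gobj G" for x u v
    using gcomp_id(1)[OF G gid_hom[OF G that]] by simp
qed (simp_all add: gid_hom[OF G])

text \<open>Every groupoid is a crossed complex. This covers \<open>P\<^sub>0\<close>, which is not a quotient in the
  sense of \<open>cc_quotient\<close> since the projection to it identifies objects.\<close>

lemma crossed_complex_of_zero_xmods:
  assumes G: "groupoid (base C)" and zero: "\<And>n. n \<ge> 2 \<Longrightarrow> xm C n = zero_xmod (base C) e"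
    and b2: "\<And>x. bd2 C x e = gid (base C) x" and b: "\<And>n x. n \<ge> 3 \<Longrightarrow> bd C n x e = e"
  shows "crossed_complex C"
  by (rule crossed_complexI)
    (use G in \<open>simp_all add: zero zero_xmod_crossed_module b2 b\<close>)

text \<open>In dimension \<open>m \<le> n\<close>, the group of \<open>P\<^sub>n\<close> is the quotient by this subgroup.\<close>

definition P_sub :: "('o, 'm, 'a) ccx \<Rightarrow> nat \<Rightarrow> nat \<Rightarrow> 'o \<Rightarrow> 'a set" where
  "P_sub C n m x = (if m < n then {neutral C m x} else bd_im C (n + 1) x)"

abbreviation P_class :: "('o, 'm, 'a) ccx \<Rightarrow> nat \<Rightarrow> nat \<Rightarrow> 'o \<Rightarrow> 'a \<Rightarrow> 'a set" where
  "P_class C n m x u \<equiv> P_sub C n m x #>\<^bsub>cgrp C m x\<^esub> u"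

text \<open>The unit \<open>C \<rightarrow> P\<^sub>n C\<close>. In dimensions above \<open>n\<close> its value is \<open>{}\<close>, the only element of
  the zero crossed module there.\<close>

definition P_unit :: "('o, 'm, 'a) ccx \<Rightarrow> nat \<Rightarrow>
    ('o, 'm, 'a, 'o set, 'm set, 'a set) cmor" where
  "P_unit C n = \<lparr>mbase = \<lparr>fo = (\<lambda>x. if n = 0 then component (base C) x else {x}),
       fa = (\<lambda>g. if n = 0 then component_arrows C (component (base C) (gsrc (base C) g))
         else if n = 1 then pi1_class C g else {g})\<rparr>,
     mcmp = (\<lambda>m x u. if n < m then {} else P_class C n m x u)\<rparr>"

context
  fixes C :: "('o, 'm, 'a) ccx"
  assumes C: "crossed_complex C"
begin

lemma cgrp_group: "m \<ge> 2 \<Longrightarrow> x \<in> objs C \<Longrightarrow> group (cgrp C m x)"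
  using crossed_moduleD(2)[OF crossed_complexD(2)[OF C]] .

text \<open>Conjugation by \<open>u\<close> is the action of \<open>\<delta>(u)\<close>, under which the image of \<open>\<partial>\<close> is stable.\<close>

lemma bd_im_normal:
  assumes m: "m \<ge> 2" and x: "x \<in> objs C"
  shows "bd_im C (m + 1) x \<lhd> cgrp C m x"
proof -
  note CD = crossed_complexD[OF C]
  note M = crossed_moduleD[OF CD(2)[OF m]] and M' = crossed_moduleD[OF CD(2), of "m + 1"]
  have h: "bd C (m + 1) x \<in> hom (cgrp C (m + 1) x) (cgrp C m x)"
    using CD(5)[of "m + 1" x] m x by simp
  interpret G: group "cgrp C m x" by (rule cgrp_group[OF m x])
  interpret h: group_hom "cgrp C (m + 1) x" "cgrp C m x" "bd C (m + 1) x"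
    using h cgrp_group[of "m + 1" x] m x by (simp add: group_hom_def group_hom_axioms_def G.is_group)
  have "u \<otimes>\<^bsub>cgrp C m x\<^esub> d \<otimes>\<^bsub>cgrp C m x\<^esub> inv\<^bsub>cgrp C m x\<^esub> u \<in> bd_im C (m + 1) x"
    if u: "u \<in> elts C m x" and d: "d \<in> bd_im C (m + 1) x" for u d
  proof -
    obtain v where v: "v \<in> elts C (m + 1) x" "d = bd C (m + 1) x v"
      using d by (auto simp: bd_im_def)
    have "act (xm C m) (dlt (xm C m) x u) d = bd C (m + 1) x (act (xm C (m + 1)) (dlt (xm C m) x u) v)"
      using CD(6)[OF _ M(7)[OF x u] v(1)] m v(2) by simp
    moreover have "act (xm C (m + 1)) (dlt (xm C m) x u) v \<in> elts C (m + 1) x"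
      using M'(3)[OF _ M(7)[OF x u] v(1)] m by simp
    moreover have "act (xm C m) (dlt (xm C m) x u) d = u \<otimes>\<^bsub>cgrp C m x\<^esub> d \<otimes>\<^bsub>cgrp C m x\<^esub> inv\<^bsub>cgrp C m x\<^esub> u"
      using M(10)[OF x u h.hom_closed[OF v(1)]] v(2) by simp
    ultimately show ?thesis unfolding bd_im_def by (metis image_eqI)
  qed
  then show ?thesis
    using h.img_is_subgroup by (simp add: G.normal_inv_iff bd_im_def)
qed

lemma P_sub_normal: "m \<ge> 2 \<Longrightarrow> m \<le> n \<Longrightarrow> x \<in> objs C \<Longrightarrow> P_sub C n m x \<lhd> cgrp C m x"
  using bd_im_normal[of m x] cgrp_group[of m x] group.one_is_normal
  by (cases "m = n") (auto simp: P_sub_def)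

lemma bd_im_act:
  assumes m: "m \<ge> 2" and t: "t \<in> homs C x y" and d: "d \<in> bd_im C (m + 1) x"
  shows "act (xm C m) t d \<in> bd_im C (m + 1) y"
proof -
  note CD = crossed_complexD[OF C]
  obtain v where v: "v \<in> elts C (m + 1) x" "d = bd C (m + 1) x v"
    using d by (auto simp: bd_im_def)
  have "act (xm C m) t d = bd C (m + 1) y (act (xm C (m + 1)) t v)"
    using CD(6)[OF _ t v(1)] m v(2) by simp
  then show ?thesis
    using crossed_moduleD(3)[OF CD(2) t v(1)] m by (simp add: bd_im_def)
qed

lemma act_cancel:
  assumes m: "m \<ge> 2" and t: "t \<in> homs C x y" and u: "u \<in> elts C m y"
  shows "act (xm C m) t (act (xm C m) (ginv (base C) t) u) = u"
proof -
  note CD = crossed_complexD[OF C] and M = crossed_moduleD[OF crossed_complexD(2)[OF C m]]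
  note i = ginv[OF CD(1) t]
  show ?thesis using M(6)[OF i(1) t u] i(3) M(5)[OF ghom_obj(2)[OF CD(1) t] u] by simp
qed

text \<open>The action of \<open>t\<close> is invertible, so the inclusion of the image in the subgroup over the
  target is an equality.\<close>

lemma P_sub_act:
  assumes m: "m \<ge> 2" "m \<le> n" and t: "t \<in> homs C x y"
  shows "act (xm C m) t ` P_sub C n m x = P_sub C n m y"
proof (cases "m < n")
  case True
  then show ?thesis
    using crossed_moduleD(11)[OF crossed_complexD(2)[OF C m(1)] t] by (simp add: P_sub_def)
next
  case False
  note G = crossed_complexD(1)[OF C]
  have y: "y \<in> objs C" using ghom_obj[OF G t] by simp
  have "bd_im C (m + 1) y \<subseteq> elts C m y"
    using bd_im_normal[OF m(1) y] by (simp add: normal_imp_subgroup subgroup.subset)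
  then have "act (xm C m) t ` bd_im C (m + 1) x = bd_im C (m + 1) y"
    using bd_im_act[OF m(1) t] bd_im_act[OF m(1) ginv(1)[OF G t]] act_cancel[OF m(1) t]
    by (auto simp: image_iff) (metis subsetD)
  then show ?thesis using False m(2) by (simp add: P_sub_def)
qed

lemma act_r_coset:
  assumes m: "m \<ge> 2" "m \<le> n" and t: "t \<in> homs C x y" and u: "u \<in> elts C m x"
  shows "act (xm C m) t ` (P_class C n m x u) = P_class C n m y (act (xm C m) t u)"
proof -
  note M = crossed_moduleD[OF crossed_complexD(2)[OF C m(1)]]
  have x: "x \<in> objs C" using ghom_obj[OF M(1) t] by simp
  have "P_sub C n m x \<subseteq> elts C m x"
    using P_sub_normal[OF m x] by (simp add: normal_imp_subgroup subgroup.subset)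
  then have "act (xm C m) t ` (P_class C n m x u)
      = (\<lambda>d. d \<otimes>\<^bsub>cgrp C m y\<^esub> act (xm C m) t u) ` act (xm C m) t ` P_sub C n m x"
    using M(4)[OF t _ u] by (force simp: r_coset_def image_iff)
  then show ?thesis unfolding P_sub_act[OF m t] by (auto simp: r_coset_def)
qed

text \<open>A homomorphism that kills \<open>N\<close> has one value on each coset of \<open>N\<close>.\<close>

lemma image_r_coset_trivial:
  assumes "group G" "N \<lhd> G" "u \<in> carrier G"
    and "\<And>d. d \<in> N \<Longrightarrow> h (d \<otimes>\<^bsub>G\<^esub> u) = h u"
  shows "h ` (N #>\<^bsub>G\<^esub> u) = {h u}"
proof -
  have "\<one>\<^bsub>G\<^esub> \<in> N" using assms(2) by (simp add: normal_imp_subgroup subgroup.one_closed)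
  then have "h u \<in> h ` (N #>\<^bsub>G\<^esub> u)"
    using assms(4)[of "\<one>\<^bsub>G\<^esub>"] by (auto simp: r_coset_def intro!: image_eqI[of _ _ "\<one>\<^bsub>G\<^esub> \<otimes>\<^bsub>G\<^esub> u"])
  then show ?thesis using assms(4) by (auto simp: r_coset_def)
qed

lemma P_sub_dlt:
  assumes m: "m \<ge> 2" "m \<le> n" and x: "x \<in> objs C" and d: "d \<in> P_sub C n m x"
  shows "dlt (xm C m) x d = gid (base C) x"
proof (cases "m < n")
  case True
  then show ?thesis using d crossed_moduleD(12)[OF crossed_complexD(2)[OF C m(1)] x] by (simp add: P_sub_def)
next
  case False
  note CD = crossed_complexD[OF C]
  obtain v where v: "v \<in> elts C (m + 1) x" "d = bd C (m + 1) x v"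
    using d False m(2) by (auto simp: bd_im_def P_sub_def)
  have c: "d \<in> elts C m x" using hom_in_carrier[OF CD(5)[of "m + 1" x] v(1)] v(2) m x by simp
  show ?thesis
  proof (cases "m = 2")
    case True
    then show ?thesis using CD(3)[OF x, of d] CD(7)[OF x, of v] c v by simp
  next
    case False
    then show ?thesis using CD(4)[OF _ x c] m by simp
  qed
qed

lemma P_sub_bd:
  assumes m: "m \<ge> 3" "m \<le> n" and x: "x \<in> objs C" and d: "d \<in> P_sub C n m x"
  shows "bd C m x d = neutral C (m - 1) x"
proof (cases "m < n")
  case True
  then show ?thesis
    using d hom_one[OF crossed_complexD(5)[OF C m(1) x]] cgrp_group[of m x] cgrp_group[of "m - 1" x] m x
    by (simp add: P_sub_def)
next
  case False
  obtain v where v: "v \<in> elts C (m + 1) x" "d = bd C (m + 1) x v"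
    using d False m(2) by (auto simp: bd_im_def P_sub_def)
  show ?thesis using crossed_complexD(8)[OF C _ x v(1)] m v(2) by simp
qed

lemma
  assumes m: "m \<ge> 2" "m \<le> n" and x: "x \<in> objs C" and u: "u \<in> elts C m x"
  shows dlt_r_coset: "dlt (xm C m) x ` (P_class C n m x u) = {dlt (xm C m) x u}"
    and bd_r_coset: "m \<ge> 3 \<Longrightarrow> bd C m x ` (P_class C n m x u) = {bd C m x u}"
proof -
  note M = crossed_moduleD[OF crossed_complexD(2)[OF C m(1)]]
  interpret G: group "cgrp C m x" by (rule cgrp_group[OF m(1) x])
  have N: "P_sub C n m x \<lhd> cgrp C m x" by (rule P_sub_normal[OF m x])
  have c: "d \<in> elts C m x" if "d \<in> P_sub C n m x" for d
    using N that by (meson normal_imp_subgroup subgroup.mem_carrier)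
  show "dlt (xm C m) x ` (P_class C n m x u) = {dlt (xm C m) x u}"
  proof (rule image_r_coset_trivial[OF G.is_group N u])
    fix d assume d: "d \<in> P_sub C n m x"
    show "dlt (xm C m) x (d \<otimes>\<^bsub>cgrp C m x\<^esub> u) = dlt (xm C m) x u"
      using M(8)[OF x c[OF d] u] P_sub_dlt[OF m x d] gcomp_id(2)[OF M(1) M(7)[OF x u]] by simp
  qed
  assume m3: "m \<ge> 3"
  note b = crossed_complexD(5)[OF C m3 x]
  interpret G': group "cgrp C (m - 1) x" using cgrp_group[of "m - 1" x] m3 x by simp
  show "bd C m x ` (P_class C n m x u) = {bd C m x u}"
  proof (rule image_r_coset_trivial[OF G.is_group N u])
    fix d assume d: "d \<in> P_sub C n m x"
    show "bd C m x (d \<otimes>\<^bsub>cgrp C m x\<^esub> u) = bd C m x u"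
      using hom_mult[OF b c[OF d] u] P_sub_bd[OF m3 m(2) x d]
        G'.l_one[OF hom_in_carrier[OF b u]] by simp
  qed
qed

lemma P_sub_one_coset: "m \<ge> 2 \<Longrightarrow> m < n \<Longrightarrow> x \<in> objs C \<Longrightarrow> u \<in> elts C m x \<Longrightarrow>
    P_class C n m x u = {u}"
  using cgrp_group[of m x] by (simp add: P_sub_def r_coset_def group.is_monoid)

lemma P_base_quotient:
  assumes n: "n \<ge> 1"
  shows "gpd_quotient (base C) (P_base C n) (mbase (P_unit C n))"
proof -
  let ?G = "base C"
  have b: "bij_betw (\<lambda>x. {x}) (gobj ?G) {{x} | x. x \<in> gobj ?G}"
    by (auto simp: bij_betw_def inj_on_def)
  have pq: "gpd_quotient (base C) (pi1 C) \<lparr>fo = (\<lambda>x. x), fa = pi1_class C\<rparr>"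
    by (rule pi1_quotient[OF C])
  show ?thesis
  proof (cases "n = 1")
    case True
    have c: "gcomp (pi1 C) (pi1_class C g) (pi1_class C f) = pi1_class C (gcomp ?G g f)"
      if "f \<in> garr ?G" "g \<in> garr ?G" "gtgt ?G f = gsrc ?G g" for f g
      using pq that by (simp add: gpd_quotient_def)
    show ?thesis
      using True b unfolding gpd_quotient_def
      by (simp add: P_base_def P_unit_def pi1_garr[OF C] pi1_gobj[OF C] pi1_gid[OF C]
          pi1_gsrc[OF C] pi1_gtgt[OF C] c)
  next
    case False
    then show ?thesis
      using n b unfolding gpd_quotient_def
      by (auto simp: P_base_def P_unit_def Let_def)
  qed
qed

text \<open>For \<open>n = 1\<close> the values of \<open>\<partial>\<^sub>2\<close> become identities in \<open>\<pi>\<^sub>1\<close>; for \<open>n \<ge> 2\<close> the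
  operations of \<open>P\<^sub>n\<close> act on cosets elementwise.\<close>

lemma P_unit_quotient:
  assumes n: "n \<ge> 1"
  shows "cc_quotient C (P C n) (P_unit C n)"
proof -
  let ?G = "base C" and ?q = "P_unit C n"
  note CD = crossed_complexD[OF C]
  have low: "elts (P C n) m {x} = mcmp ?q m x ` elts C m x"
    "neutral (P C n) m {x} = mcmp ?q m x (neutral C m x)"
    "u \<in> elts C m x \<Longrightarrow> v \<in> elts C m x \<Longrightarrow>
      mcmp ?q m x (u \<otimes>\<^bsub>cgrp C m x\<^esub> v) = mcmp ?q m x u \<otimes>\<^bsub>cgrp (P C n) m {x}\<^esub> mcmp ?q m x v"
    if m: "m \<ge> 2" "m \<le> n" and x: "x \<in> gobj ?G" for m x u v
  proof -
    have g: "cgrp (P C n) m {x} = cgrp C m x Mod P_sub C n m x"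
      using m by (simp add: P_def P_xm_def P_sub_def Let_def)
    have N: "P_sub C n m x \<lhd> cgrp C m x" by (rule P_sub_normal[OF m x])
    have q: "mcmp ?q m x = (\<lambda>u. P_class C n m x u)" using m by (auto simp: P_unit_def)
    show "elts (P C n) m {x} = mcmp ?q m x ` elts C m x"
      unfolding g q by (auto simp: FactGroup_def RCOSETS_def)
    interpret G: group "cgrp C m x" by (rule cgrp_group[OF m(1) x])
    show "neutral (P C n) m {x} = mcmp ?q m x (neutral C m x)"
      unfolding g q using N by (simp add: normal_imp_subgroup subgroup.subset G.coset_mult_one)
    show "mcmp ?q m x (u \<otimes>\<^bsub>cgrp C m x\<^esub> v) = mcmp ?q m x u \<otimes>\<^bsub>cgrp (P C n) m {x}\<^esub> mcmp ?q m x v"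
      if "u \<in> elts C m x" "v \<in> elts C m x"
      unfolding g q using normal.rcos_sum[OF N that] by simp
  qed
  have hi: "xm (P C n) m = zero_xmod (P_base C n) {}" "mcmp ?q m x u = {}" if "m > n" for m x u
    using that by (simp_all add: P_def P_xm_def P_unit_def)
  have fo: "ob ?q x = {x}" for x using n by (simp add: P_unit_def)
  have gq: "gpd_quotient ?G (base (P C n)) (mbase ?q)"
    using P_base_quotient[OF n] by (simp add: P_def)
  have gid: "gid (P_base C n) {x} = ar ?q (gid ?G x)" if "x \<in> gobj ?G" for x
    using P_base_quotient[OF n] that by (simp add: gpd_quotient_def fo)
  have d_hi: "ar ?q (dlt (xm C m) x u) = gid (P_base C n) {x}"
    if m: "m \<ge> 2" "m > n" and x: "x \<in> gobj ?G" and u: "u \<in> elts C m x" for m x u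
  proof (cases "m = 2")
    case True
    then have n1: "n = 1" and u2: "u \<in> elts C 2 x" using n m u by simp_all
    have "bd2 C x u \<in> pi1_class C (gid ?G x)"
      using pi1_class_ghom(1)[OF C gid_hom[OF CD(1) x]] gcomp_id(1)[OF CD(1) bd2_ghom[OF C x u2]] u2
      by (force simp: bd2_im_def)
    then show ?thesis
      using pi1_class_eqI[OF C gid_hom[OF CD(1) x]] CD(3)[OF x u2] True n1 gid[OF x] by (simp add: P_unit_def)
  next
    case False
    then show ?thesis using CD(4)[OF _ x u] m gid[OF x] by simp
  qed
  have fa: "ar ?q t = {t}" if "n \<ge> 2" for t using that by (simp add: P_unit_def)
  show ?thesis
  proof (rule cc_quotient.intro, unfold fo)
    show "crossed_complex C" by (rule C)
    show "gpd_quotient ?G (base (P C n)) (mbase ?q)" by (rule gq)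
  next
    fix m x assume m: "m \<ge> (2::nat)" and x: "x \<in> gobj ?G"
    show "elts (P C n) m {x} = mcmp ?q m x ` elts C m x"
    proof (cases "m \<le> n")
      case False
      have "neutral C m x \<in> elts C m x"
        using cgrp_group[OF m x] by (simp add: group.is_monoid monoid.one_closed)
      then show ?thesis using hi[of m] False by (auto simp: image_iff)
    qed (use low(1) m x in simp)
    show "neutral (P C n) m {x} = mcmp ?q m x (neutral C m x)"
      using low(2)[OF m _ x] hi[of m] by (cases "m \<le> n") simp_all
    fix u assume u: "u \<in> elts C m x"
    show "ar ?q (dlt (xm C m) x u) = dlt (xm (P C n) m) {x} (mcmp ?q m x u)"
    proof (cases "m \<le> n")
      case True
      then show ?thesis
        using dlt_r_coset[OF m True x u] fa m by (simp add: P_def P_xm_def P_unit_def)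
    qed (use d_hi[OF m _ x u] hi[of m] in simp)
    fix v assume v: "v \<in> elts C m x"
    show "mcmp ?q m x (u \<otimes>\<^bsub>cgrp C m x\<^esub> v) = mcmp ?q m x u \<otimes>\<^bsub>cgrp (P C n) m {x}\<^esub> mcmp ?q m x v"
      using low(3)[OF m _ x u v] hi[of m] by (cases "m \<le> n") simp_all
  next
    fix m x y t u assume m: "m \<ge> (2::nat)" and t: "t \<in> ghom ?G x y" and u: "u \<in> elts C m x"
    show "mcmp ?q m y (act (xm C m) t u) = act (xm (P C n) m) (ar ?q t) (mcmp ?q m x u)"
    proof (cases "m \<le> n")
      case True
      then show ?thesis using act_r_coset[OF m True t u] fa m by (simp add: P_def P_xm_def P_unit_def)
    qed (use hi[of m] in simp)
  next
    fix x u assume x: "x \<in> gobj ?G" and u: "u \<in> elts C 2 x"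
    show "ar ?q (bd2 C x u) = bd2 (P C n) {x} (mcmp ?q 2 x u)"
    proof (cases "2 \<le> n")
      case True
      have c: "d \<in> elts C 2 x" if "d \<in> P_sub C n 2 x #>\<^bsub>cgrp C 2 x\<^esub> u" for d
        using that u P_sub_normal[OF _ True x] cgrp_group[of 2 x] x
        monoid.r_coset_subset_G[OF group.is_monoid, of "cgrp C 2 x" "P_sub C n 2 x" u]
        by (auto dest: normal_imp_subgroup subgroup.subset)
      have "bd2 C x ` (P_sub C n 2 x #>\<^bsub>cgrp C 2 x\<^esub> u) = dlt (xm C 2) x ` (P_sub C n 2 x #>\<^bsub>cgrp C 2 x\<^esub> u)"
        using CD(3)[OF x c] by (intro image_cong) simp_all
      then show ?thesis
        using dlt_r_coset[OF _ True x u] CD(3)[OF x u] fa[OF True] True by (simp add: P_def P_unit_def)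
    next
      case False
      then show ?thesis using d_hi[of 2 x u] x u CD(3)[OF x u] by (simp add: P_def)
    qed
  next
    fix m x u assume m: "m \<ge> (3::nat)" and x: "x \<in> gobj ?G" and u: "u \<in> elts C m x"
    have m': "m - 1 \<ge> 2" "m \<ge> 2" using m by simp_all
    have c: "bd C m x u \<in> elts C (m - 1) x" by (rule hom_in_carrier[OF CD(5)[OF m x] u])
    show "mcmp ?q (m - 1) x (bd C m x u) = bd (P C n) m {x} (mcmp ?q m x u)"
    proof (cases "m \<le> n")
      case True
      then show ?thesis
        using bd_r_coset[OF m'(2) True x u m] P_sub_one_coset[OF m'(1) _ x c, of n] m
        by (simp add: P_def P_unit_def)
    next
      case False
      show ?thesis
      proof (cases "m = n + 1")
        case True
        \<comment> \<open>This is the dimension where the quotient matters: boundaries become neutral in \<open>P\<^sub>n\<close>.\<close>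
        then have "m - 1 = n" "\<not> m - 1 < n" by simp_all
        have s: "subgroup (P_sub C n (m - 1) x) (cgrp C (m - 1) x)"
          using P_sub_normal[OF m'(1) _ x, of n] True by (simp add: normal_imp_subgroup)
        have "bd C m x u \<in> P_sub C n (m - 1) x" using u True by (simp add: P_sub_def bd_im_def)
        then have "P_sub C n (m - 1) x #>\<^bsub>cgrp C (m - 1) x\<^esub> bd C m x u = P_sub C n (m - 1) x"
          using group.coset_join2[OF cgrp_group[OF m'(1) x] c s] by blast
        moreover have "neutral (P C n) (m - 1) {x} = P_sub C n (m - 1) x"
          using True by (simp add: P_def P_xm_def P_sub_def Let_def)
        ultimately show ?thesis using True by (simp add: P_def P_unit_def)
      next
        case False
        then show ?thesis using \<open>\<not> m \<le> n\<close> by (auto simp: P_def P_unit_def P_xm_def)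
      qed
    qed
  qed
qed

lemma component_eqI:
  assumes t: "t \<in> homs C x y"
  shows "component (base C) y = component (base C) x"
proof -
  note G = crossed_complexD(1)[OF C]
  have "component (base C) y \<subseteq> component (base C) x" if "t \<in> homs C x y" for t x y
    using gcomp_hom[OF G that] by (fastforce simp: component_def)
  from this[OF t] this[OF ginv(1)[OF G t]] show ?thesis by blast
qed

lemma self_in_component: "x \<in> objs C \<Longrightarrow> x \<in> component (base C) x"
  using gid_hom[OF crossed_complexD(1)[OF C]] by (auto simp: component_def)

lemma component_eq_iff:
  assumes y: "y \<in> objs C"
  shows "component (base C) y = component (base C) x \<longleftrightarrow> y \<in> component (base C) x"
proof
  assume "y \<in> component (base C) x"
  then obtain t where "t \<in> homs C x y" by (auto simp: component_def)
  then show "component (base C) y = component (base C) x" by (rule component_eqI)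
qed (use self_in_component[OF y] in simp)

text \<open>The identity arrows reach every object of the component, and no arrow leaves it. Hence
  source and target of the identity arrow of \<open>P\<^sub>0\<close> at a component are this component.\<close>

lemma component_arrows_ends:
  assumes x: "x \<in> objs C"
  shows "gsrc (base C) ` component_arrows C (component (base C) x) = component (base C) x"
    and "gtgt (base C) ` component_arrows C (component (base C) x) = component (base C) x"
proof -
  let ?G = "base C"
  note G = crossed_complexD(1)[OF C]
  have i: "gid ?G y \<in> component_arrows C (component ?G x)" "gsrc ?G (gid ?G y) = y" "gtgt ?G (gid ?G y) = y"
    if "y \<in> component ?G x" for y
  proof -
    have "y \<in> gobj ?G" using that by (simp add: component_def)
    note h = ghomD[OF gid_hom[OF G this]]
    show "gid ?G y \<in> component_arrows C (component ?G x)" "gsrc ?G (gid ?G y) = y" "gtgt ?G (gid ?G y) = y"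
      using h that by (simp_all add: component_arrows_def)
  qed
  have t: "gtgt ?G g \<in> component ?G x" if "g \<in> component_arrows C (component ?G x)" for g
  proof -
    have g: "g \<in> garr ?G" "gsrc ?G g \<in> component ?G x" using that by (simp_all add: component_arrows_def)
    have "component ?G (gtgt ?G g) = component ?G (gsrc ?G g)" by (rule component_eqI[OF garr_in_ghom[OF g(1)]])
    also have "\<dots> = component ?G x" using g(2) component_eq_iff garr_obj[OF G g(1)] by blast
    finally show ?thesis using component_eq_iff garr_obj[OF G g(1)] by blast
  qed
  show "gsrc ?G ` component_arrows C (component ?G x) = component ?G x"
    using i(1,2) by (auto simp: component_arrows_def image_iff) metis
  show "gtgt ?G ` component_arrows C (component ?G x) = component ?G x"
    using i(1,3) t by (auto simp: image_iff) metis
qed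

lemma P0_base:
  shows "groupoid (base (P C 0))"
    and "is_functor (base C) (base (P C 0)) (mbase (P_unit C 0))"
    and "homs (P C 0) c d = (if c = d \<and> c \<in> pi0 C then {component_arrows C c} else {})"
proof -
  let ?G = "base C" and ?H = "base (P C 0)"
  note G = crossed_complexD(1)[OF C]
  have H: "gobj ?H = pi0 C" "garr ?H = component_arrows C ` pi0 C" "gid ?H = component_arrows C"
    "gcomp ?H B A = A" for A B
    by (simp_all add: P_def P_base_def Let_def)
  have ends: "gsrc ?H (component_arrows C c) = c" "gtgt ?H (component_arrows C c) = c" if c: "c \<in> pi0 C" for c
  proof -
    obtain x where "x \<in> gobj ?G" "c = component ?G x" using c by (auto simp: pi0_def)
    then show "gsrc ?H (component_arrows C c) = c" "gtgt ?H (component_arrows C c) = c"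
      using component_arrows_ends[of x] by (simp_all add: P_def P_base_def Let_def)
  qed
  show hom: "ghom ?H c d = (if c = d \<and> c \<in> pi0 C then {component_arrows C c} else {})" for c d
    using ends by (auto simp: ghom_def H)
  show gH: "groupoid ?H"
    by (rule groupoidI) (use ends in \<open>auto simp: hom H split: if_splits\<close>)
  show "is_functor ?G ?H (mbase (P_unit C 0))"
  proof (rule is_functorI[OF G gH])
    fix x y g assume g: "g \<in> ghom ?G x y"
    note c = component_eqI[OF g]
    show "ar (P_unit C 0) g \<in> ghom ?H (ob (P_unit C 0) x) (ob (P_unit C 0) y)"
      using c ghomD[OF g] ghom_obj[OF G g] by (simp add: P_unit_def hom pi0_def)
  next
    fix x assume x: "x \<in> gobj ?G"
    show "ob (P_unit C 0) x \<in> gobj ?H" using x by (simp add: P_unit_def H pi0_def)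
    show "ar (P_unit C 0) (gid ?G x) = gid ?H (ob (P_unit C 0) x)"
      using ghomD(2)[OF gid_hom[OF G x]] by (simp add: P_unit_def H)
  next
    fix x y z f g assume fg: "f \<in> ghom ?G x y" "g \<in> ghom ?G y z"
    show "ar (P_unit C 0) (gcomp ?G g f) = gcomp ?H (ar (P_unit C 0) g) (ar (P_unit C 0) f)"
      using ghomD(2)[OF gcomp_hom[OF G fg]] ghomD(2)[OF fg(1)] by (simp add: P_unit_def H)
  qed
qed

lemma P0_crossed_complex: "crossed_complex (P C 0)"
  by (rule crossed_complex_of_zero_xmods[where e = "{}"])
    (use P0_base(1) in \<open>simp_all add: P_def P_xm_def\<close>)

lemma P_unit_morphism: "cc_morphism C (P C n) (P_unit C n)"
proof (cases "n = 0")
  case False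
  then show ?thesis using cc_quotient.cc_quotient_morphism[OF P_unit_quotient] by simp
next
  case True
  have d2: "ar (P_unit C 0) (bd2 C x u) = bd2 (P C 0) (ob (P_unit C 0) x) (mcmp (P_unit C 0) 2 x u)"
    if "x \<in> objs C" "u \<in> elts C 2 x" for x u
    using ghomD(2)[OF bd2_ghom[OF C that]] by (simp add: P_def P_unit_def P_base_def Let_def)
  show ?thesis
    unfolding True
    by (rule cc_morphismI[OF C P0_crossed_complex P0_base(2)])
      (use d2 in \<open>auto simp: P_def P_unit_def P_xm_def\<close>)
qed

lemma P_crossed_complex: "crossed_complex (P C n)"
  by (rule cc_morphismD(2)[OF P_unit_morphism])

text \<open>In terms of elements of \<open>C\<close>, the map \<open>\<eta>\<^sub>n\<close> sends \<open>{u}\<close> to the coset of \<open>u\<close> in dimension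
  \<open>n - 1\<close> and to \<open>{u}\<close> below.\<close>

lemma
  assumes n: "n \<ge> 1"
  shows eta_P_unit_fo: "x \<in> objs C \<Longrightarrow>
      ob (eta C n) (ob (P_unit C n) x) = ob (P_unit C (n - 1)) x"
    and eta_P_unit_fa: "t \<in> garr (base C) \<Longrightarrow>
      ar (eta C n) (ar (P_unit C n) t) = ar (P_unit C (n - 1)) t"
    and eta_P_unit_mcmp: "m \<ge> 2 \<Longrightarrow> x \<in> objs C \<Longrightarrow> u \<in> elts C m x \<Longrightarrow>
      mcmp (eta C n) m (ob (P_unit C n) x) (mcmp (P_unit C n) m x u) = mcmp (P_unit C (n - 1)) m x u"
proof -
  show "ob (eta C n) (ob (P_unit C n) x) = ob (P_unit C (n - 1)) x"
    using n by (simp add: eta_def eta_base_def P_unit_def)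
  show "ar (eta C n) (ar (P_unit C n) t) = ar (P_unit C (n - 1)) t" if "t \<in> garr (base C)"
    using n that pi1_gsrc[OF C that] by (auto simp: eta_def eta_base_def P_unit_def)
  assume m: "m \<ge> 2" and x: "x \<in> objs C" and u: "u \<in> elts C m x"
  have fo: "ob (P_unit C n) x = {x}" using n by (simp add: P_unit_def)
  consider "m \<ge> n" | "m = n - 1" "m < n" | "m < n - 1" by linarith
  then show "mcmp (eta C n) m (ob (P_unit C n) x) (mcmp (P_unit C n) m x u) = mcmp (P_unit C (n - 1)) m x u"
  proof cases
    case 1
    then have "xm (P C (n - 1)) m = zero_xmod (P_base C (n - 1)) {}" using n by (auto simp: P_def P_xm_def)
    then show ?thesis using 1 n by (auto simp: eta_def P_unit_def P_xm_def)
  next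
    case 2
    then show ?thesis using P_sub_one_coset[OF m 2(2) x u] fo by (auto simp: eta_def P_unit_def P_sub_def)
  next
    case 3
    then have "m < n" by simp
    then show ?thesis
      using P_sub_one_coset[OF m 3 x u] P_sub_one_coset[OF m \<open>m < n\<close> x u] 3 by (simp add: eta_def P_unit_def)
  qed
qed

lemma eta_morphism:
  assumes n: "n \<ge> 1"
  shows "cc_morphism (P C n) (P C (n - 1)) (eta C n)"
  by (rule cc_quotient.cc_morphism_descends[OF P_unit_quotient[OF n] P_unit_morphism[of "n - 1"]])
    (use eta_P_unit_fo[OF n] eta_P_unit_fa[OF n] eta_P_unit_mcmp[OF n] in auto)

text \<open>Surjectivity of \<open>\<eta>\<^sub>n\<close> follows from that of the unit of \<open>P\<^bsub>n - 1\<^esub>\<close>. The base of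
  \<open>P\<^sub>0\<close> has identity arrows only, so for \<open>n = 1\<close> there is nothing to lift.\<close>

lemma eta_fibration:
  assumes n: "n \<ge> 1"
  shows "cc_fibration (P C n) (P C (n - 1)) (eta C n)"
proof -
  let ?G = "base C" and ?e = "eta C n"
  note E = cc_morphismD[OF eta_morphism[OF n]]
  note EF = is_functorD[OF E(3)]
  have q: "cc_quotient C (P C n) (P_unit C n)" by (rule P_unit_quotient[OF n])
  then have gq: "gpd_quotient ?G (base (P C n)) (mbase (P_unit C n))" by (simp add: cc_quotient_def)
  note Q = cc_morphismD[OF P_unit_morphism[of n]]
  note QF = is_functorD[OF Q(3)]
  have obj: "\<exists>x. x \<in> gobj ?G \<and> X = ob (P_unit C n) x" if "X \<in> objs (P C n)" for X
    using gpd_quotient_lift_obj[OF gq that] by blast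
  have lift: "\<exists>g\<in>garr (base (P C n)). gsrc (base (P C n)) g = X \<and> ar ?e g = h"
    if X: "X \<in> objs (P C n)" and h: "h \<in> garr (base (P C (n - 1)))"
      "gsrc (base (P C (n - 1))) h = ob ?e X" for X h
  proof (cases "n = 1")
    case True
    have "h \<in> homs (P C 0) (ob ?e X) (gtgt (base (P C 0)) h)"
      using h True by (simp add: ghom_def)
    \<comment> \<open>The only arrow out of a component in \<open>P\<^sub>0\<close> is the identity, which lifts to an identity.\<close>
    then have "h = gid (base (P C (n - 1))) (ob ?e X)"
      using True P0_base(3) by (simp add: P_def P_base_def Let_def split: if_splits)
    then show ?thesis
      using EF(5)[OF X] ghomD(1,2)[OF gid_hom[OF EF(1) X]] by (intro bexI[of _ "gid (base (P C n)) X"]) simp_all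
  next
    case False
    then have "cc_quotient C (P C (n - 1)) (P_unit C (n - 1))" using P_unit_quotient[of "n - 1"] n by simp
    then have gq': "gpd_quotient ?G (base (P C (n - 1))) (mbase (P_unit C (n - 1)))"
      by (simp add: cc_quotient_def)
    then have "garr (base (P C (n - 1))) = ar (P_unit C (n - 1)) ` garr ?G"
      by (simp add: gpd_quotient_def)
    then obtain t where t: "t \<in> garr ?G" "h = ar (P_unit C (n - 1)) t"
      using h(1) by auto
    obtain x where x: "x \<in> gobj ?G" "X = ob (P_unit C n) x" using obj[OF X] by blast
    have "gsrc (base (P C (n - 1))) h = ob (P_unit C (n - 1)) (gsrc ?G t)"
      using gq' t by (simp add: gpd_quotient_def)
    then have "ob (P_unit C (n - 1)) (gsrc ?G t) = ob (P_unit C (n - 1)) x"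
      using h(2) x eta_P_unit_fo[OF n] by simp
    then have tx: "gsrc ?G t = x" using n False by (simp add: P_unit_def)
    have "ar (P_unit C n) t \<in> garr (base (P C n))" "gsrc (base (P C n)) (ar (P_unit C n) t) = X"
      using ghomD[OF QF(4)[OF garr_in_ghom[OF t(1)]]] tx x(2) by simp_all
    then show ?thesis using eta_P_unit_fa[OF n t(1)] t(2) by (intro bexI[of _ "ar (P_unit C n) t"]) simp_all
  qed
  have surj: "mcmp ?e m X ` elts (P C n) m X = elts (P C (n - 1)) m (ob ?e X)"
    if m: "m \<ge> 2" and X: "X \<in> objs (P C n)" for m X
  proof -
    obtain x where x: "x \<in> gobj ?G" "X = ob (P_unit C n) x" using obj[OF X] by blast
    have "elts (P C n) m X = mcmp (P_unit C n) m x ` elts C m x"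
      using q m x by (simp add: cc_quotient_def)
    then have "mcmp ?e m X ` elts (P C n) m X = mcmp (P_unit C (n - 1)) m x ` elts C m x"
      using eta_P_unit_mcmp[OF n m x(1)] x(2) by (simp add: image_image)
    also have "\<dots> = elts (P C (n - 1)) m (ob (P_unit C (n - 1)) x)"
    proof (cases "n = 1")
      case True
      have "neutral C m x \<in> elts C m x"
        using cgrp_group[OF m x(1)] by (simp add: group.is_monoid monoid.one_closed)
      then show ?thesis using True m by (auto simp: P_unit_def P_def P_xm_def image_iff)
    next
      case False
      then show ?thesis
        using P_unit_quotient[of "n - 1"] n m x by (simp add: cc_quotient_def)
    qed
    finally show ?thesis using eta_P_unit_fo[OF n x(1)] x(2) by simp
  qed
  show ?thesis
    unfolding cc_fibration_def groupoid_fibration_def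
    by (intro conjI ballI allI impI eta_morphism[OF n] E(3) surj lift)
qed

end

section \<open>Fibers\<close>

text \<open>The laws are inherited, so only closure has to be checked; inverses in \<open>G\<close> are inverses in
  \<open>S\<close> because these are unique.\<close>

lemma subgroupoid:
  assumes G: "groupoid G" and hom: "\<And>x y. ghom S x y \<subseteq> ghom G x y"
    and ops: "gid S = gid G" "gcomp S = gcomp G"
    and ends: "\<And>g. g \<in> garr S \<Longrightarrow> gsrc S g \<in> gobj S \<and> gtgt S g \<in> gobj S"
    and gid: "\<And>x. x \<in> gobj S \<Longrightarrow> gid G x \<in> ghom S x x"
    and comp: "\<And>x y z f g. f \<in> ghom S x y \<Longrightarrow> g \<in> ghom S y z \<Longrightarrow> gcomp G g f \<in> ghom S x z"
    and inv: "\<And>x y f. f \<in> ghom S x y \<Longrightarrow> ginv G f \<in> ghom S y x"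
  shows "groupoid S" and "f \<in> ghom S x y \<Longrightarrow> ginv S f = ginv G f"
proof -
  have h: "f \<in> ghom S x y \<Longrightarrow> f \<in> ghom G x y" for f x y using hom by blast
  show S: "groupoid S"
  proof (rule groupoidI)
    fix w x y z f g k assume f: "f \<in> ghom S w x" "g \<in> ghom S x y" "k \<in> ghom S y z"
    show "gcomp S k (gcomp S g f) = gcomp S (gcomp S k g) f"
      unfolding ops by (rule gcomp_assoc[OF G h[OF f(1)] h[OF f(2)] h[OF f(3)]])
  next
    fix x y f assume f: "f \<in> ghom S x y"
    show "gcomp S f (gid S x) = f \<and> gcomp S (gid S y) f = f"
      unfolding ops using gcomp_id[OF G h[OF f]] by simp
    show "\<exists>g\<in>ghom S y x. gcomp S g f = gid S x \<and> gcomp S f g = gid S y"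
      unfolding ops using inv[OF f] ginv(2,3)[OF G h[OF f]] by (intro bexI[of _ "ginv G f"]) simp_all
  qed (use ends gid comp ops in simp_all)
  show "f \<in> ghom S x y \<Longrightarrow> ginv S f = ginv G f"
    using ginv_equality[OF S _ inv] ginv(2,3)[OF G h] by (simp add: ops)
qed

context
  fixes C :: "('o, 'm, 'a) ccx" and D :: "('p, 'q, 'b) ccx"
    and f :: "('o, 'm, 'a, 'p, 'q, 'b) cmor" and x :: 'p
  assumes f: "cc_morphism C D f" and x: "x \<in> objs D"
begin

lemma fiber_simps:
  "objs (cc_fiber C D f x) = {y \<in> objs C. ob f y = x}"
  "garr (base (cc_fiber C D f x)) = {g \<in> garr (base C). ar f g = gid (base D) x}"
  "gsrc (base (cc_fiber C D f x)) = gsrc (base C)" "gtgt (base (cc_fiber C D f x)) = gtgt (base C)"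
  "gid (base (cc_fiber C D f x)) = gid (base C)" "gcomp (base (cc_fiber C D f x)) = gcomp (base C)"
  "cgrp (cc_fiber C D f x) n y = (cgrp C n y)
     \<lparr>carrier := {u \<in> elts C n y. mcmp f n y u = neutral D n x}\<rparr>"
  "act (xm (cc_fiber C D f x) n) = act (xm C n)" "dlt (xm (cc_fiber C D f x) n) = dlt (xm C n)"
  "bd2 (cc_fiber C D f x) = bd2 C" "bd (cc_fiber C D f x) = bd C"
  by (simp_all add: cc_fiber_def)

lemma fiber_ghom:
  "g \<in> homs (cc_fiber C D f x) y z \<longleftrightarrow> g \<in> homs C y z \<and> ar f g = gid (base D) x"
  by (auto simp: ghom_def fiber_simps)

lemma fiber_obj:
  assumes "g \<in> homs (cc_fiber C D f x) y z"
  shows "y \<in> objs C" "z \<in> objs C" "ob f y = x" "ob f z = x"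
proof -
  note F = is_functorD[OF cc_morphismD(3)[OF f]]
  have g: "g \<in> homs C y z" "ar f g = gid (base D) x" using assms by (simp_all add: fiber_ghom)
  show "y \<in> objs C" "z \<in> objs C" using ghom_obj[OF F(1) g(1)] by auto
  show "ob f y = x" "ob f z = x"
    using ghomD[OF F(4)[OF g(1)]] ghomD[OF gid_hom[OF F(2) x]] g(2) by simp_all
qed

lemma fiber_base:
  shows "groupoid (base (cc_fiber C D f x))"
    and "g \<in> homs (cc_fiber C D f x) y z \<Longrightarrow> ginv (base (cc_fiber C D f x)) g = ginv (base C) g"
proof -
  let ?S = "base (cc_fiber C D f x)"
  note F = is_functorD[OF cc_morphismD(3)[OF f]]
  have ends: "gsrc ?S g \<in> gobj ?S \<and> gtgt ?S g \<in> gobj ?S" if "g \<in> garr ?S" for g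
    using fiber_obj[OF garr_in_ghom[OF that]] by (simp add: fiber_simps)
  have gid: "gid (base C) y \<in> ghom ?S y y" if "y \<in> gobj ?S" for y
    using that gid_hom[OF F(1)] F(5) by (auto simp: fiber_ghom fiber_simps)
  have comp: "gcomp (base C) k g \<in> ghom ?S y w" if "g \<in> ghom ?S y z" "k \<in> ghom ?S z w" for y z w g k
    using that F(6)[of g y z k w] gcomp_hom[OF F(1), of g y z k w] gcomp_id(1)[OF F(2) gid_hom[OF F(2) x]]
    by (simp add: fiber_ghom)
  have inv: "ginv (base C) g \<in> ghom ?S z y" if "g \<in> ghom ?S y z" for y z g
    using that ginv(1)[OF F(1), of g y z] is_functor_ginv[OF cc_morphismD(3)[OF f], of g y z]
      ginv_gid[OF F(2) x] by (simp add: fiber_ghom)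
  have sub: "ghom ?S y z \<subseteq> homs C y z" for y z by (auto simp: fiber_ghom)
  show "groupoid ?S"
    by (rule subgroupoid(1)[OF F(1) sub fiber_simps(5,6) ends gid comp inv])
  show "ginv ?S g = ginv (base C) g" if "g \<in> ghom ?S y z"
    by (rule subgroupoid(2)[OF F(1) sub fiber_simps(5,6) ends gid comp inv that])
qed

lemma fiber_subgroup:
  assumes n: "n \<ge> 2" and y: "y \<in> objs (cc_fiber C D f x)"
  shows "subgroup {u \<in> elts C n y. mcmp f n y u = neutral D n x} (cgrp C n y)"
proof -
  note M = cc_morphismD[OF f]
  have y': "y \<in> objs C" "ob f y = x" using y by (simp_all add: fiber_simps)
  have "group_hom (cgrp C n y) (cgrp D n x) (mcmp f n y)"
    using M(4)[OF n y'(1)] y'(2) crossed_moduleD(2)[OF crossed_complexD(2)[OF M(1) n] y'(1)]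
      crossed_moduleD(2)[OF crossed_complexD(2)[OF M(2) n] x]
    by (simp add: group_hom_def group_hom_axioms_def)
  from group_hom.subgroup_kernel[OF this] show ?thesis by (simp add: kernel_def)
qed

text \<open>The operations are restrictions, so the identities are inherited. What remains is closure: a
  morphism sends the result of each operation on elements of the fiber to a neutral element.\<close>

theorem fiber_crossed_complex: "crossed_complex (cc_fiber C D f x)"
proof -
  let ?E = "cc_fiber C D f x" let ?S = "base ?E"
  note M = cc_morphismD[OF f]
  note CD = crossed_complexD[OF M(1)] and DD = crossed_complexD[OF M(2)]
  have obj: "y \<in> objs C" "ob f y = x" if "y \<in> gobj ?S" for y
    using that by (simp_all add: fiber_simps)
  have el: "u \<in> elts C n y" "mcmp f n y u = neutral D n x" if "u \<in> elts ?E n y" for n y u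
    using that by (simp_all add: fiber_simps)
  have hom: "t \<in> homs C y z" "ar f t = gid (base D) x" if "t \<in> ghom ?S y z" for t y z
    using that by (simp_all add: fiber_ghom)
  have one: "neutral D n x \<in> elts D n x" if "n \<ge> 2" for n
    using crossed_moduleD(2)[OF DD(2)[OF that] x] by (simp add: group.is_monoid monoid.one_closed)
  have xmod: "crossed_module ?S (xm ?E n)" if n: "n \<ge> 2" for n
  proof (rule crossed_moduleI[OF fiber_base(1)])
    note X = crossed_moduleD[OF CD(2)[OF n]] and XD = crossed_moduleD[OF DD(2)[OF n]]
    fix y u v assume y: "y \<in> gobj ?S"
    note s = fiber_subgroup[OF n y] and o = obj[OF y]
    interpret g: group "cgrp C n y" by (rule X(2)[OF o(1)])
    show "group (cgrp ?E n y)"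
      using subgroup.subgroup_is_group[OF s g.is_group] by (simp add: fiber_simps)
    assume u: "u \<in> elts ?E n y"
    show "act (xm ?E n) (gid ?S y) u = u" using X(5)[OF o(1) el(1)[OF u]] by (simp add: fiber_simps)
    have "ar f (dlt (xm C n) y u) = gid (base D) x"
      using M(6)[OF n o(1) el(1)[OF u]] el(2)[OF u] o(2) XD(12)[OF x] by simp
    then show "dlt (xm ?E n) y u \<in> ghom ?S y y"
      using X(7)[OF o(1) el(1)[OF u]] by (simp add: fiber_ghom fiber_simps(9))
    assume v: "v \<in> elts ?E n y"
    show "dlt (xm ?E n) y (u \<otimes>\<^bsub>cgrp ?E n y\<^esub> v) = gcomp ?S (dlt (xm ?E n) y u) (dlt (xm ?E n) y v)"
      using X(8)[OF o(1) el(1)[OF u] el(1)[OF v]] by (simp add: fiber_simps)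
    have "inv\<^bsub>cgrp ?E n y\<^esub> u = inv\<^bsub>cgrp C n y\<^esub> u"
      using g.m_inv_consistent[OF s, of u] u by (simp add: fiber_simps(7))
    then show "act (xm ?E n) (dlt (xm ?E n) y u) v = u \<otimes>\<^bsub>cgrp ?E n y\<^esub> v \<otimes>\<^bsub>cgrp ?E n y\<^esub> inv\<^bsub>cgrp ?E n y\<^esub> u"
      using X(10)[OF o(1) el(1)[OF u] el(1)[OF v]] by (simp add: fiber_simps)
  next
    note X = crossed_moduleD[OF CD(2)[OF n]] and XD = crossed_moduleD[OF DD(2)[OF n]]
    fix y z t u v assume t: "t \<in> ghom ?S y z" and u: "u \<in> elts ?E n y"
    have "mcmp f n z (act (xm C n) t u) = neutral D n x"
      using M(5)[OF n hom(1)[OF t] el(1)[OF u]] hom(2)[OF t] el(2)[OF u] XD(5)[OF x one[OF n]] by simp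
    then show "act (xm ?E n) t u \<in> elts ?E n z"
      using X(3)[OF hom(1)[OF t] el(1)[OF u]] by (simp add: fiber_simps)
    show "dlt (xm ?E n) z (act (xm ?E n) t u) = gcomp ?S (gcomp ?S t (dlt (xm ?E n) y u)) (ginv ?S t)"
      unfolding fiber_base(2)[OF t] using X(9)[OF hom(1)[OF t] el(1)[OF u]] by (simp add: fiber_simps)
    assume v: "v \<in> elts ?E n y"
    show "act (xm ?E n) t (u \<otimes>\<^bsub>cgrp ?E n y\<^esub> v) = act (xm ?E n) t u \<otimes>\<^bsub>cgrp ?E n z\<^esub> act (xm ?E n) t v"
      using X(4)[OF hom(1)[OF t] el(1)[OF u] el(1)[OF v]] by (simp add: fiber_simps)
  next
    note X = crossed_moduleD[OF CD(2)[OF n]]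
    fix y z w s t u assume s: "s \<in> ghom ?S y z" and t: "t \<in> ghom ?S z w" and u: "u \<in> elts ?E n y"
    show "act (xm ?E n) (gcomp ?S t s) u = act (xm ?E n) t (act (xm ?E n) s u)"
      using X(6)[OF hom(1)[OF s] hom(1)[OF t] el(1)[OF u]] by (simp add: fiber_simps)
  qed
  show ?thesis
  proof (rule crossed_complexI[OF fiber_base(1) xmod])
    fix n y u v assume n: "n \<ge> 3" and y: "y \<in> gobj ?S" and u: "u \<in> elts ?E n y"
    have n2: "n \<ge> 2" "n - 1 \<ge> 2" using n by simp_all
    note o = obj[OF y]
    show "dlt (xm ?E n) y u = gid ?S y" using CD(4)[OF n o(1) el(1)[OF u]] by (simp add: fiber_simps)
    have "mcmp f (n - 1) y (bd C n y u) = bd D n x (neutral D n x)"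
      using M(8)[OF n o(1) el(1)[OF u]] o(2) el(2)[OF u] by simp
    also have "\<dots> = neutral D (n - 1) x"
      by (rule hom_one[OF DD(5)[OF n x] crossed_moduleD(2)[OF DD(2)[OF n2(1)] x]
            crossed_moduleD(2)[OF DD(2)[OF n2(2)] x]])
    finally show "bd ?E n y u \<in> elts ?E (n - 1) y"
      using hom_in_carrier[OF CD(5)[OF n o(1)] el(1)[OF u]] by (simp add: fiber_simps)
    { assume v: "v \<in> elts ?E n y"
      show "bd ?E n y (u \<otimes>\<^bsub>cgrp ?E n y\<^esub> v) = bd ?E n y u \<otimes>\<^bsub>cgrp ?E (n - 1) y\<^esub> bd ?E n y v"
        using hom_mult[OF CD(5)[OF n o(1)] el(1)[OF u] el(1)[OF v]] by (simp add: fiber_simps) }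
    { assume v: "v \<in> elts ?E 2 y"
      show "act (xm ?E n) (bd2 ?E y v) u = u"
        using CD(9)[OF n o(1) el(1)[OF v] el(1)[OF u]] by (simp add: fiber_simps) }
  next
    fix n y u assume n: "n \<ge> 4" and y: "y \<in> gobj ?S" and u: "u \<in> elts ?E n y"
    show "bd ?E (n - 1) y (bd ?E n y u) = neutral ?E (n - 2) y"
      using CD(8)[OF n obj(1)[OF y] el(1)[OF u]] by (simp add: fiber_simps)
  next
    fix y u assume y: "y \<in> gobj ?S" and u: "u \<in> elts ?E 2 y"
    show "dlt (xm ?E 2) y u = bd2 ?E y u"
      using CD(3)[OF obj(1)[OF y] el(1)[OF u]] by (simp add: fiber_simps)
  next
    fix y u assume y: "y \<in> gobj ?S" and u: "u \<in> elts ?E 3 y"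
    show "bd2 ?E y (bd ?E 3 y u) = gid ?S y"
      using CD(7)[OF obj(1)[OF y] el(1)[OF u]] by (simp add: fiber_simps)
  next
    fix n y z t u assume n: "n \<ge> 3" and t: "t \<in> ghom ?S y z" and u: "u \<in> elts ?E n y"
    show "bd ?E n z (act (xm ?E n) t u) = act (xm ?E (n - 1)) t (bd ?E n y u)"
      using CD(6)[OF n hom(1)[OF t] el(1)[OF u]] by (simp add: fiber_simps)
  qed
qed

end

section \<open>Inverse limits of towers\<close>

lemma lim_simps:
  "X \<in> objs (inverse_limit T e) \<longleftrightarrow>
     (\<forall>n. X n \<in> objs (T n) \<and> ob (e (Suc n)) (X (Suc n)) = X n)"
  "gid (base (inverse_limit T e)) X = (\<lambda>n. gid (base (T n)) (X n))"
  "gcomp (base (inverse_limit T e)) B A = (\<lambda>n. gcomp (base (T n)) (B n) (A n))"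
  "u \<in> elts (inverse_limit T e) m X \<longleftrightarrow>
     (\<forall>n. u n \<in> elts (T n) m (X n) \<and> mcmp (e (Suc n)) m (X (Suc n)) (u (Suc n)) = u n)"
  "u \<otimes>\<^bsub>cgrp (inverse_limit T e) m X\<^esub> v = (\<lambda>n. u n \<otimes>\<^bsub>cgrp (T n) m (X n)\<^esub> v n)"
  "neutral (inverse_limit T e) m X = (\<lambda>n. neutral (T n) m (X n))"
  "act (xm (inverse_limit T e) m) A u = (\<lambda>n. act (xm (T n) m) (A n) (u n))"
  "dlt (xm (inverse_limit T e) m) X u = (\<lambda>n. dlt (xm (T n) m) (X n) (u n))"
  "bd2 (inverse_limit T e) X u = (\<lambda>n. bd2 (T n) (X n) (u n))"
  "bd (inverse_limit T e) m X u = (\<lambda>n. bd (T n) m (X n) (u n))"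
  by (simp_all add: inverse_limit_def lim_base_def lim_xm_def)

lemma lim_ghom:
  "A \<in> homs (inverse_limit T e) X Y \<longleftrightarrow>
     (\<forall>n. A n \<in> homs (T n) (X n) (Y n) \<and> ar (e (Suc n)) (A (Suc n)) = A n)"
  by (auto simp: ghom_def inverse_limit_def lim_base_def fun_eq_iff)

lemma lim_proj_simps [simp]:
  "ob (lim_proj n) X = X n" "ar (lim_proj n) A = A n" "mcmp (lim_proj n) m X u = u n"
  by (simp_all add: lim_proj_def)

definition lim_lift :: "(nat \<Rightarrow> ('x, 'y, 'z, 'o, 'm, 'a) cmor)
    \<Rightarrow> ('x, 'y, 'z, nat \<Rightarrow> 'o, nat \<Rightarrow> 'm, nat \<Rightarrow> 'a) cmor" where
  "lim_lift q = \<lparr>mbase = \<lparr>fo = (\<lambda>x n. ob (q n) x), fa = (\<lambda>t n. ar (q n) t)\<rparr>,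
     mcmp = (\<lambda>m x u n. mcmp (q n) m x u)\<rparr>"

context
  fixes T :: "nat \<Rightarrow> ('o, 'm, 'a) ccx" and e :: "nat \<Rightarrow> ('o, 'm, 'a, 'o, 'm, 'a) cmor"
  assumes tower: "\<And>n. cc_morphism (T (Suc n)) (T n) (e (Suc n))"
begin

lemma tower_complex: "crossed_complex (T n)"
  using cc_morphismD(2)[OF tower] .

text \<open>The functors of the tower preserve endpoints, so those of a compatible sequence of arrows are
  compatible sequences of objects.\<close>

lemma lim_ghom_obj:
  assumes "A \<in> homs (inverse_limit T e) X Y"
  shows "X \<in> objs (inverse_limit T e)" "Y \<in> objs (inverse_limit T e)"
proof -
  have A: "A n \<in> homs (T n) (X n) (Y n)" "ar (e (Suc n)) (A (Suc n)) = A n" for n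
    using assms by (simp_all add: lim_ghom)
  have "X n \<in> objs (T n) \<and> ob (e (Suc n)) (X (Suc n)) = X n"
    "Y n \<in> objs (T n) \<and> ob (e (Suc n)) (Y (Suc n)) = Y n" for n
  proof -
    note F = is_functorD[OF cc_morphismD(3)[OF tower[of n]]]
    show "X n \<in> objs (T n) \<and> ob (e (Suc n)) (X (Suc n)) = X n"
      "Y n \<in> objs (T n) \<and> ob (e (Suc n)) (Y (Suc n)) = Y n"
      using ghom_obj[OF F(2) A(1)] ghomD[OF A(1)[of n]] ghomD[OF F(4)[OF A(1)[of "Suc n"]]] A(2)[of n]
      by simp_all
  qed
  then show "X \<in> objs (inverse_limit T e)" "Y \<in> objs (inverse_limit T e)"
    by (simp_all add: lim_simps)
qed

lemma lim_groupoid: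
  shows "groupoid (base (inverse_limit T e))"
    and "A \<in> homs (inverse_limit T e) X Y \<Longrightarrow>
      ginv (base (inverse_limit T e)) A = (\<lambda>n. ginv (base (T n)) (A n))"
proof -
  let ?L = "base (inverse_limit T e)"
  note F = is_functorD[OF cc_morphismD(3)[OF tower]]
  have h: "A n \<in> homs (T n) (X n) (Y n)" "ar (e (Suc n)) (A (Suc n)) = A n"
    if "A \<in> ghom ?L X Y" for A X Y n
    using that by (simp_all add: lim_ghom)
  have inv: "(\<lambda>n. ginv (base (T n)) (A n)) \<in> ghom ?L Y X" if A: "A \<in> ghom ?L X Y" for A X Y
    using ginv(1)[OF F(2) h(1)[OF A]] is_functor_ginv[OF cc_morphismD(3)[OF tower] h(1)[OF A]] h(2)[OF A]
    by (simp add: lim_ghom)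
  have inv': "gcomp ?L (\<lambda>n. ginv (base (T n)) (A n)) A = gid ?L X"
    "gcomp ?L A (\<lambda>n. ginv (base (T n)) (A n)) = gid ?L Y" if A: "A \<in> ghom ?L X Y" for A X Y
    using ginv(2,3)[OF F(2) h(1)[OF A]] by (simp_all add: lim_simps)
  show L: "groupoid ?L"
  proof (rule groupoidI)
    show "gsrc ?L g \<in> gobj ?L \<and> gtgt ?L g \<in> gobj ?L" if "g \<in> garr ?L" for g
      using lim_ghom_obj[OF garr_in_ghom[OF that]] by simp
    show "gid ?L X \<in> ghom ?L X X" if "X \<in> gobj ?L" for X
      using that gid_hom[OF F(2)] F(5) by (simp add: lim_ghom lim_simps)
    show "gcomp ?L B A \<in> ghom ?L X Z" if A: "A \<in> ghom ?L X Y" and B: "B \<in> ghom ?L Y Z" for A B X Y Z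
      using gcomp_hom[OF F(2) h(1)[OF A] h(1)[OF B]] F(6)[OF h(1)[OF A] h(1)[OF B]] h(2)[OF A] h(2)[OF B]
      by (simp add: lim_ghom lim_simps)
    show "gcomp ?L A (gid ?L X) = A \<and> gcomp ?L (gid ?L Y) A = A" if A: "A \<in> ghom ?L X Y" for A X Y
      using gcomp_id[OF F(2) h(1)[OF A]] by (simp add: lim_simps)
    show "gcomp ?L K (gcomp ?L B A) = gcomp ?L (gcomp ?L K B) A"
      if A: "A \<in> ghom ?L W X" and B: "B \<in> ghom ?L X Y" and K: "K \<in> ghom ?L Y Z" for A B K W X Y Z
      unfolding lim_simps using gcomp_assoc[OF F(2) h(1)[OF A] h(1)[OF B] h(1)[OF K]] by (intro ext)
    show "\<exists>B\<in>ghom ?L Y X. gcomp ?L B A = gid ?L X \<and> gcomp ?L A B = gid ?L Y"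
      if A: "A \<in> ghom ?L X Y" for A X Y
      using inv[OF A] inv'[OF A] by blast
  qed
  show "A \<in> ghom ?L X Y \<Longrightarrow> ginv ?L A = (\<lambda>n. ginv (base (T n)) (A n))"
    by (rule ginv_equality[OF L _ inv inv'])
qed

lemma lim_group:
  assumes m: "m \<ge> 2" and X: "X \<in> objs (inverse_limit T e)"
  shows "group (cgrp (inverse_limit T e) m X)"
    and "u \<in> elts (inverse_limit T e) m X \<Longrightarrow>
      inv\<^bsub>cgrp (inverse_limit T e) m X\<^esub> u = (\<lambda>n. inv\<^bsub>cgrp (T n) m (X n)\<^esub> u n)"
proof -
  let ?H = "cgrp (inverse_limit T e) m X"
  have X': "X n \<in> objs (T n)" "ob (e (Suc n)) (X (Suc n)) = X n" for n
    using X by (simp_all add: lim_simps)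
  have grp: "group (cgrp (T n) m (X n))" for n
    by (rule crossed_moduleD(2)[OF crossed_complexD(2)[OF tower_complex m] X'(1)])
  have hom: "mcmp (e (Suc n)) m (X (Suc n)) \<in> hom (cgrp (T (Suc n)) m (X (Suc n))) (cgrp (T n) m (X n))" for n
    using cc_morphismD(4)[OF tower m X'(1)] X'(2) by simp
  have gh: "group_hom (cgrp (T (Suc n)) m (X (Suc n))) (cgrp (T n) m (X n)) (mcmp (e (Suc n)) m (X (Suc n)))" for n
    using hom grp by (simp add: group_hom_def group_hom_axioms_def)
  have el: "u n \<in> elts (T n) m (X n)" "mcmp (e (Suc n)) m (X (Suc n)) (u (Suc n)) = u n"
    if "u \<in> carrier ?H" for u n using that by (simp_all add: lim_simps)
  have inv: "(\<lambda>n. inv\<^bsub>cgrp (T n) m (X n)\<^esub> u n) \<in> carrier ?H" if u: "u \<in> carrier ?H" for u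
    using group.inv_closed[OF grp el(1)[OF u]] group_hom.hom_inv[OF gh el(1)[OF u]] el(2)[OF u]
    by (simp add: lim_simps)
  have l_inv: "(\<lambda>n. inv\<^bsub>cgrp (T n) m (X n)\<^esub> u n) \<otimes>\<^bsub>?H\<^esub> u = \<one>\<^bsub>?H\<^esub>" if u: "u \<in> carrier ?H" for u
    using group.l_inv[OF grp el(1)[OF u]] by (simp add: lim_simps)
  show H: "group ?H"
  proof (rule groupI)
    show "u \<otimes>\<^bsub>?H\<^esub> v \<in> carrier ?H" if u: "u \<in> carrier ?H" and v: "v \<in> carrier ?H" for u v
      using monoid.m_closed[OF group.is_monoid[OF grp] el(1)[OF u] el(1)[OF v]]
        hom_mult[OF hom el(1)[OF u] el(1)[OF v]] el(2)[OF u] el(2)[OF v]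
      by (simp add: lim_simps)
    show "\<one>\<^bsub>?H\<^esub> \<in> carrier ?H"
      using monoid.one_closed[OF group.is_monoid[OF grp]] group_hom.hom_one[OF gh] by (simp add: lim_simps)
    show "u \<otimes>\<^bsub>?H\<^esub> v \<otimes>\<^bsub>?H\<^esub> w = u \<otimes>\<^bsub>?H\<^esub> (v \<otimes>\<^bsub>?H\<^esub> w)"
      if "u \<in> carrier ?H" "v \<in> carrier ?H" "w \<in> carrier ?H" for u v w
      unfolding lim_simps using monoid.m_assoc[OF group.is_monoid[OF grp] el(1)[OF that(1)] el(1)[OF that(2)] el(1)[OF that(3)]]
      by (intro ext)
    show "\<one>\<^bsub>?H\<^esub> \<otimes>\<^bsub>?H\<^esub> u = u" if "u \<in> carrier ?H" for u
      unfolding lim_simps using monoid.l_one[OF group.is_monoid[OF grp] el(1)[OF that]] by (intro ext)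
    show "\<exists>v\<in>carrier ?H. v \<otimes>\<^bsub>?H\<^esub> u = \<one>\<^bsub>?H\<^esub>" if u: "u \<in> carrier ?H" for u
      using inv[OF u] l_inv[OF u] by blast
  qed
  show "u \<in> carrier ?H \<Longrightarrow> inv\<^bsub>?H\<^esub> u = (\<lambda>n. inv\<^bsub>cgrp (T n) m (X n)\<^esub> u n)"
    by (rule group.inv_equality[OF H l_inv _ inv])
qed

text \<open>Each identity holds in every coordinate, and functions on the natural numbers are equal when
  their coordinates are. Compatibility of a composed sequence is the statement that the maps of
  the tower respect the operation.\<close>

theorem lim_crossed_complex: "crossed_complex (inverse_limit T e)"
proof -
  let ?L = "inverse_limit T e"
  note M = cc_morphismD[OF tower] and CT = crossed_complexD[OF tower_complex]
  have h: "A n \<in> homs (T n) (X n) (Y n)" "ar (e (Suc n)) (A (Suc n)) = A n"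
    if "A \<in> homs ?L X Y" for A X Y n
    using that by (simp_all add: lim_ghom)
  have o: "X n \<in> objs (T n)" "ob (e (Suc n)) (X (Suc n)) = X n" if "X \<in> objs ?L" for X n
    using that by (simp_all add: lim_simps)
  have el: "u n \<in> elts (T n) m (X n)" "mcmp (e (Suc n)) m (X (Suc n)) (u (Suc n)) = u n"
    if "u \<in> elts ?L m X" for u n m X using that by (simp_all add: lim_simps)
  have xmod: "crossed_module (base ?L) (xm ?L m)" if m: "m \<ge> 2" for m
  proof (rule crossed_moduleI[OF lim_groupoid(1)])
    note X = crossed_moduleD[OF CT(2)[OF m]]
    fix Y u v assume Y: "Y \<in> objs ?L"
    show "group (cgrp ?L m Y)" by (rule lim_group(1)[OF m Y])
    assume u: "u \<in> elts ?L m Y"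
    show "act (xm ?L m) (gid (base ?L) Y) u = u"
      unfolding lim_simps using X(5)[OF o(1)[OF Y] el(1)[OF u]] by (intro ext)
    show "dlt (xm ?L m) Y u \<in> homs ?L Y Y"
      unfolding lim_ghom lim_simps
      using X(7)[OF o(1)[OF Y] el(1)[OF u]] M(6)[OF m o(1)[OF Y] el(1)[OF u]] o(2)[OF Y] el(2)[OF u] by simp
    assume v: "v \<in> elts ?L m Y"
    show "dlt (xm ?L m) Y (u \<otimes>\<^bsub>cgrp ?L m Y\<^esub> v) = gcomp (base ?L) (dlt (xm ?L m) Y u) (dlt (xm ?L m) Y v)"
      unfolding lim_simps using X(8)[OF o(1)[OF Y] el(1)[OF u] el(1)[OF v]] by (intro ext)
    show "act (xm ?L m) (dlt (xm ?L m) Y u) v = u \<otimes>\<^bsub>cgrp ?L m Y\<^esub> v \<otimes>\<^bsub>cgrp ?L m Y\<^esub> inv\<^bsub>cgrp ?L m Y\<^esub> u"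
      unfolding lim_group(2)[OF m Y u] unfolding lim_simps
      using X(10)[OF o(1)[OF Y] el(1)[OF u] el(1)[OF v]] by (intro ext)
  next
    note X = crossed_moduleD[OF CT(2)[OF m]]
    fix Y Z t u v assume t: "t \<in> homs ?L Y Z" and u: "u \<in> elts ?L m Y"
    show "act (xm ?L m) t u \<in> elts ?L m Z"
      unfolding lim_simps
      using X(3)[OF h(1)[OF t] el(1)[OF u]] M(5)[OF m h(1)[OF t] el(1)[OF u]] h(2)[OF t] el(2)[OF u] by simp
    show "dlt (xm ?L m) Z (act (xm ?L m) t u) =
        gcomp (base ?L) (gcomp (base ?L) t (dlt (xm ?L m) Y u)) (ginv (base ?L) t)"
      unfolding lim_groupoid(2)[OF t] unfolding lim_simps using X(9)[OF h(1)[OF t] el(1)[OF u]] by (intro ext)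
    assume v: "v \<in> elts ?L m Y"
    show "act (xm ?L m) t (u \<otimes>\<^bsub>cgrp ?L m Y\<^esub> v) = act (xm ?L m) t u \<otimes>\<^bsub>cgrp ?L m Z\<^esub> act (xm ?L m) t v"
      unfolding lim_simps using X(4)[OF h(1)[OF t] el(1)[OF u] el(1)[OF v]] by (intro ext)
  next
    note X = crossed_moduleD[OF CT(2)[OF m]]
    fix Y Z W s t u
    assume s: "s \<in> homs ?L Y Z" and t: "t \<in> homs ?L Z W" and u: "u \<in> elts ?L m Y"
    show "act (xm ?L m) (gcomp (base ?L) t s) u = act (xm ?L m) t (act (xm ?L m) s u)"
      unfolding lim_simps using X(6)[OF h(1)[OF s] h(1)[OF t] el(1)[OF u]] by (intro ext)
  qed
  show ?thesis
  proof (rule crossed_complexI[OF lim_groupoid(1) xmod])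
    fix m Y u v assume m: "m \<ge> 3" and Y: "Y \<in> objs ?L" and u: "u \<in> elts ?L m Y"
    note oY = o(1)[OF Y] and u' = el(1)[OF u]
    show "dlt (xm ?L m) Y u = gid (base ?L) Y"
      unfolding lim_simps using CT(4)[OF m oY u'] by (intro ext)
    show "bd ?L m Y u \<in> elts ?L (m - 1) Y"
      unfolding lim_simps
      using hom_in_carrier[OF CT(5)[OF m oY] u'] M(8)[OF m oY u'] o(2)[OF Y] el(2)[OF u] by simp
    { assume v: "v \<in> elts ?L m Y"
      show "bd ?L m Y (u \<otimes>\<^bsub>cgrp ?L m Y\<^esub> v) = bd ?L m Y u \<otimes>\<^bsub>cgrp ?L (m - 1) Y\<^esub> bd ?L m Y v"
        unfolding lim_simps using hom_mult[OF CT(5)[OF m oY] u' el(1)[OF v]] by (intro ext) }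
    { assume v: "v \<in> elts ?L 2 Y"
      show "act (xm ?L m) (bd2 ?L Y v) u = u"
        unfolding lim_simps using CT(9)[OF m oY el(1)[OF v] u'] by (intro ext) }
  next
    fix m Y u assume m: "m \<ge> 4" and Y: "Y \<in> objs ?L" and u: "u \<in> elts ?L m Y"
    show "bd ?L (m - 1) Y (bd ?L m Y u) = neutral ?L (m - 2) Y"
      unfolding lim_simps using CT(8)[OF m o(1)[OF Y] el(1)[OF u]] by (intro ext)
  next
    fix Y u assume Y: "Y \<in> objs ?L" and u: "u \<in> elts ?L 2 Y"
    show "dlt (xm ?L 2) Y u = bd2 ?L Y u"
      unfolding lim_simps using CT(3)[OF o(1)[OF Y] el(1)[OF u]] by (intro ext)
  next
    fix Y u assume Y: "Y \<in> objs ?L" and u: "u \<in> elts ?L 3 Y"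
    show "bd2 ?L Y (bd ?L 3 Y u) = gid (base ?L) Y"
      unfolding lim_simps using CT(7)[OF o(1)[OF Y] el(1)[OF u]] by (intro ext)
  next
    fix m Y Z t u assume m: "m \<ge> 3" and t: "t \<in> homs ?L Y Z" and u: "u \<in> elts ?L m Y"
    show "bd ?L m Z (act (xm ?L m) t u) = act (xm ?L (m - 1)) t (bd ?L m Y u)"
      unfolding lim_simps using CT(6)[OF m h(1)[OF t] el(1)[OF u]] by (intro ext)
  qed
qed

lemma lim_proj_morphism: "cc_morphism (inverse_limit T e) (T n) (lim_proj n)"
proof (rule cc_morphismI[OF lim_crossed_complex tower_complex])
  show "is_functor (base (inverse_limit T e)) (base (T n)) (mbase (lim_proj n))"
    by (rule is_functorI[OF lim_groupoid(1) crossed_complexD(1)[OF tower_complex]])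
      (simp_all add: lim_simps lim_ghom)
qed (simp_all add: lim_simps)

lemma lim_lift_morphism:
  assumes q: "\<And>n. cc_morphism X (T n) (q n)"
    and comp: "\<And>n. cc_mor_eq X (cc_comp (e (Suc n)) (q (Suc n))) (q n)"
  shows "cc_morphism X (inverse_limit T e) (lim_lift q)"
proof -
  let ?L = "inverse_limit T e"
  note Q = cc_morphismD[OF q]
  note F = is_functorD[OF Q(3)]
  have cfo: "ob (e (Suc n)) (ob (q (Suc n)) x) = ob (q n) x" if "x \<in> objs X" for n x
    using comp[of n] that by (simp add: cc_mor_eq_def cc_comp_def)
  have cfa: "ar (e (Suc n)) (ar (q (Suc n)) t) = ar (q n) t" if "t \<in> garr (base X)" for n t
    using comp[of n] that by (simp add: cc_mor_eq_def cc_comp_def)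
  have cm: "mcmp (e (Suc n)) m (ob (q (Suc n)) x) (mcmp (q (Suc n)) m x u) = mcmp (q n) m x u"
    if "m \<ge> 2" "x \<in> objs X" "u \<in> elts X m x" for n m x u
    using comp[of n] that by (simp add: cc_mor_eq_def cc_comp_def)
  have s: "ob (lim_lift q) x = (\<lambda>n. ob (q n) x)" "ar (lim_lift q) t = (\<lambda>n. ar (q n) t)"
    "mcmp (lim_lift q) m x u = (\<lambda>n. mcmp (q n) m x u)" for x t m u
    by (simp_all add: lim_lift_def)
  show ?thesis
  proof (rule cc_morphismI[OF Q(1) lim_crossed_complex])
    show "is_functor (base X) (base ?L) (mbase (lim_lift q))"
    proof (rule is_functorI[OF F(1) lim_groupoid(1)])
      show "ob (lim_lift q) x \<in> objs ?L" if "x \<in> objs X" for x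
        unfolding s lim_simps using F(3)[OF that] cfo[OF that] by simp
      show "ar (lim_lift q) t \<in> homs ?L (ob (lim_lift q) x) (ob (lim_lift q) y)"
        if "t \<in> homs X x y" for t x y
        unfolding s lim_ghom using F(4)[OF that] cfa[OF ghomD(1)[OF that]] by simp
      show "ar (lim_lift q) (gid (base X) x) = gid (base ?L) (ob (lim_lift q) x)"
        if "x \<in> objs X" for x
        unfolding s lim_simps using F(5)[OF that] by (intro ext)
      show "ar (lim_lift q) (gcomp (base X) t r) =
          gcomp (base ?L) (ar (lim_lift q) t) (ar (lim_lift q) r)"
        if "r \<in> homs X x y" "t \<in> homs X y z" for r t x y z
        unfolding s lim_simps using F(6)[OF that] by (intro ext)
    qed
  next
    fix m x u v assume m: "m \<ge> (2::nat)" and x: "x \<in> objs X" and u: "u \<in> elts X m x"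
    show "mcmp (lim_lift q) m x u \<in> elts ?L m (ob (lim_lift q) x)"
      unfolding s lim_simps using hom_in_carrier[OF Q(4)[OF m x] u] cm[OF m x u] by simp
    assume v: "v \<in> elts X m x"
    show "mcmp (lim_lift q) m x (u \<otimes>\<^bsub>cgrp X m x\<^esub> v) =
        mcmp (lim_lift q) m x u \<otimes>\<^bsub>cgrp ?L m (ob (lim_lift q) x)\<^esub> mcmp (lim_lift q) m x v"
      unfolding s lim_simps using hom_mult[OF Q(4)[OF m x] u v] by (intro ext)
  next
    fix m x y t u assume m: "m \<ge> (2::nat)" and t: "t \<in> homs X x y" and u: "u \<in> elts X m x"
    show "mcmp (lim_lift q) m y (act (xm X m) t u) = act (xm ?L m) (ar (lim_lift q) t) (mcmp (lim_lift q) m x u)"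
      unfolding s lim_simps using Q(5)[OF m t u] by (intro ext)
  next
    fix x u assume x: "x \<in> objs X" and u: "u \<in> elts X 2 x"
    show "ar (lim_lift q) (bd2 X x u) = bd2 ?L (ob (lim_lift q) x) (mcmp (lim_lift q) 2 x u)"
      unfolding s lim_simps using Q(7)[OF x u] by (intro ext)
  next
    fix m x u assume m: "m \<ge> (3::nat)" and x: "x \<in> objs X" and u: "u \<in> elts X m x"
    show "mcmp (lim_lift q) (m - 1) x (bd X m x u) = bd ?L m (ob (lim_lift q) x) (mcmp (lim_lift q) m x u)"
      unfolding s lim_simps using Q(8)[OF m x u] by (intro ext)
  qed
qed

text \<open>The mediating morphism collects the values of the given cone into sequences. It is unique
  because the projections read off all coordinates.\<close>

theorem inverse_limit_is_inverse_limit: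
  "is_inverse_limit TYPE('x \<times> 'y \<times> 'z) T e (inverse_limit T e) lim_proj"
  unfolding is_inverse_limit_def
proof (intro conjI allI impI)
  show "cc_mor_eq (inverse_limit T e) (cc_comp (e (Suc n)) (lim_proj (Suc n))) (lim_proj n)" for n
    unfolding cc_mor_eq_def
    by (auto simp: cc_comp_def lim_simps) (simp add: inverse_limit_def lim_base_def)
next
  fix X :: "('x, 'y, 'z) ccx" and q
  assume a: "crossed_complex X \<and> (\<forall>n. cc_morphism X (T n) (q n)) \<and>
    (\<forall>n. cc_mor_eq X (cc_comp (e (Suc n)) (q (Suc n))) (q n))"
  have eq: "cc_mor_eq X (cc_comp (lim_proj n) (lim_lift q)) (q n)" for n
    by (simp add: cc_mor_eq_def cc_comp_def lim_lift_def)
  have uniq: "cc_mor_eq X v (lim_lift q)" if "\<forall>n. cc_mor_eq X (cc_comp (lim_proj n) v) (q n)" for v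
    using that by (simp add: cc_mor_eq_def cc_comp_def lim_lift_def fun_eq_iff)
  show "\<exists>u. cc_morphism X (inverse_limit T e) u \<and> (\<forall>n. cc_mor_eq X (cc_comp (lim_proj n) u) (q n)) \<and>
      (\<forall>v. cc_morphism X (inverse_limit T e) v \<and> (\<forall>n. cc_mor_eq X (cc_comp (lim_proj n) v) (q n)) \<longrightarrow>
         cc_mor_eq X v u)"
    using lim_lift_morphism[of X q] a eq uniq by blast
qed (rule lim_crossed_complex lim_proj_morphism)+

end

section \<open>Bijective morphisms are weak equivalences\<close>

lemma bijective_functor_lift_hom:
  assumes F: "is_functor G H F" and o: "inj_on (fo F) (gobj G)" and a: "garr H \<subseteq> fa F ` garr G"
    and x: "x \<in> gobj G" and y: "y \<in> gobj G" and h: "h \<in> ghom H (fo F x) (fo F y)"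
  obtains g where "g \<in> ghom G x y" "h = fa F g"
proof -
  note FD = is_functorD[OF F]
  obtain g where g: "g \<in> garr G" "h = fa F g" using a ghomD(1)[OF h] by blast
  have "fo F (gsrc G g) = fo F x" "fo F (gtgt G g) = fo F y"
    using ghomD[OF FD(4)[OF garr_in_ghom[OF g(1)]]] ghomD[OF h] g(2) by simp_all
  then have "gsrc G g = x" "gtgt G g = y"
    using inj_onD[OF o] garr_obj[OF FD(1) g(1)] x y by blast+
  then show ?thesis using that g by (auto intro: ghomI)
qed

text \<open>The inverse on objects and arrows is a functor, and both composites are identities, so
  identity arrows serve as the natural transformations.\<close>

lemma bijective_functor_equivalence:
  assumes F: "is_functor G H F" and o: "bij_betw (fo F) (gobj G) (gobj H)"
    and a: "bij_betw (fa F) (garr G) (garr H)"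
  shows "is_equivalence G H F"
proof -
  note FD = is_functorD[OF F]
  define K where "K = \<lparr>fo = inv_into (gobj G) (fo F), fa = inv_into (garr G) (fa F)\<rparr>"
  have oinj: "inj_on (fo F) (gobj G)" and ainj: "inj_on (fa F) (garr G)"
    and aim: "fa F ` garr G = garr H" and oim: "fo F ` gobj G = gobj H"
    using o a by (simp_all add: bij_betw_def)
  have KF: "fo K (fo F x) = x" if "x \<in> gobj G" for x
    using that oinj by (simp add: K_def)
  have KFa: "fa K (fa F g) = g" if "g \<in> garr G" for g
    using that ainj by (simp add: K_def)
  have lo: "\<exists>x\<in>gobj G. y = fo F x" if "y \<in> gobj H" for y using that oim by blast
  have lh: "\<exists>x' y' g. x' \<in> gobj G \<and> y' \<in> gobj G \<and> x = fo F x' \<and> y = fo F y' \<and> g \<in> ghom G x' y' \<and> h = fa F g"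
    if h: "h \<in> ghom H x y" for h x y
  proof -
    obtain x' where x': "x' \<in> gobj G" "x = fo F x'" using lo ghom_obj[OF FD(2) h] by blast
    obtain y' where y': "y' \<in> gobj G" "y = fo F y'" using lo ghom_obj[OF FD(2) h] by blast
    obtain g where "g \<in> ghom G x' y'" "h = fa F g"
      using bijective_functor_lift_hom[OF F oinj _ x'(1) y'(1)] h aim x'(2) y'(2) by blast
    then show ?thesis using x' y' by (intro exI conjI)
  qed
  have Kf: "is_functor H G K"
  proof (rule is_functorI[OF FD(2,1)])
    fix y assume "y \<in> gobj H"
    then obtain x where x: "x \<in> gobj G" "y = fo F x" using lo by blast
    show "fo K y \<in> gobj G" using x KF by simp
    show "fa K (gid H y) = gid G (fo K y)"
      using FD(5)[OF x(1)] KFa[OF ghomD(1)[OF gid_hom[OF FD(1) x(1)]]] KF[OF x(1)] x(2) by simp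
  next
    fix x y r assume "r \<in> ghom H x y"
    from lh[OF this] obtain x' y' r' where r: "x' \<in> gobj G" "y' \<in> gobj G" "x = fo F x'" "y = fo F y'"
      "r' \<in> ghom G x' y'" "r = fa F r'" by (elim exE conjE)
    show "fa K r \<in> ghom G (fo K x) (fo K y)" using r KF KFa[OF ghomD(1)[OF r(5)]] by simp
    fix z t assume t: "t \<in> ghom H y z"
    obtain z' where z': "z' \<in> gobj G" "z = fo F z'" using lo ghom_obj[OF FD(2) t] by blast
    obtain t' where t': "t' \<in> ghom G y' z'" "t = fa F t'"
      using bijective_functor_lift_hom[OF F oinj _ r(2) z'(1)] t aim r(4) z'(2) by blast
    show "fa K (gcomp H t r) = gcomp G (fa K t) (fa K r)"
      using FD(6)[OF r(5) t'(1)] KFa[OF ghomD(1)[OF gcomp_hom[OF FD(1) r(5) t'(1)]]]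
        KFa[OF ghomD(1)[OF r(5)]] KFa[OF ghomD(1)[OF t'(1)]] r(6) t'(2) by simp
  qed
  have "is_natural G G (fctr_comp K F) fctr_id (gid G)"
    unfolding is_natural_def
  proof (intro conjI ballI)
    fix x assume x: "x \<in> gobj G"
    show "gid G x \<in> ghom G (fo (fctr_comp K F) x) (fo fctr_id x)" using gid_hom[OF FD(1) x] KF[OF x] by simp
    fix y g assume g: "g \<in> ghom G x y"
    show "gcomp G (gid G y) (fa (fctr_comp K F) g) = gcomp G (fa fctr_id g) (gid G x)"
      using KFa[OF ghomD(1)[OF g]] gcomp_id[OF FD(1) g] by simp
  qed
  moreover have "is_natural H H (fctr_comp F K) fctr_id (gid H)"
    unfolding is_natural_def
  proof (intro conjI ballI)
    fix x assume x: "x \<in> gobj H"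
    then obtain x' where "x' \<in> gobj G" "x = fo F x'" using lo by blast
    then show "gid H x \<in> ghom H (fo (fctr_comp F K) x) (fo fctr_id x)"
      using gid_hom[OF FD(2) x] KF by simp
    fix y g assume g: "g \<in> ghom H x y"
    then obtain g' where "g' \<in> garr G" "g = fa F g'" using aim ghomD(1)[OF g] by blast
    then show "gcomp H (gid H y) (fa (fctr_comp F K) g) = gcomp H (fa fctr_id g) (gid H x)"
      using KFa gcomp_id[OF FD(2) g] by simp
  qed
  ultimately show ?thesis using F Kf unfolding is_equivalence_def by (intro conjI exI)
qed

text \<open>A morphism maps the image of \<open>\<partial>\<^sub>2\<close> in \<open>C\<close> to the one in \<open>D\<close>, so all members of a class
  contribute the same class to the union that defines the induced map.\<close>

lemma
  assumes f: "cc_morphism C D f"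
  shows pi1_map_class: "g \<in> garr (base C) \<Longrightarrow> fa (pi1_map D f) (pi1_class C g) = pi1_class D (ar f g)"
    and pi1_map_functor: "is_functor (pi1 C) (pi1 D) (pi1_map D f)"
proof -
  note M = cc_morphismD[OF f]
  note F = is_functorD[OF M(3)]
  have cls: "fa (pi1_map D f) (pi1_class C g) = pi1_class D (ar f g)" if g: "g \<in> homs C x y" for g x y
  proof -
    note fg = F(4)[OF g]
    have const: "pi1_class D (ar f h) = pi1_class D (ar f g)" if h: "h \<in> pi1_class C g" for h
    proof -
      have y: "y \<in> objs C" using ghom_obj[OF F(1) g] by simp
      obtain u where u: "u \<in> elts C 2 y" "h = gcomp (base C) (bd2 C y u) g"
        using h by (auto simp: pi1_class_ghom(1)[OF M(1) g] bd2_im_def)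
      have "ar f h = gcomp (base D) (ar f (bd2 C y u)) (ar f g)"
        using F(6)[OF g bd2_ghom[OF M(1) y u(1)]] u(2) by simp
      moreover have "ar f (bd2 C y u) \<in> bd2_im D (ob f y)"
        using M(7)[OF y u(1)] hom_in_carrier[OF M(4)[OF _ y] u(1)] by (simp add: bd2_im_def)
      ultimately have "ar f h \<in> pi1_class D (ar f g)"
        using pi1_class_ghom(1)[OF M(2) fg] by simp
      then show ?thesis by (rule pi1_class_eqI[OF M(2) fg])
    qed
    show ?thesis
      unfolding pi1_map_def fctr.simps by (rule UN_constant_eq[OF pi1_class_ghom(3)[OF M(1) g] ballI[OF const]])
  qed
  show "g \<in> garr (base C) \<Longrightarrow> fa (pi1_map D f) (pi1_class C g) = pi1_class D (ar f g)"
    by (rule cls[OF garr_in_ghom])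
  have fo: "fo (pi1_map D f) = ob f" by (simp add: pi1_map_def)
  show "is_functor (pi1 C) (pi1 D) (pi1_map D f)"
  proof (rule is_functorI[OF pi1_groupoid[OF M(1)] pi1_groupoid[OF M(2)]])
    show "fo (pi1_map D f) x \<in> gobj (pi1 D)" if "x \<in> gobj (pi1 C)" for x
      using that F(3) fo by (simp add: pi1_gobj[OF M(1)] pi1_gobj[OF M(2)])
    show "fa (pi1_map D f) (gid (pi1 C) x) = gid (pi1 D) (fo (pi1_map D f) x)" if "x \<in> gobj (pi1 C)" for x
      using that cls[OF gid_hom[OF F(1)]] F(5) fo
      by (simp add: pi1_gobj[OF M(1)] pi1_gid[OF M(1)] pi1_gid[OF M(2)])
  next
    fix x y A assume "A \<in> ghom (pi1 C) x y"
    then obtain a where a: "a \<in> homs C x y" "A = pi1_class C a" by (auto simp: pi1_ghom[OF M(1)])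
    show "fa (pi1_map D f) A \<in> ghom (pi1 D) (fo (pi1_map D f) x) (fo (pi1_map D f) y)"
      using cls[OF a(1)] F(4)[OF a(1)] a(2) fo by (simp add: pi1_ghom[OF M(2)])
    fix z B assume "B \<in> ghom (pi1 C) y z"
    then obtain b where b: "b \<in> homs C y z" "B = pi1_class C b" by (auto simp: pi1_ghom[OF M(1)])
    have "fa (pi1_map D f) (gcomp (pi1 C) B A) = pi1_class D (ar f (gcomp (base C) b a))"
      unfolding a(2) b(2) pi1_gcomp[OF M(1) a(1) b(1)] by (rule cls[OF gcomp_hom[OF F(1) a(1) b(1)]])
    also have "\<dots> = gcomp (pi1 D) (pi1_class D (ar f b)) (pi1_class D (ar f a))"
      unfolding F(6)[OF a(1) b(1)] by (rule pi1_gcomp[OF M(2) F(4)[OF a(1)] F(4)[OF b(1)], symmetric])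
    finally show "fa (pi1_map D f) (gcomp (pi1 C) B A) = gcomp (pi1 D) (fa (pi1_map D f) B) (fa (pi1_map D f) A)"
      unfolding a(2) b(2) cls[OF a(1)] cls[OF b(1)] .
  qed
qed

lemma pin_simps:
  "carrier (pin C n x) = (\<lambda>u. bd_im C (n + 1) x #>\<^bsub>cgrp C n x\<^esub> u) ` bd_ker C n x"
  "A \<otimes>\<^bsub>pin C n x\<^esub> B = A <#>\<^bsub>cgrp C n x\<^esub> B" "\<one>\<^bsub>pin C n x\<^esub> = bd_im C (n + 1) x"
  by (auto simp: pin_def FactGroup_def RCOSETS_def r_coset_def set_mult_def)

lemma bd_ker_subset: "n \<ge> 2 \<Longrightarrow> bd_ker C n x \<subseteq> elts C n x"
  by (auto simp: bd_ker_def)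

text \<open>The induced map is a union over the coset; all its members have images in one coset, since
  \<open>f\<close> commutes with the boundary \<open>\<partial>\<^bsub>n + 1\<^esub>\<close>.\<close>

lemma pin_map_coset:
  assumes f: "cc_morphism C D f" and n: "n \<ge> 2" and x: "x \<in> objs C" and u: "u \<in> elts C n x"
  shows "pin_map D f n x (bd_im C (n + 1) x #>\<^bsub>cgrp C n x\<^esub> u) =
    bd_im D (n + 1) (ob f x) #>\<^bsub>cgrp D n (ob f x)\<^esub> mcmp f n x u"
proof -
  let ?y = "ob f x" and ?I = "bd_im C (n + 1) x" and ?J = "bd_im D (n + 1) (ob f x)"
  let ?G = "cgrp C n x" and ?H = "cgrp D n ?y"
  note M = cc_morphismD[OF f]
  have y: "?y \<in> objs D" by (rule is_functorD(3)[OF M(3) x])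
  interpret G: group ?G by (rule cgrp_group[OF M(1) n x])
  interpret H: group ?H by (rule cgrp_group[OF M(2) n y])
  note a = M(4)[OF n x]
  have I: "subgroup ?I ?G" and J: "subgroup ?J ?H"
    using bd_im_normal[OF M(1) n x] bd_im_normal[OF M(2) n y] by (simp_all add: normal_imp_subgroup)
  have const: "?J #>\<^bsub>?H\<^esub> mcmp f n x v = ?J #>\<^bsub>?H\<^esub> mcmp f n x u" if v: "v \<in> ?I #>\<^bsub>?G\<^esub> u" for v
  proof -
    obtain w where w: "w \<in> elts C (n + 1) x" "v = bd C (n + 1) x w \<otimes>\<^bsub>?G\<^esub> u"
      using v by (auto simp: bd_im_def r_coset_def)
    have b: "bd C (n + 1) x w \<in> carrier ?G"
      using hom_in_carrier[OF crossed_complexD(5)[OF M(1) _ x] w(1)] n by simp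
    have "mcmp f n x (bd C (n + 1) x w) \<in> ?J"
      using M(8)[OF _ x w(1)] hom_in_carrier[OF M(4)[OF _ x] w(1)] n by (simp add: bd_im_def)
    then have "mcmp f n x v \<in> ?J #>\<^bsub>?H\<^esub> mcmp f n x u"
      using hom_mult[OF a b u] w(2) by (auto simp: r_coset_def)
    then show ?thesis using H.repr_independence[OF _ hom_in_carrier[OF a u] J] by simp
  qed
  show ?thesis
    unfolding pin_map_def Let_def by (rule UN_constant_eq[OF G.rcos_self[OF u I] ballI[OF const]])
qed

lemma image_Collect_iff:
  assumes "h ` A = B" and "\<And>u. u \<in> A \<Longrightarrow> R (h u) \<longleftrightarrow> Q u"
  shows "h ` {u \<in> A. Q u} = {v \<in> B. R v}"
  using assms by auto

text \<open>Bijectivity lets arrows of \<open>D\<close>, kernels and images of boundaries be lifted to \<open>C\<close>; so two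
  objects, arrows or cycles of \<open>C\<close> that become equivalent in \<open>D\<close> were equivalent already.\<close>

theorem bijective_weak_equivalence:
  assumes f: "cc_morphism C D f" and o: "bij_betw (ob f) (objs C) (objs D)"
    and a: "bij_betw (ar f) (garr (base C)) (garr (base D))"
    and g: "\<And>n x. n \<ge> 2 \<Longrightarrow> x \<in> objs C \<Longrightarrow>
      bij_betw (mcmp f n x) (elts C n x) (elts D n (ob f x))"
  shows "weak_equivalence C D f"
proof -
  let ?G = "base C" and ?H = "base D" and ?F = "mbase f"
  note M = cc_morphismD[OF f]
  note F = is_functorD[OF M(3)]
  have oinj: "inj_on (fo ?F) (gobj ?G)" and ainj: "inj_on (fa ?F) (garr ?G)"
    and aim: "fa ?F ` garr ?G = garr ?H" and oim: "fo ?F ` gobj ?G = gobj ?H"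
    using o a by (simp_all add: bij_betw_def)
  have ginj: "inj_on (mcmp f n x) (elts C n x)"
    and gim: "mcmp f n x ` elts C n x = elts D n (fo ?F x)"
    if "n \<ge> 2" "x \<in> gobj ?G" for n x
    using g[OF that] by (simp_all add: bij_betw_def)
  have lift: "\<exists>g\<in>ghom ?G x y. h = fa ?F g"
    if "x \<in> gobj ?G" "y \<in> gobj ?G" "h \<in> ghom ?H (fo ?F x) (fo ?F y)" for x y h
    using bijective_functor_lift_hom[OF M(3) oinj _ that] aim by blast

  have p0: "pi0_map D f (component ?G x) = component ?H (fo ?F x)" if x: "x \<in> gobj ?G" for x
  proof -
    have const: "component ?H (fo ?F y) = component ?H (fo ?F x)" if y: "y \<in> component ?G x" for y
    proof -
      obtain t where "t \<in> ghom ?G x y" using y by (auto simp: component_def)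
      then show ?thesis by (rule component_eqI[OF M(2) F(4)])
    qed
    show ?thesis
      unfolding pi0_map_def by (rule UN_constant_eq[OF self_in_component[OF M(1) x] ballI[OF const]])
  qed
  have comp: "component ?G x = component ?G y"
    if x: "x \<in> gobj ?G" and y: "y \<in> gobj ?G" and e: "component ?H (fo ?F x) = component ?H (fo ?F y)" for x y
  proof -
    have "fo ?F x \<in> component ?H (fo ?F y)" using e self_in_component[OF M(2) F(3)[OF x]] by simp
    then obtain h where "h \<in> ghom ?H (fo ?F y) (fo ?F x)" by (auto simp: component_def)
    then obtain t where "t \<in> ghom ?G y x" using lift[OF y x] by auto
    then show ?thesis by (rule component_eqI[OF M(1)])
  qed
  have "bij_betw (pi0_map D f) (pi0 C) (pi0 D)"
    unfolding bij_betw_def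
  proof
    show "inj_on (pi0_map D f) (pi0 C)"
    proof (rule inj_onI)
      fix c d assume "c \<in> pi0 C" "d \<in> pi0 C" and e: "pi0_map D f c = pi0_map D f d"
      then obtain x y where x: "x \<in> gobj ?G" "c = component ?G x" and y: "y \<in> gobj ?G" "d = component ?G y"
        by (auto simp: pi0_def)
      show "c = d" unfolding x(2) y(2)
        by (rule comp[OF x(1) y(1)]) (use e p0[OF x(1)] p0[OF y(1)] x(2) y(2) in simp)
    qed
    show "pi0_map D f ` pi0 C = pi0 D"
      unfolding pi0_def oim[symmetric] image_image using p0 by (intro image_cong) simp_all
  qed
  moreover have "is_equivalence (pi1 C) (pi1 D) (pi1_map D f)"
  proof (rule bijective_functor_equivalence[OF pi1_map_functor[OF f]])
    show "bij_betw (fo (pi1_map D f)) (gobj (pi1 C)) (gobj (pi1 D))"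
      using o by (simp add: pi1_map_def pi1_gobj[OF M(1)] pi1_gobj[OF M(2)])
    have "k \<in> pi1_class C h" if k: "k \<in> garr ?G" and h: "h \<in> garr ?G"
      and e: "pi1_class D (fa ?F k) = pi1_class D (fa ?F h)" for k h
    proof -
      note hh = garr_in_ghom[OF h]
      have y: "gtgt ?G h \<in> gobj ?G" by (rule garr_obj(2)[OF F(1) h])
      have "fa ?F k \<in> pi1_class D (fa ?F h)"
        using pi1_class_ghom(3)[OF M(2) F(4)[OF garr_in_ghom[OF k]]] e by simp
      then obtain v where v: "v \<in> elts D 2 (fo ?F (gtgt ?G h))"
        "fa ?F k = gcomp ?H (bd2 D (fo ?F (gtgt ?G h)) v) (fa ?F h)"
        by (auto simp: pi1_class_ghom(1)[OF M(2) F(4)[OF hh]] bd2_im_def)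
      obtain u where u: "u \<in> elts C 2 (gtgt ?G h)" "v = mcmp f 2 (gtgt ?G h) u"
        using v(1) gim[OF _ y, of 2] by auto
      note b = bd2_ghom[OF M(1) y u(1)]
      have "fa ?F k = fa ?F (gcomp ?G (bd2 C (gtgt ?G h) u) h)"
        using v(2) u(2) M(7)[OF y u(1)] F(6)[OF hh b] by simp
      then have "k = gcomp ?G (bd2 C (gtgt ?G h) u) h"
        using inj_onD[OF ainj _ k ghomD(1)[OF gcomp_hom[OF F(1) hh b]]] by simp
      then show ?thesis using u(1) by (auto simp: pi1_class_ghom(1)[OF M(1) hh] bd2_im_def)
    qed
    note same = this
    have "inj_on (fa (pi1_map D f)) (garr (pi1 C))"
    proof (rule inj_onI)
      fix A B assume "A \<in> garr (pi1 C)" "B \<in> garr (pi1 C)" and e: "fa (pi1_map D f) A = fa (pi1_map D f) B"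
      then obtain k h where k: "k \<in> garr ?G" "A = pi1_class C k" and h: "h \<in> garr ?G" "B = pi1_class C h"
        by (auto simp: pi1_garr[OF M(1)])
      have "k \<in> pi1_class C h"
        using same[OF k(1) h(1)] e k(2) h(2) pi1_map_class[OF f k(1)] pi1_map_class[OF f h(1)] by simp
      then show "A = B" unfolding k(2) h(2) by (rule pi1_class_eqI[OF M(1) garr_in_ghom[OF h(1)]])
    qed
    moreover have "fa (pi1_map D f) ` garr (pi1 C) = garr (pi1 D)"
      unfolding pi1_garr[OF M(1)] pi1_garr[OF M(2)] aim[symmetric] image_image
      by (intro image_cong) (simp_all add: pi1_map_class[OF f])
    ultimately show "bij_betw (fa (pi1_map D f)) (garr (pi1 C)) (garr (pi1 D))" by (simp add: bij_betw_def)
  qed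
  moreover have "pin_map D f n x \<in> iso (pin C n x) (pin D n (fo ?F x))" if n: "n \<ge> 2" and x: "x \<in> gobj ?G" for n x
  proof -
    let ?y = "fo ?F x" and ?I = "bd_im C (n + 1) x" and ?J = "bd_im D (n + 1) (fo ?F x)"
    let ?A = "cgrp C n x" and ?B = "cgrp D n ?y"
    have y: "?y \<in> gobj ?H" by (rule F(3)[OF x])
    interpret A: group ?A by (rule cgrp_group[OF M(1) n x])
    interpret B: group ?B by (rule cgrp_group[OF M(2) n y])
    have I: "?I \<lhd> ?A" and J: "?J \<lhd> ?B" using bd_im_normal[OF M(1) n x] bd_im_normal[OF M(2) n y] .
    note al = M(4)[OF n x]
    note map = pin_map_coset[OF f n x]
    have sub: "u \<in> carrier ?A" if "u \<in> bd_ker C n x" for u by (rule subsetD[OF bd_ker_subset[OF n] that])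
    have ker: "mcmp f n x ` bd_ker C n x = bd_ker D n ?y"
    proof (cases "n = 2")
      case True
      have "bd2 D ?y (mcmp f 2 x u) = gid ?H ?y \<longleftrightarrow> bd2 C x u = gid ?G x" if u: "u \<in> elts C 2 x" for u
        using M(7)[OF x u] F(5)[OF x] inj_on_eq_iff[OF ainj ghomD(1)[OF bd2_ghom[OF M(1) x u]]
            ghomD(1)[OF gid_hom[OF F(1) x]]] by simp
      then show ?thesis
        using image_Collect_iff[OF gim[OF n x], of "\<lambda>v. bd2 D ?y v = gid ?H ?y" "\<lambda>u. bd2 C x u = gid ?G x"] True
        by (simp add: bd_ker_def)
    next
      case False
      then have n3: "n \<ge> 3" "n - 1 \<ge> 2" using n by simp_all
      have one: "mcmp f (n - 1) x (neutral C (n - 1) x) = neutral D (n - 1) ?y"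
        by (rule hom_one[OF M(4)[OF n3(2) x] cgrp_group[OF M(1) n3(2) x] cgrp_group[OF M(2) n3(2) y]])
      have one': "neutral C (n - 1) x \<in> elts C (n - 1) x"
        by (rule monoid.one_closed[OF group.is_monoid[OF cgrp_group[OF M(1) n3(2) x]]])
      have "bd D n ?y (mcmp f n x u) = neutral D (n - 1) ?y \<longleftrightarrow> bd C n x u = neutral C (n - 1) x"
        if u: "u \<in> carrier ?A" for u
        using M(8)[OF n3(1) x u] one
          inj_on_eq_iff[OF ginj[OF n3(2) x] hom_in_carrier[OF crossed_complexD(5)[OF M(1) n3(1) x] u] one']
        by simp
      then show ?thesis
        using image_Collect_iff[OF gim[OF n x], of "\<lambda>v. bd D n ?y v = neutral D (n - 1) ?y"
            "\<lambda>u. bd C n x u = neutral C (n - 1) x"] False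
        by (simp add: bd_ker_def)
    qed
    have hom: "pin_map D f n x \<in> hom (pin C n x) (pin D n ?y)"
    proof (rule homI)
      fix U assume "U \<in> carrier (pin C n x)"
      then obtain u where u: "u \<in> bd_ker C n x" "U = ?I #>\<^bsub>?A\<^esub> u" by (auto simp: pin_simps)
      show "pin_map D f n x U \<in> carrier (pin D n ?y)"
        unfolding u(2) map[OF sub[OF u(1)]] pin_simps ker[symmetric] by (intro imageI u(1))
      fix V assume "V \<in> carrier (pin C n x)"
      then obtain v where v: "v \<in> bd_ker C n x" "V = ?I #>\<^bsub>?A\<^esub> v" by (auto simp: pin_simps)
      note u' = sub[OF u(1)] and v' = sub[OF v(1)]
      have "pin_map D f n x (U <#>\<^bsub>?A\<^esub> V) = ?J #>\<^bsub>?B\<^esub> mcmp f n x (u \<otimes>\<^bsub>?A\<^esub> v)"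
        unfolding u(2) v(2) normal.rcos_sum[OF I u' v'] by (rule map[OF A.m_closed[OF u' v']])
      also have "\<dots> = pin_map D f n x U <#>\<^bsub>?B\<^esub> pin_map D f n x V"
        unfolding u(2) v(2) map[OF u'] map[OF v'] hom_mult[OF al u' v']
        by (rule normal.rcos_sum[OF J hom_in_carrier[OF al u'] hom_in_carrier[OF al v'], symmetric])
      finally show "pin_map D f n x (U \<otimes>\<^bsub>pin C n x\<^esub> V) = pin_map D f n x U \<otimes>\<^bsub>pin D n ?y\<^esub> pin_map D f n x V"
        by (simp add: pin_simps)
    qed
    have "inj_on (pin_map D f n x) (carrier (pin C n x))"
    proof (rule inj_onI)
      fix U V assume "U \<in> carrier (pin C n x)" "V \<in> carrier (pin C n x)"
        and e: "pin_map D f n x U = pin_map D f n x V"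
      then obtain u v where u: "u \<in> bd_ker C n x" "U = ?I #>\<^bsub>?A\<^esub> u" and v: "v \<in> bd_ker C n x" "V = ?I #>\<^bsub>?A\<^esub> v"
        by (auto simp: pin_simps)
      note u' = sub[OF u(1)] and v' = sub[OF v(1)]
      have "mcmp f n x u \<in> ?J #>\<^bsub>?B\<^esub> mcmp f n x v"
        using e B.rcos_self[OF hom_in_carrier[OF al u'] normal_imp_subgroup[OF J]]
        unfolding u(2) v(2) map[OF u'] map[OF v'] by simp
      then obtain w where w: "w \<in> elts D (n + 1) ?y" "mcmp f n x u = bd D (n + 1) ?y w \<otimes>\<^bsub>?B\<^esub> mcmp f n x v"
        by (auto simp: r_coset_def bd_im_def)
      obtain w' where w': "w' \<in> elts C (n + 1) x" "w = mcmp f (n + 1) x w'"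
        using w(1) gim[OF _ x, of "n + 1"] n by auto
      have b: "bd C (n + 1) x w' \<in> carrier ?A"
        using hom_in_carrier[OF crossed_complexD(5)[OF M(1) _ x] w'(1)] n by simp
      have "mcmp f n x u = mcmp f n x (bd C (n + 1) x w' \<otimes>\<^bsub>?A\<^esub> v)"
        using w(2) w'(2) M(8)[OF _ x w'(1)] n hom_mult[OF al b v'] by simp
      then have "u = bd C (n + 1) x w' \<otimes>\<^bsub>?A\<^esub> v"
        using inj_onD[OF ginj[OF n x] _ u' A.m_closed[OF b v']] by simp
      then have "u \<in> ?I #>\<^bsub>?A\<^esub> v" using w'(1) by (auto simp: r_coset_def bd_im_def)
      then show "U = V" unfolding u(2) v(2)
        using A.repr_independence[OF _ v' normal_imp_subgroup[OF I]] by simp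
    qed
    moreover have "pin_map D f n x ` carrier (pin C n x) = carrier (pin D n ?y)"
      unfolding pin_simps ker[symmetric] image_image by (intro image_cong) (simp_all only: map sub)
    ultimately show ?thesis using hom by (simp add: iso_def bij_betw_def)
  qed
  ultimately show ?thesis using f unfolding weak_equivalence_def by (intro conjI allI impI ballI)
qed

section \<open>The inverse limit of the truncations\<close>

text \<open>From index \<open>k\<close> on, the lift \<open>s\<close> of \<open>X n\<close> is unique, and a lift of \<open>X (n + 1)\<close> is one of
  \<open>X n\<close> by compatibility; so \<open>s\<close> is independent of \<open>n\<close>. Applying the maps \<open>e\<close> to \<open>X k\<close>
  gives the coordinates below \<open>k\<close>.\<close>

lemma compatible_sequence_lift:
  assumes surj: "\<And>n. n \<ge> k \<Longrightarrow> X n \<in> q n ` S" and inj: "\<And>n. n \<ge> k \<Longrightarrow> inj_on (q n) S"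
    and q: "\<And>n s. s \<in> S \<Longrightarrow> e n (q (Suc n) s) = q n s" and X: "\<And>n. e n (X (Suc n)) = X n"
  shows "\<exists>s\<in>S. X = (\<lambda>n. q n s)"
proof -
  obtain s where s: "s \<in> S" "X k = q k s" using surj[of k] by blast
  have up: "X (k + i) = q (k + i) s" for i
  proof (induction i)
    case (Suc i)
    obtain r where r: "r \<in> S" "X (k + Suc i) = q (k + Suc i) r" using surj[of "k + Suc i"] by auto
    have "q (k + i) r = X (k + i)" using q[OF r(1), of "k + i"] X[of "k + i"] r(2) by simp
    then have "r = s" using inj_onD[OF inj[of "k + i"] _ r(1) s(1)] Suc by simp
    then show ?case using r by simp
  qed (use s in simp)
  have down: "X (k - i) = q (k - i) s" for i
  proof (induction i)
    case (Suc i)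
    show ?case
    proof (cases "i < k")
      case True
      then have "Suc (k - Suc i) = k - i" by simp
      then show ?thesis using X[of "k - Suc i"] q[OF s(1), of "k - Suc i"] Suc by simp
    qed (use Suc in simp)
  qed (use s in simp)
  have "X n = q n s" for n
    using up[of "n - k"] down[of "k - n"] by (cases "k \<le> n") simp_all
  then show ?thesis using s(1) by auto
qed

text \<open>Injectivity of the units begins at index 1 on objects, at index 2 on arrows and at index
  \<open>m + 1\<close> on elements of dimension \<open>m\<close>, where \<open>P\<^sub>n\<close> contains the singletons of \<open>C\<close>.\<close>

lemma P_unit_lift_weak_equivalence:
  assumes C: "crossed_complex C"
  shows "weak_equivalence C (inverse_limit (P C) (eta C)) (lim_lift (P_unit C))"
proof -
  let ?L = "inverse_limit (P C) (eta C)" and ?f = "lim_lift (P_unit C)" and ?G = "base C"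
  have tower: "\<And>n. cc_morphism (P C (Suc n)) (P C n) (eta C (Suc n))"
    using eta_morphism[OF C, of "Suc n" for n] by simp
  note eo = eta_P_unit_fo[OF C, of "Suc n" for n, simplified]
    and ea = eta_P_unit_fa[OF C, of "Suc n" for n, simplified]
    and em = eta_P_unit_mcmp[OF C, of "Suc n" for n, simplified]
  have "cc_mor_eq C (cc_comp (eta C (Suc n)) (P_unit C (Suc n))) (P_unit C n)" for n
    using eo ea em by (simp add: cc_mor_eq_def cc_comp_def)
  then have f: "cc_morphism C ?L ?f"
    by (intro lim_lift_morphism tower P_unit_morphism[OF C])
  note FF = is_functorD[OF cc_morphismD(3)[OF f]]
  have s: "ob ?f x = (\<lambda>n. ob (P_unit C n) x)" "ar ?f t = (\<lambda>n. ar (P_unit C n) t)"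
    "mcmp ?f m x u = (\<lambda>n. mcmp (P_unit C n) m x u)" for x t m u
    by (simp_all add: lim_lift_def)
  have gq: "gpd_quotient ?G (base (P C n)) (mbase (P_unit C n))" if "n \<ge> 1" for n
    using P_unit_quotient[OF C that] by (simp add: cc_quotient_def)
  have "bij_betw (ob ?f) (gobj ?G) (objs ?L)"
    unfolding bij_betw_def
  proof
    show "inj_on (ob ?f) (gobj ?G)"
    proof (rule inj_onI)
      fix x y assume "ob ?f x = ob ?f y"
      then have "ob (P_unit C 1) x = ob (P_unit C 1) y" unfolding s by (rule fun_cong)
      then show "x = y" by (simp add: P_unit_def)
    qed
    have "X \<in> ob ?f ` gobj ?G" if X: "X \<in> objs ?L" for X
    proof -
      have "\<exists>x\<in>gobj ?G. X = (\<lambda>n. ob (P_unit C n) x)"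
      proof (rule compatible_sequence_lift[where k = 1 and e = "\<lambda>n. ob (eta C (Suc n))"])
        show "X n \<in> ob (P_unit C n) ` gobj ?G" if "n \<ge> 1" for n
        proof -
          have "ob (P_unit C n) ` gobj ?G = objs (P C n)"
            using gq[OF that] by (simp add: gpd_quotient_def bij_betw_def)
          then show ?thesis using X by (simp add: lim_simps)
        qed
        show "inj_on (ob (P_unit C n)) (gobj ?G)" if "n \<ge> 1" for n
          using gq[OF that] by (simp add: gpd_quotient_def bij_betw_def)
      qed (use eo X in \<open>simp_all add: lim_simps\<close>)
      then show ?thesis unfolding s by blast
    qed
    then show "ob ?f ` gobj ?G = objs ?L" using FF(3) by blast
  qed
  moreover have "bij_betw (ar ?f) (garr ?G) (garr (base ?L))"
    unfolding bij_betw_def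
  proof
    show "inj_on (ar ?f) (garr ?G)"
    proof (rule inj_onI)
      fix g h assume "ar ?f g = ar ?f h"
      then have "ar (P_unit C 2) g = ar (P_unit C 2) h" unfolding s by (rule fun_cong)
      then show "g = h" by (simp add: P_unit_def)
    qed
    have "A \<in> ar ?f ` garr ?G" if A: "A \<in> garr (base ?L)" for A
    proof -
      have A': "A n \<in> garr (base (P C n))" "ar (eta C (Suc n)) (A (Suc n)) = A n" for n
        using A by (simp_all add: inverse_limit_def lim_base_def)
      have "\<exists>g\<in>garr ?G. A = (\<lambda>n. ar (P_unit C n) g)"
      proof (rule compatible_sequence_lift[where k = 2 and e = "\<lambda>n. ar (eta C (Suc n))"])
        show "A n \<in> ar (P_unit C n) ` garr ?G" if "n \<ge> 2" for n
          using A'(1)[of n] gq[of n] that by (simp add: gpd_quotient_def)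
        show "inj_on (ar (P_unit C n)) (garr ?G)" if "n \<ge> 2" for n
          using that by (simp add: P_unit_def inj_on_def)
      qed (use ea A' in simp_all)
      then show ?thesis unfolding s by blast
    qed
    moreover have "ar ?f g \<in> garr (base ?L)" if "g \<in> garr ?G" for g
      using ghomD(1)[OF FF(4)[OF garr_in_ghom[OF that]]] .
    ultimately show "ar ?f ` garr ?G = garr (base ?L)" by blast
  qed
  moreover have "bij_betw (mcmp ?f m x) (elts C m x) (elts ?L m (ob ?f x))"
    if m: "m \<ge> 2" and x: "x \<in> gobj ?G" for m x
    unfolding bij_betw_def
  proof
    have inj: "inj_on (mcmp (P_unit C n) m x) (elts C m x)" if n: "n \<ge> Suc m" for n
    proof -
      have "m < n" using n by simp
      then show ?thesis
        using P_sub_one_coset[OF C m _ x] by (intro inj_onI) (auto simp: P_unit_def)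
    qed
    show "inj_on (mcmp ?f m x) (elts C m x)"
    proof (rule inj_onI)
      fix u v assume u: "u \<in> elts C m x" and v: "v \<in> elts C m x"
        and e: "mcmp ?f m x u = mcmp ?f m x v"
      have "mcmp (P_unit C (Suc m)) m x u = mcmp (P_unit C (Suc m)) m x v"
        using e unfolding s by (rule fun_cong)
      then show "u = v" by (rule inj_onD[OF inj[OF order_refl] _ u v])
    qed
    have "U \<in> mcmp ?f m x ` elts C m x" if U: "U \<in> elts ?L m (ob ?f x)" for U
    proof -
      have U': "U n \<in> elts (P C n) m (ob (P_unit C n) x)"
        "mcmp (eta C (Suc n)) m (ob (P_unit C (Suc n)) x) (U (Suc n)) = U n" for n
        using U by (simp_all add: lim_simps s)
      have "\<exists>u\<in>elts C m x. U = (\<lambda>n. mcmp (P_unit C n) m x u)"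
      proof (rule compatible_sequence_lift[where k = "Suc m" and
            e = "\<lambda>n. mcmp (eta C (Suc n)) m (ob (P_unit C (Suc n)) x)"])
        show "U n \<in> mcmp (P_unit C n) m x ` elts C m x" if "n \<ge> Suc m" for n
          using U'(1)[of n] P_unit_quotient[OF C, of n] that m x by (simp add: cc_quotient_def)
      qed (use em[OF m x] U' inj in simp_all)
      then show ?thesis unfolding s by blast
    qed
    moreover have "mcmp ?f m x u \<in> elts ?L m (ob ?f x)" if "u \<in> elts C m x" for u
      using hom_in_carrier[OF cc_morphismD(4)[OF f m x] that] .
    ultimately show "mcmp ?f m x ` elts C m x = elts ?L m (ob ?f x)" by blast
  qed
  ultimately show ?thesis by (rule bijective_weak_equivalence[OF f])
qed

section \<open>The homotopy type of the fibers\<close>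

context
  fixes C :: "('o, 'm, 'a) ccx"
  assumes C: "crossed_complex C"
begin

lemma cc_connectedI:
  assumes x: "x \<in> objs C" and c: "\<And>y. y \<in> objs C \<Longrightarrow> homs C x y \<noteq> {}"
  shows "cc_connected C"
proof -
  have const: "component (base C) y = component (base C) x" if y: "y \<in> objs C" for y
  proof -
    obtain t where "t \<in> homs C x y" using c[OF y] by auto
    then show ?thesis by (rule component_eqI[OF C])
  qed
  have "pi0 C = (\<lambda>y. component (base C) x) ` objs C"
    unfolding pi0_def by (rule image_cong[OF refl const])
  also have "\<dots> = {component (base C) x}" by (rule image_constant[OF x])
  finally show ?thesis unfolding cc_connected_def by (rule exI)
qed

lemma pi1_trivial:
  assumes x: "x \<in> objs C" and s: "homs C x x \<subseteq> bd2_im C x"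
  shows "carrier (End_group (pi1 C) x) = {gid (pi1 C) x}"
proof -
  let ?G = "base C"
  note G = crossed_complexD(1)[OF C]
  note i = gid_hom[OF G x]
  have "pi1_class C g = pi1_class C (gid ?G x)" if g: "g \<in> ghom ?G x x" for g
  proof (rule pi1_class_eqI[OF C i])
    have "g = gcomp ?G g (gid ?G x)" using gcomp_id(1)[OF G g] by simp
    then show "g \<in> pi1_class C (gid ?G x)" unfolding pi1_class_ghom(1)[OF C i] using s g by blast
  qed
  then have "pi1_class C ` ghom ?G x x = {pi1_class C (gid ?G x)}" using i by blast
  then show ?thesis by (simp add: End_group_def pi1_ghom[OF C] pi1_gid[OF C])
qed

lemma pi1_iso_base:
  assumes x: "x \<in> objs C" and s: "bd2_im C x = {gid (base C) x}"
  shows "End_group (pi1 C) x \<cong> End_group (base C) x"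
proof -
  let ?G = "base C"
  note G = crossed_complexD(1)[OF C]
  have c: "pi1_class C g = {g}" if g: "g \<in> ghom ?G x x" for g
    unfolding pi1_class_ghom(1)[OF C g] s using gcomp_id(2)[OF G g] by simp
  have "pi1_class C \<in> iso (End_group ?G x) (End_group (pi1 C) x)"
    unfolding iso_def
  proof (intro CollectI conjI homI)
    show "bij_betw (pi1_class C) (carrier (End_group ?G x)) (carrier (End_group (pi1 C) x))"
      using c by (auto simp: End_group_def pi1_ghom[OF C] bij_betw_def inj_on_def)
    fix g h assume g: "g \<in> carrier (End_group ?G x)" and h: "h \<in> carrier (End_group ?G x)"
    show "pi1_class C g \<in> carrier (End_group (pi1 C) x)"
      using g by (simp add: End_group_def pi1_ghom[OF C])
    show "pi1_class C (g \<otimes>\<^bsub>End_group ?G x\<^esub> h) = pi1_class C g \<otimes>\<^bsub>End_group (pi1 C) x\<^esub> pi1_class C h"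
      using g h pi1_gcomp[OF C, of h x x g x] by (simp add: End_group_def)
  qed
  then show ?thesis
    using group.iso_sym[OF End_group_group[OF G x]] by (auto simp: is_iso_def)
qed

lemma bd_ker_subgroup:
  assumes n: "n \<ge> 2" and x: "x \<in> objs C"
  shows "subgroup (bd_ker C n x) (cgrp C n x)"
proof (cases "n = 2")
  case True
  note G = crossed_complexD(1)[OF C]
  have "bd2 C x \<in> hom (cgrp C 2 x) (End_group (base C) x)"
    by (rule homI) (simp_all add: End_group_def bd2_ghom[OF C x] bd2_mult[OF C x])
  then have "group_hom (cgrp C 2 x) (End_group (base C) x) (bd2 C x)"
    using cgrp_group[OF C _ x, of 2] End_group_group[OF G x] by (simp add: group_hom_def group_hom_axioms_def)
  from group_hom.subgroup_kernel[OF this] show ?thesis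
    using True by (simp add: bd_ker_def kernel_def End_group_def)
next
  case False
  then have n3: "n \<ge> 3" "n - 1 \<ge> 2" using n by simp_all
  have "group_hom (cgrp C n x) (cgrp C (n - 1) x) (bd C n x)"
    using crossed_complexD(5)[OF C n3(1) x] cgrp_group[OF C n x] cgrp_group[OF C n3(2) x]
    by (simp add: group_hom_def group_hom_axioms_def)
  from group_hom.subgroup_kernel[OF this] show ?thesis
    using False by (simp add: bd_ker_def kernel_def)
qed

lemma pin_trivial:
  assumes n: "n \<ge> 2" and x: "x \<in> objs C" and s: "bd_ker C n x \<subseteq> bd_im C (n + 1) x"
  shows "carrier (pin C n x) = {\<one>\<^bsub>pin C n x\<^esub>}"
proof -
  interpret A: group "cgrp C n x" by (rule cgrp_group[OF C n x])
  have I: "subgroup (bd_im C (n + 1) x) (cgrp C n x)"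
    using bd_im_normal[OF C n x] by (simp add: normal_imp_subgroup)
  have "bd_im C (n + 1) x #>\<^bsub>cgrp C n x\<^esub> u = bd_im C (n + 1) x" if "u \<in> bd_ker C n x" for u
    using A.coset_join2[OF _ I] s that subgroup.mem_carrier[OF I] by blast
  moreover have "neutral C n x \<in> bd_ker C n x" by (rule subgroup.one_closed[OF bd_ker_subgroup[OF n x]])
  ultimately show ?thesis unfolding pin_simps by blast
qed

lemma pin_trivial_of_trivial_group:
  assumes n: "n \<ge> 2" and x: "x \<in> objs C" and s: "elts C n x \<subseteq> {neutral C n x}"
  shows "carrier (pin C n x) = {\<one>\<^bsub>pin C n x\<^esub>}"
proof (rule pin_trivial[OF n x])
  have "neutral C n x \<in> bd_im C (n + 1) x"
    using bd_im_normal[OF C n x] by (simp add: normal_imp_subgroup subgroup.one_closed)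
  then have "{neutral C n x} \<subseteq> bd_im C (n + 1) x" by simp
  then show "bd_ker C n x \<subseteq> bd_im C (n + 1) x"
    by (rule subset_trans[OF subset_trans[OF bd_ker_subset[OF n] s]])
qed

text \<open>An element with trivial boundary acts trivially, hence is central by the Peiffer rule.\<close>

lemma bd_ker_comm_group:
  assumes n: "n \<ge> 2" and x: "x \<in> objs C"
  shows "comm_group ((cgrp C n x)\<lparr>carrier := bd_ker C n x\<rparr>)"
proof -
  note CD = crossed_complexD[OF C] and X = crossed_moduleD[OF crossed_complexD(2)[OF C n]]
  interpret A: group "cgrp C n x" by (rule cgrp_group[OF C n x])
  note s = bd_ker_subgroup[OF n x]
  have "u \<otimes>\<^bsub>cgrp C n x\<^esub> v = v \<otimes>\<^bsub>cgrp C n x\<^esub> u" if u: "u \<in> bd_ker C n x" and v: "v \<in> elts C n x" for u v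
  proof -
    have u': "u \<in> elts C n x" by (rule subgroup.mem_carrier[OF s u])
    have "dlt (xm C n) x u = gid (base C) x"
    proof (cases "n = 2")
      case True
      then show ?thesis using CD(3)[OF x, of u] u u' by (simp add: bd_ker_def)
    next
      case False
      then show ?thesis using CD(4)[OF _ x u'] n by simp
    qed
    then have "u \<otimes>\<^bsub>cgrp C n x\<^esub> v \<otimes>\<^bsub>cgrp C n x\<^esub> inv\<^bsub>cgrp C n x\<^esub> u = v"
      using X(10)[OF x u' v] X(5)[OF x v] by simp
    then show ?thesis using A.inv_solve_right'[of v "u \<otimes>\<^bsub>cgrp C n x\<^esub> v" u] u' v by simp
  qed
  then show ?thesis
    using subgroup.mem_carrier[OF s]
    by (intro group.group_comm_groupI[OF subgroup.subgroup_is_group[OF s A.is_group]]) simp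
qed

text \<open>Without boundaries, the cosets in \<open>\<pi>\<^sub>n\<close> are singletons.\<close>

lemma pin_iso_bd_ker:
  assumes n: "n \<ge> 2" and x: "x \<in> objs C" and s: "bd_im C (n + 1) x = {neutral C n x}"
  shows "pin C n x \<cong> (cgrp C n x)\<lparr>carrier := bd_ker C n x\<rparr>"
proof -
  interpret A: group "cgrp C n x" by (rule cgrp_group[OF C n x])
  let ?K = "(cgrp C n x)\<lparr>carrier := bd_ker C n x\<rparr>"
  have K: "group ?K" by (rule comm_group.axioms(2)[OF bd_ker_comm_group[OF n x]])
  have c: "bd_im C (n + 1) x #>\<^bsub>cgrp C n x\<^esub> u = {u}" if "u \<in> bd_ker C n x" for u
    using subgroup.mem_carrier[OF bd_ker_subgroup[OF n x] that] unfolding s by (simp add: r_coset_def)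
  have car: "carrier (pin C n x) = (\<lambda>u. {u}) ` bd_ker C n x"
    unfolding pin_simps using c by (intro image_cong refl)
  have "(\<lambda>u. {u}) \<in> iso ?K (pin C n x)"
    unfolding iso_def
  proof (intro CollectI conjI homI)
    show "bij_betw (\<lambda>u. {u}) (carrier ?K) (carrier (pin C n x))"
      unfolding car by (simp add: bij_betw_def inj_on_def)
    show "{u} \<in> carrier (pin C n x)" if "u \<in> carrier ?K" for u
      unfolding car using that by simp
    show "{u \<otimes>\<^bsub>?K\<^esub> v} = {u} \<otimes>\<^bsub>pin C n x\<^esub> {v}" for u v
      unfolding pin_simps by (simp add: set_mult_def)
  qed
  then show ?thesis using group.iso_sym[OF K] by (auto simp: is_iso_def)
qed

end

context
  fixes C :: "('o, 'm, 'a) ccx"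
  assumes C: "crossed_complex C"
begin

lemma P_carrier_above:
  assumes "m > n" shows "elts (P C n) m X = {{}}" "neutral (P C n) m X = {}"
  using assms by (simp_all add: P_def P_xm_def)

lemma P_carrier:
  assumes n: "n \<ge> 1" and m: "m \<ge> 2" and x: "x \<in> objs C"
  shows "elts (P C n) m {x} = mcmp (P_unit C n) m x ` elts C m x"
proof -
  have "elts (P C n) m (ob (P_unit C n) x) = mcmp (P_unit C n) m x ` elts C m x"
    using P_unit_quotient[OF C n] m x by (simp add: cc_quotient_def)
  moreover have "ob (P_unit C n) x = {x}" using n by (simp add: P_unit_def)
  ultimately show ?thesis by simp
qed

lemma fiber_eta_carrier:
  assumes m: "m \<ge> 2" and x: "x \<in> objs C"
    and U: "U \<in> elts (cc_fiber (P C (Suc k)) (P C k) (eta C (Suc k)) X) m {x}"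
  obtains u where "u \<in> elts C m x" "U = mcmp (P_unit C (Suc k)) m x u"
    "mcmp (P_unit C k) m x u = neutral (P C k) m X"
proof -
  have U': "U \<in> elts (P C (Suc k)) m {x}" "mcmp (eta C (Suc k)) m {x} U = neutral (P C k) m X"
    using U by (simp_all add: cc_fiber_def)
  then obtain u where u: "u \<in> elts C m x" "U = mcmp (P_unit C (Suc k)) m x u"
    using P_carrier[of "Suc k", OF _ m x] by auto
  have "ob (P_unit C (Suc k)) x = {x}" by (simp add: P_unit_def)
  then show ?thesis using that u U'(2) eta_P_unit_mcmp[OF C, of "Suc k", OF _ m x u(1)] by simp
qed

text \<open>An arrow of \<open>\<pi>\<^sub>1\<close> between objects of one component lies in the fiber, as its image in \<open>P\<^sub>0\<close>
  can only be an identity arrow. So the fiber is connected, and its vertex groups are isomorphic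
  to that at any chosen object.\<close>

theorem fiber_eta_1:
  assumes X: "X \<in> objs (P C 0)"
  shows "\<exists>K :: 'm set monoid. of_type_K (cc_fiber (P C (Suc 0)) (P C 0) (eta C (Suc 0)) X) K (Suc 0)"
proof -
  let ?E = "cc_fiber (P C (Suc 0)) (P C 0) (eta C (Suc 0)) X" and ?G = "base C"
  have e: "cc_morphism (P C (Suc 0)) (P C 0) (eta C (Suc 0))" using eta_morphism[OF C, of "Suc 0"] by simp
  have E: "crossed_complex ?E" by (rule fiber_crossed_complex[OF e X])
  note S = fiber_simps[OF e X]
  note EF = is_functorD[OF cc_morphismD(3)[OF e]]
  note UF = is_functorD[OF cc_morphismD(3)[OF P_unit_morphism[OF C, of "Suc 0"]]]
  have obj: "Y \<in> objs ?E \<longleftrightarrow> (\<exists>y\<in>gobj ?G. Y = {y} \<and> component ?G y = X)" for Y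
    unfolding S by (auto simp: P_def P_base_def eta_def eta_base_def pi1_gobj[OF C])
  have hom: "homs ?E Y Z \<noteq> {}" if Y: "Y \<in> objs ?E" and Z: "Z \<in> objs ?E" for Y Z
  proof -
    obtain y z where y: "y \<in> gobj ?G" "Y = {y}" "component ?G y = X" and z: "z \<in> gobj ?G" "Z = {z}" "component ?G z = X"
      using Y Z unfolding obj by blast
    have "z \<in> component ?G y" using component_eq_iff[OF C z(1), of y] y(3) z(3) by simp
    then obtain t where t: "t \<in> ghom ?G y z" by (auto simp: component_def)
    let ?A = "ar (P_unit C (Suc 0)) t"
    have A: "?A \<in> homs (P C (Suc 0)) Y Z" using UF(4)[OF t] y z by (simp add: P_unit_def)
    have "ar (eta C (Suc 0)) ?A \<in> homs (P C 0) (ob (eta C (Suc 0)) Y) (ob (eta C (Suc 0)) Z)"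
      by (rule EF(4)[OF A])
    moreover have "ob (eta C (Suc 0)) Y = X" using Y by (simp add: S)
    ultimately have "ar (eta C (Suc 0)) ?A = component_arrows C X"
      by (simp add: P0_base(3)[OF C] split: if_splits)
    moreover have "gid (base (P C 0)) X = component_arrows C X" by (simp add: P_def P_base_def Let_def)
    ultimately have "?A \<in> homs ?E Y Z" using A by (simp add: fiber_ghom[OF e X])
    then show ?thesis by blast
  qed
  obtain x where x: "x \<in> gobj ?G" "X = component ?G x" using X by (auto simp: P_def P_base_def Let_def pi0_def)
  have o: "{x} \<in> objs ?E" using x obj by auto
  have triv: "bd2_im ?E Y = {gid (base ?E) Y}" if Y: "Y \<in> objs ?E" for Y
  proof -
    have "bd2_im ?E Y \<subseteq> {gid (base ?E) Y}" unfolding bd2_im_def S by (auto simp: P_def)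
    then show ?thesis using gid_in_bd2_im[OF E Y] by auto
  qed
  \<comment> \<open>All groups of the fiber are trivial, so dividing by the image of \<open>\<partial>\<^sub>2\<close> changes nothing and
    a vertex group of the fiber serves as \<open>\<Pi>\<close>.\<close>
  let ?K = "End_group (base ?E) {x}"
  have K: "group ?K" by (rule End_group_group[OF crossed_complexD(1)[OF E] o])
  have "End_group (pi1 ?E) Y \<cong> ?K" if Y: "Y \<in> objs ?E" for Y
  proof -
    obtain t where "t \<in> homs ?E Y {x}" using hom[OF Y o] by blast
    then have "End_group (base ?E) Y \<cong> ?K" by (rule End_group_iso[OF crossed_complexD(1)[OF E]])
    with pi1_iso_base[OF E Y triv[OF Y]] show ?thesis by (rule iso_trans)
  qed
  moreover have "carrier (pin ?E m Y) = {\<one>\<^bsub>pin ?E m Y\<^esub>}" if m: "m \<ge> 2" and Y: "Y \<in> objs ?E" for m Y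
    by (rule pin_trivial_of_trivial_group[OF E m Y]) (use m P_carrier_above[of "Suc 0" m] in \<open>auto simp: S\<close>)
  ultimately have "of_type_K ?E ?K (Suc 0)"
    unfolding of_type_K_def using E cc_connectedI[OF E o hom[OF o]] K by auto
  then show ?thesis by blast
qed

text \<open>Let \<open>n = k + 1\<close>. The elements of the fiber are the images \<open>q\<^sub>n u\<close> with \<open>q\<^bsub>n - 1\<^esub> u\<close> neutral. Below dimension
  \<open>n - 1\<close> this forces \<open>u = 1\<close>. In dimension \<open>n - 1\<close> it says that \<open>u\<close> is a boundary
  \<open>\<partial>\<^sub>n w\<close>, so that \<open>q\<^sub>n u\<close> bounds the element \<open>q\<^sub>n w\<close>, which belongs to the fiber because
  \<open>\<eta>\<^sub>n\<close> is trivial in dimension \<open>n\<close>. For \<open>n = 2\<close> the same argument with arrows in place of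
  elements shows that \<open>\<pi>\<^sub>1\<close> is trivial.\<close>

theorem fiber_eta:
  assumes k: "k \<ge> 1" and X: "X \<in> objs (P C k)"
  shows "\<exists>K :: 'a set monoid. of_type_K (cc_fiber (P C (Suc k)) (P C k) (eta C (Suc k)) X) K (Suc k)"
proof -
  define n where "n = Suc k"
  have n: "n \<ge> 2" "n \<ge> 1" "n - 1 = k" using k by (simp_all add: n_def)
  let ?E = "cc_fiber (P C n) (P C k) (eta C n) X" and ?G = "base C"
  have eta_fa: "t \<in> garr ?G \<Longrightarrow> ar (eta C n) (ar (P_unit C n) t) = ar (P_unit C k) t" for t
    using eta_P_unit_fa[OF C n(2)] n(3) by simp
  have eta_mcmp: "mcmp (eta C n) m (ob (P_unit C n) x) (mcmp (P_unit C n) m x u) = mcmp (P_unit C k) m x u"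
    if "m \<ge> 2" "x \<in> gobj ?G" "u \<in> elts C m x" for m x u
    using eta_P_unit_mcmp[OF C n(2) that] n(3) by simp
  have e: "cc_morphism (P C n) (P C k) (eta C n)" by (rule eta_morphism[OF C n(2), unfolded n(3)])
  have E: "crossed_complex ?E" by (rule fiber_crossed_complex[OF e X])
  note S = fiber_simps[OF e X] and CD = crossed_complexD[OF C]
  note U = cc_morphismD[OF P_unit_morphism[OF C, of n]]
  have q: "gpd_quotient ?G (base (P C k)) (mbase (P_unit C k))" if "k \<ge> 1" for k
    using P_unit_quotient[OF C that] by (simp add: cc_quotient_def)
  have fo: "ob (P_unit C k) y = {y}" if "k \<ge> 1" for k y using that by (simp add: P_unit_def)
  obtain x where x: "x \<in> gobj ?G" and Xx: "X = {x}"
    using gpd_quotient_lift_obj[OF q[OF k] X] fo[OF k] by auto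
  have foe: "ob (eta C n) Y = Y" for Y using n by (simp add: eta_def eta_base_def)
  have "X \<in> objs (P C n)" using is_functorD(3)[OF U(3) x] fo[OF n(2)] Xx by simp
  then have obj: "objs ?E = {X}" by (auto simp: S foe)
  then have o: "X \<in> objs ?E" by simp
  have one_E: "neutral ?E m X = mcmp (P_unit C n) m x (neutral C m x)" if "m \<ge> 2" for m
  proof -
    have "neutral (P C n) m (ob (P_unit C n) x) = mcmp (P_unit C n) m x (neutral C m x)"
      using P_unit_quotient[OF C n(2)] that x by (simp add: cc_quotient_def)
    then show ?thesis by (simp add: S fo[OF n(2)] Xx[symmetric])
  qed
  have in_E: "mcmp (P_unit C n) m x u \<in> elts ?E m X"
    if m: "m \<ge> 2" and u: "u \<in> elts C m x"
      and one: "mcmp (P_unit C k) m x u = neutral (P C k) m X" for m u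
    using hom_in_carrier[OF U(4)[OF m x] u] eta_mcmp[OF m x u] one fo[OF n(2)] by (simp add: S Xx[symmetric])
  have top: "mcmp (P_unit C k) m x u = neutral (P C k) m X" if "m \<ge> n" for m u
    using that n_def P_carrier_above(2)[of k m] by (simp add: P_unit_def)
  have low_one: "neutral (P C k) m X = P_sub C k m x" if "m \<le> k" for m
    using that Xx by (auto simp: P_def P_xm_def P_sub_def Let_def)
  have conn: "cc_connected ?E"
    by (rule cc_connectedI[OF E o]) (use obj gid_hom[OF crossed_complexD(1)[OF E] o] in auto)
  have pi1: "carrier (End_group (pi1 ?E) X) = {gid (pi1 ?E) X}"
  proof (rule pi1_trivial[OF E o], rule subsetI)
    fix g assume "g \<in> homs ?E X X"
    then have g: "g \<in> homs (P C n) X X" "ar (eta C n) g = gid (base (P C k)) X"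
      by (simp_all add: fiber_ghom[OF e X])
    obtain t where t: "t \<in> ghom ?G x x" "g = ar (P_unit C n) t"
      using gpd_quotient_lift_hom[OF CD(1) q[OF n(2)] x x] g(1) fo[OF n(2)] Xx by metis
    have "ar (P_unit C k) t = gid (base (P C k)) X"
      using eta_fa[OF ghomD(1)[OF t(1)]] t(2) g(2) by simp
    also have "\<dots> = ar (P_unit C k) (gid ?G x)"
      using q[OF k] x fo[OF k] Xx by (simp add: gpd_quotient_def)
    finally have same: "ar (P_unit C k) t = ar (P_unit C k) (gid ?G x)" .
    have gidE: "gid (base ?E) X = ar (P_unit C n) (gid ?G x)"
      using is_functorD(5)[OF U(3) x] fo[OF n(2)] by (simp add: S Xx[symmetric])
    show "g \<in> bd2_im ?E X"
    proof (cases "n = 2")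
      case True
      then have "pi1_class C t = pi1_class C (gid ?G x)" using same n_def by (simp add: P_unit_def)
      then obtain d where "d \<in> bd2_im C x" "t = gcomp ?G d (gid ?G x)"
        using pi1_class_ghom(3)[OF C t(1)] by (auto simp: pi1_class_ghom(1)[OF C gid_hom[OF CD(1) x]])
      then obtain u where u: "u \<in> elts C 2 x" "t = bd2 C x u"
        using gcomp_id(1)[OF CD(1) bd2_im_ghom[OF C x]] by (auto simp: bd2_im_def)
      have "g = bd2 ?E X (mcmp (P_unit C n) 2 x u)"
        using U(7)[OF x u(1)] t(2) u(2) fo[OF n(2)] by (simp add: S Xx[symmetric])
      moreover have "mcmp (P_unit C n) 2 x u \<in> elts ?E 2 X"
        by (rule in_E[OF _ u(1)]) (use top[of 2] True in simp_all)
      ultimately show ?thesis unfolding bd2_im_def by (rule image_eqI)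
    next
      case False
      then have "t = gid ?G x" using same k n_def by (simp add: P_unit_def)
      then have "g = gid (base ?E) X" using t(2) gidE by simp
      then show ?thesis using gid_in_bd2_im[OF E o] by simp
    qed
  qed
  have above: "elts ?E m X \<subseteq> {neutral ?E m X}" if "m > n" for m
    using P_carrier_above[OF that] by (auto simp: S)
  have im: "bd_im ?E (n + 1) X = {neutral ?E n X}"
  proof -
    have h: "bd ?E (n + 1) X \<in> hom (cgrp ?E (n + 1) X) (cgrp ?E n X)"
      using crossed_complexD(5)[OF E _ o, of "n + 1"] n by simp
    have g: "group (cgrp ?E (n + 1) X)" "group (cgrp ?E n X)" using cgrp_group[OF E _ o] n by simp_all
    have "elts ?E (n + 1) X = {neutral ?E (n + 1) X}"
      using above[of "n + 1"] monoid.one_closed[OF group.is_monoid[OF g(1)]] by auto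
    then show ?thesis using hom_one[OF h g] by (simp add: bd_im_def)
  qed
  have triv: "carrier (pin ?E m X) = {\<one>\<^bsub>pin ?E m X\<^esub>}" if m: "m \<ge> 2" "m \<noteq> n" for m
  proof -
    consider "m > n" | "m < k" | "m = k" using m n_def by linarith
    then show ?thesis
    proof cases
      case 1
      then show ?thesis by (intro pin_trivial_of_trivial_group[OF E m(1) o] above)
    next
      case 2
      show ?thesis
      proof (rule pin_trivial_of_trivial_group[OF E m(1) o], rule subsetI)
        fix V assume V: "V \<in> elts ?E m X"
        obtain u where u: "u \<in> elts C m x" "V = mcmp (P_unit C n) m x u"
          "mcmp (P_unit C k) m x u = neutral (P C k) m X"
          using fiber_eta_carrier[OF m(1) x] V unfolding Xx n_def by blast
        have "mcmp (P_unit C k) m x u = {u}"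
          using P_sub_one_coset[OF C m(1) 2 x u(1)] 2 by (simp add: P_unit_def)
        then have "u = neutral C m x" using u(3) low_one[of m] 2 by (simp add: P_sub_def)
        then show "V \<in> {neutral ?E m X}" using one_E[OF m(1)] u(2) by simp
      qed
    next
      case 3
      have n3: "n \<ge> 3" using 3 m n_def by simp
      show ?thesis
      proof (rule pin_trivial[OF E m(1) o], rule subsetI)
        fix V assume "V \<in> bd_ker ?E m X"
        then have V: "V \<in> elts ?E m X" by (rule subsetD[OF bd_ker_subset[OF m(1)]])
        obtain u where u: "u \<in> elts C m x" "V = mcmp (P_unit C n) m x u"
          "mcmp (P_unit C k) m x u = neutral (P C k) m X"
          using fiber_eta_carrier[OF m(1) x] V unfolding Xx n_def by blast
        have N: "subgroup (P_sub C k m x) (cgrp C m x)"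
          using P_sub_normal[OF C m(1) _ x, of "k"] 3 by (simp add: normal_imp_subgroup)
        have "P_sub C k m x #>\<^bsub>cgrp C m x\<^esub> u = P_sub C k m x"
          using u(3) low_one[of m] 3 by (simp add: P_unit_def)
        then have "u \<in> P_sub C k m x"
          using group.rcos_self[OF cgrp_group[OF C m(1) x] u(1) N] by simp
        then obtain w where w: "w \<in> elts C n x" "u = bd C n x w"
          using 3 by (auto simp: P_sub_def bd_im_def n_def)
        have "V = bd ?E n X (mcmp (P_unit C n) n x w)"
          using U(8)[OF n3 x w(1)] u(2) w(2) 3 n(3) fo[OF n(2)] by (simp add: S Xx[symmetric])
        moreover have "mcmp (P_unit C n) n x w \<in> elts ?E n X"
          by (rule in_E[OF n(1) w(1) top]) simp
        ultimately have "V \<in> bd_im ?E n X" unfolding bd_im_def by (rule image_eqI)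
        then show "V \<in> bd_im ?E (m + 1) X" using 3 n_def by simp
      qed
    qed
  qed
  \<comment> \<open>There is nothing above dimension \<open>n\<close>, so \<open>\<pi>\<^sub>n\<close> is the kernel of \<open>\<partial>\<^sub>n\<close> itself.\<close>
  have "of_type_K ?E ((cgrp ?E n X)\<lparr>carrier := bd_ker ?E n X\<rparr>) n"
    unfolding of_type_K_def
    using E conn n(1,2) obj pi1 triv bd_ker_comm_group[OF E n(1) o] pin_iso_bd_ker[OF E n(1) o im] by auto
  then show ?thesis unfolding n_def by blast
qed

end

theorem proposition3p3:
  fixes C :: "('o, 'm, 'a) ccx"
  assumes "crossed_complex C"
  shows "is_inverse_limit TYPE('x \<times> 'y \<times> 'z) (P C) (eta C) (inverse_limit (P C) (eta C)) lim_proj \<and>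
    same_homotopy_type (inverse_limit (P C) (eta C)) C \<and>
    (\<forall>n\<ge>1. cc_fibration (P C n) (P C (n - 1)) (eta C n)) \<and>
    (\<forall>x\<in>gobj (base (P C 0)). \<exists>K :: 'm set monoid.
       of_type_K (cc_fiber (P C 1) (P C 0) (eta C 1) x) K 1) \<and>
    (\<forall>n\<ge>2. \<forall>x\<in>gobj (base (P C (n - 1))). \<exists>K :: 'a set monoid.
       of_type_K (cc_fiber (P C n) (P C (n - 1)) (eta C n) x) K n)"
proof (intro conjI allI ballI impI)
  have tower: "cc_morphism (P C (Suc n)) (P C n) (eta C (Suc n))" for n
    using eta_morphism[OF assms, of "Suc n"] by simp
  show "is_inverse_limit TYPE('x \<times> 'y \<times> 'z) (P C) (eta C) (inverse_limit (P C) (eta C)) lim_proj"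
    by (rule inverse_limit_is_inverse_limit) (rule tower)
  have "weq_step (inverse_limit (P C) (eta C)) C"
    using P_unit_lift_weak_equivalence[OF assms] by (auto simp: weq_step_def)
  then show "same_homotopy_type (inverse_limit (P C) (eta C)) C"
    unfolding same_homotopy_type_def by blast
  show "cc_fibration (P C n) (P C (n - 1)) (eta C n)" if "n \<ge> 1" for n
    by (rule eta_fibration[OF assms that])
  show "\<exists>K :: 'm set monoid. of_type_K (cc_fiber (P C 1) (P C 0) (eta C 1) x) K 1"
    if "x \<in> gobj (base (P C 0))" for x
    using fiber_eta_1[OF assms that] by simp
  show "\<exists>K :: 'a set monoid. of_type_K (cc_fiber (P C n) (P C (n - 1)) (eta C n) x) K n"
    if "n \<ge> 2" "x \<in> gobj (base (P C (n - 1)))" for n x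
    using fiber_eta[OF assms, of "n - 1" x] that by simp
qed

end
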